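(* Let $q$ be an odd prime power, let $G=\mathrm{GU}(2,q)$ and $t=-I$. Let $E=\{z\in\mathbb{F}_{q^2}^\times: z^{q+1}=1\}$, let $Q$ be the subgroup of squares in $E$ (index $2$) and $R=E\setminus Q$ the set of non-squares in $E$. Let $\mathfrak{S}\subseteq G$ consist of the elements $g\in G$ that are similar (over $\mathbb{F}_{q^2}$) to one of: $\mathrm{diag}(1,-1)$; $\begin{bmatrix}x&1\\0&x\end{bmatrix}$ for some $x\in E$; $\mathrm{diag}(z,z^{-q})$ for some $z\in\mathbb{F}_{q^2}^\times\setminus E$ with $z^{q-1}\in\{1\}\cup R$. Then the Cayley graph $\Gamma=\mathrm{Cay}(G,\mathfrak{S})$ is connected, and for every $x\in G$ perfect state transfer occurs (at some time) between the vertices $x$ and $xt$ of $\Gamma$.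
   Context: $\mathrm{GU}(2,q)$ is the subgroup of $\mathrm{GL}(2,q^2)$ preserving a fixed nondegenerate hermitian form on $\mathbb{F}_{q^2}^2$; two of its elements are conjugate in $\mathrm{GU}(2,q)$ iff they are similar as matrices. $\mathrm{Cay}(G,\mathfrak{S})$ has vertex set $G$, $g\sim h$ iff $hg^{-1}\in\mathfrak{S}$. Perfect state transfer between vertices $a\neq b$ of a graph with adjacency matrix $A$ means $\exp(-i\tau A)e_a=\gamma e_b$ for some $\tau\in\mathbb{R}$ and $|\gamma|=1$. *)

theory Defs
  imports
    "HOL-Analysis.Analysis"
    "HOL-Algebra.Group"
    "HOL-Number_Theory.Prime_Powers"
    "Graph_Theory.Digraph_Component"
begin

definition similar_matrix :: "'a::field^'n^'n \<Rightarrow> 'a^'n^'n \<Rightarrow> bool" where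
  "similar_matrix A B \<longleftrightarrow> (\<exists>P. invertible P \<and> A = P ** B ** matrix_inv P)"

(* Here 'a plays the role of the field with q^2 elements, whose automorphism of order 2 is
   x \<mapsto> x^q.  A form is linear in its first and semilinear in its second argument. *)
definition hermitian_form :: "nat \<Rightarrow> ('a::field^'n \<Rightarrow> 'a^'n \<Rightarrow> 'a) \<Rightarrow> bool" where
  "hermitian_form q f \<longleftrightarrow>
     (\<forall>u v w. f (u + v) w = f u w + f v w) \<and>
     (\<forall>c u v. f (c *s u) v = c * f u v) \<and>
     (\<forall>u v. f v u = f u v ^ q)"

definition nondegenerate_form :: "('a::field^'n \<Rightarrow> 'a^'n \<Rightarrow> 'a) \<Rightarrow> bool" where
  "nondegenerate_form f \<longleftrightarrow> (\<forall>u. (\<forall>v. f u v = 0) \<longrightarrow> u = 0)"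

definition general_linear_group :: "('a::field^'n^'n) monoid" where
  "general_linear_group = \<lparr>carrier = {A. invertible A}, mult = (**), one = mat 1\<rparr>"

definition unitary_group :: "('a::field^'n \<Rightarrow> 'a^'n \<Rightarrow> 'a) \<Rightarrow> ('a^'n^'n) monoid" where
  "unitary_group f = general_linear_group
     \<lparr>carrier := {A \<in> carrier general_linear_group. \<forall>u v. f (A *v u) (A *v v) = f u v}\<rparr>"

(* An undirected graph is represented by a digraph with a symmetric set of arcs, which is what
   results here when S is closed under inverses. *)
definition Cay :: "('g, 'b) monoid_scheme \<Rightarrow> 'g set \<Rightarrow> 'g pair_pre_digraph" where
  "Cay G S = \<lparr>pverts = carrier G,
     parcs = {(g, h). g \<in> carrier G \<and> h \<in> carrier G \<and> h \<otimes>\<^bsub>G\<^esub> inv\<^bsub>G\<^esub> g \<in> S}\<rparr>"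

(* Square complex matrices with rows and columns indexed by a finite set V are functions
   of two arguments, of which only the values on V are relevant. *)
primrec mat_power :: "'v set \<Rightarrow> ('v \<Rightarrow> 'v \<Rightarrow> complex) \<Rightarrow> nat \<Rightarrow> 'v \<Rightarrow> 'v \<Rightarrow> complex" where
  "mat_power V A 0 = (\<lambda>u v. of_bool (u = v))"
| "mat_power V A (Suc k) = (\<lambda>u v. \<Sum>w\<in>V. A u w * mat_power V A k w v)"

definition mat_exp :: "'v set \<Rightarrow> ('v \<Rightarrow> 'v \<Rightarrow> complex) \<Rightarrow> 'v \<Rightarrow> 'v \<Rightarrow> complex" where
  "mat_exp V A = (\<lambda>u v. \<Sum>k. mat_power V A k u v / fact k)"

definition adjacency_matrix :: "'v pair_pre_digraph \<Rightarrow> 'v \<Rightarrow> 'v \<Rightarrow> complex" where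
  "adjacency_matrix \<Gamma> u v = of_bool ((u, v) \<in> parcs \<Gamma>)"

definition transition_matrix :: "'v pair_pre_digraph \<Rightarrow> real \<Rightarrow> 'v \<Rightarrow> 'v \<Rightarrow> complex" where
  "transition_matrix \<Gamma> \<tau> =
     mat_exp (pverts \<Gamma>) (\<lambda>u v. - \<i> * complex_of_real \<tau> * adjacency_matrix \<Gamma> u v)"

(* The last conjunct is the equation of vectors U e_a = \<gamma> e_b for the transition matrix U
   at time \<tau>: the left-hand side is column a of U. *)
definition perfect_state_transfer :: "'v pair_pre_digraph \<Rightarrow> 'v \<Rightarrow> 'v \<Rightarrow> bool" where
  "perfect_state_transfer \<Gamma> a b \<longleftrightarrow>
     a \<in> pverts \<Gamma> \<and> b \<in> pverts \<Gamma> \<and> a \<noteq> b \<and>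
     (\<exists>(\<tau>::real) (\<gamma>::complex). cmod \<gamma> = 1 \<and>
        (\<forall>v\<in>pverts \<Gamma>. transition_matrix \<Gamma> \<tau> v a = \<gamma> * of_bool (v = b)))"

definition norm_one_group :: "nat \<Rightarrow> 'a::field set" where
  "norm_one_group q = {z. z \<noteq> 0 \<and> z ^ (q + 1) = 1}"

definition norm_one_squares :: "nat \<Rightarrow> 'a::field set" where
  "norm_one_squares q = (\<lambda>w. w ^ 2) ` norm_one_group q"

definition norm_one_nonsquares :: "nat \<Rightarrow> 'a::field set" where
  "norm_one_nonsquares q = norm_one_group q - norm_one_squares q"

abbreviation mat2 :: "'a::zero \<Rightarrow> 'a \<Rightarrow> 'a \<Rightarrow> 'a \<Rightarrow> 'a^2^2" where
  "mat2 a b c d \<equiv> vector [vector [a, b], vector [c, d]]"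

definition connection_set :: "nat \<Rightarrow> ('a::field^2 \<Rightarrow> 'a^2 \<Rightarrow> 'a) \<Rightarrow> ('a^2^2) set" where
  "connection_set q f = {g \<in> carrier (unitary_group f).
     similar_matrix g (mat2 1 0 0 (-1)) \<or>
     (\<exists>x\<in>norm_one_group q. similar_matrix g (mat2 x 1 0 x)) \<or>
     (\<exists>z. z \<noteq> 0 \<and> z \<notin> norm_one_group q \<and> z ^ (q - 1) \<in> {1} \<union> norm_one_nonsquares q \<and>
        similar_matrix g (mat2 z 0 0 (z powi (- int q))))}"

end

(* The adjacency operator A is the sum of left translations by the connection set S, so it is a
   central operator.  Since S = -S, it vanishes on functions that are odd under x \<mapsto> -x.  In a
   basis where the form is a multiple of x1 y2^q - x2 y1^q, the q + 1 isotropic lines are the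
   projective line over the field with q elements, and each g in S is recognised by its determinant
   and its isotropic eigenlines.  Hence A is a linear combination of the class-sum operators M
   (number of isotropic eigenlines, weighted by a character of the determinant), U (transvections),
   Z (scalars) and D (determinant -1, trace 0).  On even functions these commute and satisfy
   polynomial relations with integer roots, the most delicate one being D^2 = (2q - U)^2, and
   running through the joint eigenvalues shows that A has only eigenvalues congruent to 2 modulo 4
   there.  So exp(-i (pi/2) A) is the identity on odd and minus the identity on even functions,
   that is, it maps e_x to -e_(-x).  The graph is connected because the transvections in S already
   act 2-transitively on the isotropic lines and S contains enough elements fixing two lines. *)

theory Submission imports Defs begin

text \<open>The residue 2 modulo 4 comes from \<open>Dk\<close> and \<open>Uk\<close> alone. Where
  \<open>Uk\<close> has eigenvalue u, \<open>Dk\<close> has eigenvalue 2q - u or u - 2q, so D - U is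
  2q - 2u or -2q. As u is even and q odd, both numbers are 2 modulo 4, and all other terms are
  multiples of 4 by parity and because 8 divides q^2 - 1. The root lists of the polynomial relations
  suffice for this; neither the irreducible characters nor the actual joint spectrum is computed.
  The relation for D^2 rests on a point count. For z of determinant 1, the ways to write z as a
  product of two elements of the class D are the points of a conic; if the trace of z does not
  square to 4, there are q + 1 minus the number of isotropic lines fixed by z. The same number of
  fixed lines enters U^2, which is how D^2 and U^2 become comparable. A relation D^2 = e^2 separates
  the eigenvalues e and -e only for nonzero e. At u = 2q it merely says D^2 = 0, and
  self-adjointness is what then yields D = 0.\<close>

lemma card_powers_eq_one_le:
  assumes "0 < n"
  shows "card {x::'a::{field,finite}. x ^ n = 1} \<le> n"
proof -
  have "coeff (monom (1::'a) n - 1) n = 1" using assms by simp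
  then have "monom (1::'a) n - 1 \<noteq> 0" by (metis coeff_0 zero_neq_one)
  moreover have "degree (monom (1::'a) n - 1) \<le> n"
    by (rule degree_diff_le) (simp_all add: degree_monom_le)
  ultimately have "card {x. poly (monom (1::'a) n - 1) x = 0} \<le> n"
    using card_poly_roots_bound le_trans by blast
  then show ?thesis by (simp add: poly_monom)
qed

lemma power_card_minus_one:
  fixes x :: "'a::{field,finite}"
  assumes "x \<noteq> 0"
  shows "x ^ (CARD('a) - 1) = 1"
proof -
  let ?P = "\<Prod>y\<in>UNIV - {0::'a}. y"
  have "bij_betw ((*) x) (UNIV - {0}) (UNIV - {0})"
    by (rule bij_betwI[where g = "\<lambda>y. y / x"]) (use assms in auto)
  then have "?P = (\<Prod>y\<in>UNIV - {0}. x * y)"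
    by (simp add: prod.reindex_bij_betw[of _ _ _ "\<lambda>y. y"])
  also have "\<dots> = x ^ (CARD('a) - 1) * ?P"
    by (simp add: prod.distrib card_Diff_singleton)
  finally show ?thesis by (simp add: prod_zero_iff)
qed

text \<open>Translation by 1 permutes the ring, so it leaves the sum of all elements unchanged while
  adding \<open>CARD('a)\<close> times 1 to it.\<close>

lemma CHAR_dvd_card: "CHAR('a::{comm_ring_1,finite}) dvd CARD('a)"
proof -
  have "(\<Sum>x\<in>UNIV. x + 1) = (\<Sum>x\<in>UNIV. x :: 'a)"
    by (rule sum.reindex_bij_witness[where i = "\<lambda>x. x - 1" and j = "\<lambda>x. x + 1"]) simp_all
  then have "of_nat CARD('a) = (0::'a)" by (simp add: sum.distrib)
  then show ?thesis by (simp add: of_nat_eq_0_iff_char_dvd)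
qed

text \<open>The n-th power map sends the nonzero elements into the m-th roots of unity, and all its
  nonempty fibres have the same size. The root bound limits the image to m elements and a fibre to
  n; since m * n elements are distributed, both bounds are attained. This replaces an appeal to
  cyclicity of the multiplicative group.\<close>

lemma
  fixes y :: "'a::{field,finite}"
  assumes mn: "CARD('a) - 1 = m * n"
  shows card_powers_eq_one: "card {x::'a. x ^ n = 1} = n"
    and card_powers_eq: "y ^ m = 1 \<Longrightarrow> card {x::'a. x ^ n = y} = n"
proof -
  let ?K = "{x::'a. x ^ n = 1}" and ?I = "(\<lambda>x::'a. x ^ n) ` (UNIV - {0})"
  have "1 < CARD('a)"
    using card_mono[of UNIV "{0, 1 :: 'a}"] by simp
  then have pos: "0 < m" "0 < n" using mn by (auto intro: Nat.gr0I)
  have fibre: "card {x::'a. x ^ n = z} = card ?K" if "z \<in> ?I" for z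
  proof -
    from that obtain x where x: "x \<noteq> 0" "z = x ^ n" by auto
    have "bij_betw ((*) x) ?K {x. x ^ n = z}"
      by (rule bij_betwI[where g = "\<lambda>y. y / x"]) (use x in \<open>auto simp: power_mult_distrib power_divide\<close>)
    then show ?thesis by (simp add: bij_betw_same_card)
  qed
  have sub: "?I \<subseteq> {z. z ^ m = 1}"
    using power_card_minus_one[where 'a = 'a] mn by (auto simp: mult.commute simp flip: power_mult)
  have I_le: "card ?I \<le> m"
    using card_mono[OF _ sub] card_powers_eq_one_le[OF pos(1), where 'a = 'a] by simp
  have K_le: "card ?K \<le> n" by (rule card_powers_eq_one_le[OF pos(2)])
  have "UNIV - {0::'a} = (\<Union>z\<in>?I. {x. x ^ n = z})" using pos by (auto simp: power_0_left)
  moreover have "card (\<Union>z\<in>?I. {x. x ^ n = z}) = (\<Sum>z\<in>?I. card {x. x ^ n = z})"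
    by (rule card_UN_disjoint) auto
  ultimately have "CARD('a) - 1 = (\<Sum>z\<in>?I. card {x. x ^ n = z})"
    by (metis card_Diff_singleton UNIV_I)
  also have "\<dots> = card ?I * card ?K" using fibre by simp
  finally have eq: "m * n = card ?I * card ?K" using mn by simp
  have "card ?I * card ?K \<le> card ?I * n" using K_le by (rule mult_le_mono2)
  then have "m \<le> card ?I" using eq pos(2) by (metis mult_le_cancel2)
  with I_le have I: "card ?I = m" by simp
  then show K: "card ?K = n" using eq pos by simp
  show "card {x. x ^ n = y} = n" if "y ^ m = 1"
  proof -
    have "?I = {z. z ^ m = 1}"
      using sub by (rule card_seteq[rotated]) (use I card_powers_eq_one_le[OF pos(1), where 'a = 'a] in simp_all)
    then show ?thesis using that fibre K by auto
  qed
qed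

section \<open>The field with q^2 elements, its subfield and its norm-one group\<close>

locale quad_field =
  fixes q :: nat and fld :: "'a::{field,finite} itself"
  assumes primepow_q: "primepow q" and odd_q: "odd q" and card_fld: "CARD('a) = q\<^sup>2"
begin

lemma q_ge_3: "3 \<le> q"
proof -
  have "q \<noteq> 0" "q \<noteq> 1" "q \<noteq> 2" using odd_q primepow_q by (auto simp: primepow_def prime_gt_0_nat)
  then show ?thesis by simp
qed

lemma card_factor: "CARD('a) - 1 = (q - 1) * (q + 1)" "CARD('a) - 1 = (q + 1) * (q - 1)"
  by (simp_all add: card_fld power2_eq_square algebra_simps)

lemma frobenius_add: "(x + y) ^ q = x ^ q + y ^ q" for x y :: 'a
proof -
  obtain p k where pk: "prime p" "0 < k" "q = p ^ k"
    using primepow_q by (auto simp: primepow_def)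
  have "prime CHAR('a)" by (intro prime_CHAR_semidom finite_imp_CHAR_pos) simp
  moreover have "CHAR('a) dvd q\<^sup>2" using CHAR_dvd_card[where 'a = 'a] by (simp add: card_fld)
  ultimately have "CHAR('a) = p"
    using pk by (metis prime_dvd_power primes_dvd_imp_eq)
  then show ?thesis using freshmans_dream'[OF \<open>prime CHAR('a)\<close>] pk by simp
qed

lemma frobenius_minus: "(- x) ^ q = - (x ^ q)" for x :: 'a
  by (simp add: odd_q)

lemma frobenius_diff: "(x - y) ^ q = x ^ q - y ^ q" for x y :: 'a
  using frobenius_add[of x "- y"] by (simp add: odd_q)

lemma frobenius_twice: "(x ^ q) ^ q = x" for x :: 'a
proof (cases "x = 0")
  case False
  have "x ^ (q * q) = x ^ (CARD('a) - 1) * x"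
    using q_ge_3 by (simp add: card_fld power2_eq_square flip: power_Suc2)
  then show ?thesis using False using power_card_minus_one[OF False] by (simp add: power_mult)
qed (use q_ge_3 in simp)

lemma two_neq_zero: "(2::'a) \<noteq> 0"
proof
  assume "(2::'a) = 0"
  then have "CHAR('a) dvd 2" by (metis of_nat_eq_0_iff_char_dvd of_nat_numeral)
  moreover have "CHAR('a) dvd q\<^sup>2" using CHAR_dvd_card[where 'a = 'a] by (simp add: card_fld)
  moreover have "CHAR('a) \<noteq> 1" by simp
  ultimately have "2 dvd q\<^sup>2" by (metis two_is_prime_nat prime_nat_iff)
  then show False using odd_q by simp
qed

lemma minus_one_neq_one: "(- 1 :: 'a) \<noteq> 1"
  using two_neq_zero by (metis add.right_inverse one_add_one)

definition Fq :: "'a set" where "Fq = {x. x ^ q = x}"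
text \<open>The elements of trace zero over \<open>Fq\<close>. A matrix in \<open>G0\<close> of
  determinant -1 has all its entries here, which is why the involutions behind \<open>Dk\<close> are
  counted over \<open>Fm\<close>.\<close>

definition Fm :: "'a set" where "Fm = {x. x ^ q = - x}"
abbreviation E :: "'a set" where "E \<equiv> norm_one_group q"

lemma power_q: "x ^ q = x ^ (q - 1) * x" for x :: 'a
  using q_ge_3 by (metis One_nat_def Suc_diff_1 less_le_trans numeral_3_eq_3 power_Suc2 zero_less_Suc)

lemma E_iff: "x \<in> E \<longleftrightarrow> x ^ q * x = 1"
  by (auto simp: norm_one_group_def mult.commute)

lemma E_nonzero: "x \<in> E \<Longrightarrow> x \<noteq> 0" by (auto simp: norm_one_group_def)

lemma E_eq: "E = {x. x ^ (q + 1) = 1}"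
  by (auto simp: norm_one_group_def)

lemma one_in_E: "1 \<in> E" and minus_one_in_E: "- 1 \<in> E" and
  E_mult: "x \<in> E \<Longrightarrow> y \<in> E \<Longrightarrow> x * y \<in> E" and E_divide: "x \<in> E \<Longrightarrow> y \<in> E \<Longrightarrow> x / y \<in> E"
  and E_minus: "x \<in> E \<Longrightarrow> - x \<in> E"
  using odd_q by (simp_all add: E_eq power_mult_distrib power_divide del: power_Suc)

lemma card_E: "card E = q + 1"
  using card_powers_eq_one[OF card_factor(1)] by (simp add: E_eq)

lemma card_Fq: "card Fq = q"
proof -
  have "Fq = insert 0 {x. x ^ (q - 1) = 1}"
    unfolding Fq_def using q_ge_3 by (auto simp: power_q)
  then show ?thesis using card_powers_eq_one[OF card_factor(2)] q_ge_3 by (simp add: power_0_left)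
qed

text \<open>The numbers \<open>a\<close> below are the possible entries of a unitary matrix of determinant \<open>d\<close>.\<close>

lemma card_semilinear:
  assumes "d \<in> E"
  shows "card {a. a \<noteq> 0 \<and> a ^ q * d = a} = q - 1"
proof -
  have "(1 / d) ^ (q + 1) = 1" using assms by (simp add: norm_one_group_def power_one_over)
  then have "card {a. a ^ (q - 1) = 1 / d} = q - 1" by (rule card_powers_eq[OF card_factor(2)])
  moreover have "{a. a ^ (q - 1) = 1 / d} = {a. a \<noteq> 0 \<and> a ^ q * d = a}"
    using E_nonzero[OF assms] q_ge_3 by (auto simp: power_q field_simps power_0_left)
  ultimately show ?thesis by simp
qed

lemma ex_semilinear:
  assumes "d \<in> E"
  shows "\<exists>a. a \<noteq> 0 \<and> a ^ q * d = a"
proof -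
  have "0 < card {a. a \<noteq> 0 \<and> a ^ q * d = a}"
    unfolding card_semilinear[OF assms] using q_ge_3 by linarith
  then have "{a. a \<noteq> 0 \<and> a ^ q * d = a} \<noteq> {}" unfolding card_gt_0_iff by (rule conjunct1)
  then show ?thesis unfolding Collect_empty_eq not_all not_not .
qed

lemma card_Fm: "card Fm = q"
proof -
  let ?A = "{a :: 'a. a \<noteq> 0 \<and> a ^ q * (- 1) = a}"
  have A: "?A = Fm - {0}"
    unfolding Fm_def mult_minus1_right minus_equation_iff[of "_ ^ q"] set_eq_iff
    by (metis (mono_tags) Diff_iff empty_iff insert_iff mem_Collect_eq)
  have "0 \<in> Fm" using q_ge_3 by (simp add: Fm_def)
  then have "card Fm = Suc (card ?A)" unfolding A by (subst card_Suc_Diff1) simp_all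
  then show ?thesis unfolding card_semilinear[OF minus_one_in_E] using q_ge_3 by linarith
qed

lemma norm_surj:
  assumes "k \<in> Fq" "k \<noteq> 0"
  shows "\<exists>x. x ^ q * x = k"
proof -
  have "k ^ (q - 1) = 1" using assms by (auto simp: Fq_def power_q)
  then have "card {x. x ^ (q + 1) = k} = q + 1" by (rule card_powers_eq[OF card_factor(1)])
  then have "0 < card {x. x ^ (q + 1) = k}" by simp
  then have "{x. x ^ (q + 1) = k} \<noteq> {}" unfolding card_gt_0_iff by (rule conjunct1)
  then obtain x where "x ^ (q + 1) = k" by blast
  then have "x ^ q * x = k" by (simp add: mult.commute)
  then show ?thesis ..
qed

lemma Fq_closed:
  "0 \<in> Fq" "1 \<in> Fq" "x \<in> Fq \<Longrightarrow> y \<in> Fq \<Longrightarrow> x + y \<in> Fq" "x \<in> Fq \<Longrightarrow> y \<in> Fq \<Longrightarrow> x - y \<in> Fq"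
  "x \<in> Fq \<Longrightarrow> y \<in> Fq \<Longrightarrow> x * y \<in> Fq" "x \<in> Fq \<Longrightarrow> y \<in> Fq \<Longrightarrow> x / y \<in> Fq" "x \<in> Fq \<Longrightarrow> - x \<in> Fq"
  using q_ge_3 by (auto simp: Fq_def frobenius_add frobenius_diff power_mult_distrib power_divide
      frobenius_minus power_0_left)

lemma numeral_in_Fq: "numeral n \<in> Fq"
  by (induction n) (simp_all only: numeral.simps Fq_closed)

lemma Fq_Fm_0: "x \<in> Fq \<Longrightarrow> x \<in> Fm \<Longrightarrow> x = 0"
proof -
  assume "x \<in> Fq" "x \<in> Fm"
  then have "2 * x = 0" by (auto simp: Fq_def Fm_def) 
  then show ?thesis using two_neq_zero by simp
qed

text \<open>Both square roots exist in the big field. Since \<open>k ^ (q - 1) = 1\<close>, a root y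
  has \<open>y ^ (q - 1)\<close> equal to 1 or -1, so the Frobenius map fixes or negates it.\<close>

lemma card_square_roots:
  assumes "k \<in> Fq" "k \<noteq> 0"
  shows "card {y \<in> Fq. y\<^sup>2 = k} + card {y \<in> Fm. y\<^sup>2 = k} = 2"
proof -
  have "even (q + 1)" using odd_q by simp
  then obtain h where h: "q + 1 = h * 2" by (metis evenE mult.commute)
  have mn: "CARD('a) - 1 = ((q - 1) * h) * 2" using card_factor(1) unfolding h by simp
  have k1: "k ^ (q - 1) = 1" using assms by (auto simp: Fq_def power_q)
  then have "k ^ ((q - 1) * h) = 1" by (simp add: power_mult)
  then have c: "card {y. y\<^sup>2 = k} = 2" by (rule card_powers_eq[OF mn])
  have "y \<in> Fq \<union> Fm" if "y\<^sup>2 = k" for y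
  proof -
    have "(y ^ (q - 1))\<^sup>2 = 1" using k1 that by (metis power_commutes power_mult mult.commute)
    then show ?thesis by (auto simp: power2_eq_1_iff Fq_def Fm_def power_q)
  qed
  then have "{y. y\<^sup>2 = k} = {y \<in> Fq. y\<^sup>2 = k} \<union> {y \<in> Fm. y\<^sup>2 = k}" by auto
  moreover have "{y \<in> Fq. y\<^sup>2 = k} \<inter> {y \<in> Fm. y\<^sup>2 = k} = {}" using Fq_Fm_0 assms by auto
  ultimately show ?thesis using c by (simp add: card_Un_disjoint)
qed

text \<open>Euler's criterion in \<open>E\<close>, a group of even order q + 1. Counting provides a
  square root w of x in the whole field; then w^(q + 1) is x to the power (q + 1) / 2, hence 1, and
  w already lies in \<open>E\<close>.\<close>

lemma norm_one_squares_iff: "x \<in> norm_one_squares q \<longleftrightarrow> x ^ ((q + 1) div 2) = 1" for x :: 'a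
proof -
  have "even (q + 1)" using odd_q by simp
  then obtain h where h: "q + 1 = h * 2" by (metis evenE mult.commute)
  have mn: "CARD('a) - 1 = ((q - 1) * h) * 2" using card_factor(1) unfolding h by simp
  show ?thesis
  proof
    assume "x \<in> norm_one_squares q"
    then obtain w where "w \<in> E" "x = w\<^sup>2" by (auto simp: norm_one_squares_def)
    then show "x ^ ((q + 1) div 2) = 1"
      using h by (simp add: E_eq mult.commute[of 2] del: power_Suc flip: power_mult)
  next
    assume "x ^ ((q + 1) div 2) = 1"
    then have xh: "x ^ h = 1" using h by simp
    then have "x ^ ((q - 1) * h) = 1" by (simp add: mult.commute[of _ h] power_mult)
    then have "card {y. y\<^sup>2 = x} = 2" by (rule card_powers_eq[OF mn])
    then have "{y. y\<^sup>2 = x} \<noteq> {}" by (metis card.empty zero_neq_numeral)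
    then obtain w where "w\<^sup>2 = x" by blast
    moreover from this have "w \<in> E"
      using xh unfolding E_eq h mult.commute[of h 2] power_mult by simp
    ultimately show "x \<in> norm_one_squares q" by (auto simp: norm_one_squares_def)
  qed
qed

text \<open>The quadratic character of \<open>E\<close>, with complex values so that it can twist
  \<open>Mk\<close>. Outside \<open>E\<close> the value is -1 by default.\<close>

definition sgnE :: "'a \<Rightarrow> complex" where
  "sgnE x = (if x \<in> norm_one_squares q then 1 else - 1)"

lemma sgnE_mult:
  assumes "x \<in> E" "y \<in> E"
  shows "sgnE (x * y) = sgnE x * sgnE y"
proof -
  have "even (q + 1)" using odd_q by simp
  then have "z ^ (q + 1) = (z ^ ((q + 1) div 2))\<^sup>2" for z :: 'a
    by (metis dvd_div_mult_self power_mult)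
  then have pm: "z ^ ((q + 1) div 2) = 1 \<or> z ^ ((q + 1) div 2) = - 1" if "z \<in> E" for z
    using that by (simp add: E_eq power2_eq_1_iff)
  show ?thesis
    using pm[OF assms(1)] pm[OF assms(2)] minus_one_neq_one
    by (auto simp: sgnE_def norm_one_squares_iff power_mult_distrib)
qed

lemma sgnE_1: "sgnE 1 = 1" by (simp add: sgnE_def norm_one_squares_iff)

lemma sgnE_square: "x \<in> E \<Longrightarrow> sgnE (x\<^sup>2) = 1"
  by (auto simp: sgnE_def norm_one_squares_def)

lemma ex_nonsquare: "\<exists>r\<in>E. sgnE r = - 1"
proof (rule ccontr)
  assume "\<not> ?thesis"
  then have "E \<subseteq> {x. x ^ ((q + 1) div 2) = 1}"
    unfolding sgnE_def norm_one_squares_iff by (metis (mono_tags, lifting) mem_Collect_eq subsetI)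
  then have "card E \<le> card {x::'a. x ^ ((q + 1) div 2) = 1}"
    by (intro card_mono) simp_all
  also have "\<dots> \<le> (q + 1) div 2"
    using q_ge_3 by (intro card_powers_eq_one_le) simp
  finally have "card E \<le> (q + 1) div 2" .
  then show False using card_E q_ge_3 by simp
qed

end

section \<open>The unitary group and its isotropic lines\<close>

lemma vec2_eq_iff: "x = y \<longleftrightarrow> x$1 = y$1 \<and> x$2 = y$2" for x y :: "'b^2"
  by (simp add: vec_eq_iff forall_2)

lemma mat2_eq_iff: "A = B \<longleftrightarrow> A$1$1 = B$1$1 \<and> A$1$2 = B$1$2 \<and> A$2$1 = B$2$1 \<and> A$2$2 = B$2$2"
  for A B :: "'b^2^2"
  by (auto simp: vec_eq_iff forall_2)

lemma matrix_mult_2: "(A ** B)$i$j = A$i$1 * B$1$j + A$i$2 * B$2$j" for A B :: "'b::semiring_1^2^2"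
  by (simp add: matrix_matrix_mult_def sum_2)

lemma matrix_vector_mult_2: "(A *v x)$i = A$i$1 * x$1 + A$i$2 * x$2" for A :: "'b::semiring_1^2^2"
  by (simp add: matrix_vector_mult_def sum_2)

lemma mat_2 [simp]: "(mat c :: 'b::zero^2^2)$1$1 = c" "(mat c :: 'b^2^2)$1$2 = 0"
  "(mat c :: 'b^2^2)$2$1 = 0" "(mat c :: 'b^2^2)$2$2 = c"
  by (simp_all add: mat_def)

lemmas entries_2 = vec2_eq_iff mat2_eq_iff matrix_mult_2 matrix_vector_mult_2 det_2

definition cross2 :: "'b::comm_ring_1^2 \<Rightarrow> 'b^2 \<Rightarrow> 'b" where
  "cross2 v w = v$1 * w$2 - v$2 * w$1"

lemma cross2_mult: "cross2 (A *v v) (A *v w) = det A * cross2 v w"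
  by (simp add: cross2_def entries_2 algebra_simps)

lemma cross2_scale: "cross2 (a *s v) w = a * cross2 v w" "cross2 v (a *s w) = a * cross2 v w"
  by (simp_all add: cross2_def algebra_simps)

lemma matrix_eq_on_basis:
  fixes A B :: "'b::field^2^2"
  assumes "cross2 v w \<noteq> 0" "A *v v = B *v v" "A *v w = B *v w"
  shows "A = B"
proof -
  have row: "x = x' \<and> y = y'" if "x * v$1 + y * v$2 = x' * v$1 + y' * v$2"
    "x * w$1 + y * w$2 = x' * w$1 + y' * w$2" for x y x' y'
  proof -
    have "(x - x') * cross2 v w = 0" "(y - y') * cross2 v w = 0"
      using that unfolding cross2_def by algebra+
    then show ?thesis using assms(1) by simp
  qed
  show ?thesis
    using assms(2,3) by (auto simp: entries_2 dest: row)
qed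

text \<open>The representative \<open>nrm v\<close> of the line through \<open>v\<close> makes the projective line a set of
  vectors.\<close>

definition nrm :: "'b::field^2 \<Rightarrow> 'b^2" where
  "nrm v = (if v$2 = 0 then vector [1, 0] else vector [v$1 / v$2, 1])"

lemma nrm_scale: "c \<noteq> 0 \<Longrightarrow> nrm (c *s v) = nrm v"
  by (simp add: nrm_def)

lemma ex_scale_nrm:
  assumes "v \<noteq> 0"
  obtains c where "c \<noteq> 0" "v = c *s nrm v"
proof (cases "v$2 = 0")
  case True
  then show ?thesis using assms by (intro that[of "v$1"]) (auto simp: nrm_def entries_2)
next
  case False
  then show ?thesis by (intro that[of "v$2"]) (auto simp: nrm_def entries_2)
qed

context quad_field begin

text \<open>The isometry group of the form \<open>skew\<close> below. With J the matrix of rows (0,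
  1) and (-1, 0), every A satisfies A^T J A = det A J. Preserving the form means A^T J A' = J, where
  A' consists of the q-th powers of the entries of A, and together these say det A A' = A. In this
  shape the condition is entrywise and semilinear.\<close>

definition G0 :: "('a^2^2) set" where
  "G0 = {A. det A \<noteq> 0 \<and> (\<forall>i j. A$i$j ^ q * det A = A$i$j)}"

text \<open>Normalised isotropic vectors: \<open>skew\<close> of \<open>vector [x, 1]\<close> with
  itself is x - x^q. With a single representative per line, \<open>cross2\<close> vanishes only on
  equal vectors.\<close>

definition Lam :: "('a^2) set" where
  "Lam = insert (vector [1, 0]) ((\<lambda>x. vector [x, 1]) ` Fq)"

definition act :: "'a^2^2 \<Rightarrow> 'a^2 \<Rightarrow> 'a^2" where
  "act g v = nrm (g *v v)"

text \<open>Taking determinants on both sides of the entrywise condition gives d^q d^2 = d for d =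
  \<open>det A\<close>.\<close>

lemma det_in_E:
  assumes "A \<in> G0"
  shows "det A \<in> E"
proof -
  from assms have e: "A$i$j ^ q * det A = A$i$j" and d: "det A \<noteq> 0" for i j
    by (auto simp: G0_def)
  have "det A ^ q * det A * det A
      = (A$1$1 ^ q * det A) * (A$2$2 ^ q * det A) - (A$1$2 ^ q * det A) * (A$2$1 ^ q * det A)"
    by (simp add: det_2 frobenius_diff power_mult_distrib algebra_simps)
  also have "\<dots> = det A" unfolding e by (simp add: det_2)
  finally show ?thesis using d by (simp add: E_iff)
qed

lemma det_nonzero: "A \<in> G0 \<Longrightarrow> det A \<noteq> 0" by (simp add: G0_def)

lemma one_in_G0: "mat 1 \<in> G0"
  using q_ge_3 by (simp add: G0_def forall_2 power_0_left)

lemma uminus_eq_mult: "- A = - mat 1 ** A" "- A = A ** - mat 1" for A :: "'a^2^2"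
  by (simp_all add: entries_2)

lemma det_uminus [simp]: "det (- A) = det A" for A :: "'a^2^2"
  by (simp add: det_2)

lemma uminus_in_G0: "A \<in> G0 \<Longrightarrow> - A \<in> G0"
  by (auto simp: G0_def frobenius_minus)

lemma mult_in_G0:
  assumes "A \<in> G0" "B \<in> G0"
  shows "A ** B \<in> G0"
proof -
  from assms have e: "A$i$j ^ q * det A = A$i$j" "B$i$j ^ q * det B = B$i$j" for i j
    by (auto simp: G0_def)
  have "(A ** B)$i$j ^ q * (det A * det B) = (A ** B)$i$j" for i j
  proof -
    have "(A ** B)$i$j ^ q * (det A * det B) = (A$i$1 ^ q * det A) * (B$1$j ^ q * det B)
        + (A$i$2 ^ q * det A) * (B$2$j ^ q * det B)"
      by (simp add: matrix_mult_2 frobenius_add power_mult_distrib algebra_simps)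
    then show ?thesis unfolding e by (simp add: matrix_mult_2)
  qed
  then show ?thesis using assms by (auto simp: G0_def det_mul)
qed

lemma
  assumes "A \<in> G0"
  shows matrix_inv_in_G0: "matrix_inv A \<in> G0"
    and inv_left: "matrix_inv A ** A = mat 1" and inv_right: "A ** matrix_inv A = mat 1"
proof -
  from assms have e: "A$i$j ^ q * det A = A$i$j" and d: "det A \<noteq> 0" for i j
    by (auto simp: G0_def)
  define B where "B = mat2 (A$2$2 / det A) (- A$1$2 / det A) (- A$2$1 / det A) (A$1$1 / det A)"
  have D: "A$1$1 * A$2$2 = det A + A$1$2 * A$2$1" by (simp add: det_2)
  have "A ** B = mat 1" "B ** A = mat 1"
    using d D by (simp_all add: B_def mat2_eq_iff matrix_mult_2 field_simps)
  then have "\<exists>A'. A ** A' = mat 1 \<and> A' ** A = mat 1" by blast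
  then have *: "A ** matrix_inv A = mat 1 \<and> matrix_inv A ** A = mat 1"
    unfolding matrix_inv_def by (rule someI_ex)
  then show "matrix_inv A ** A = mat 1" "A ** matrix_inv A = mat 1" by auto
  have "matrix_inv A = (B ** A) ** matrix_inv A" using \<open>B ** A = mat 1\<close> by simp
  also have "\<dots> = B" using * by (simp flip: matrix_mul_assoc)
  finally have iB: "matrix_inv A = B" .
  have "det B * det A = 1" using \<open>B ** A = mat 1\<close> by (metis det_I det_mul)
  then have dB: "det B = 1 / det A" using d by (simp add: field_simps)
  have "(x / det A) ^ q * det B = x / det A" if "x ^ q * det A = x" for x
  proof -
    have "det A ^ q * det A = 1" using det_in_E[OF assms] by (simp add: E_iff)
    then have "det A ^ q = 1 / det A" using d by (simp add: field_simps)
    then have "(x / det A) ^ q * det B = x ^ q" using d by (simp add: dB power_divide)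
    then show ?thesis using that d by (metis nonzero_eq_divide_eq)
  qed
  moreover have "(- A$i$j) ^ q * det A = - A$i$j" for i j
    by (simp add: frobenius_minus e)
  ultimately have "(A$i$j / det A) ^ q * det B = A$i$j / det A"
    "(- A$i$j / det A) ^ q * det B = - A$i$j / det A" for i j
    using e by blast+
  then have "\<forall>i j. B$i$j ^ q * det B = B$i$j"
    \<comment> \<open>The occurrences left out, 2, 5, 8 and 11, are those inside
      \<open>det B\<close>, which stays folded to match the facts above.\<close>
    unfolding forall_2 by (subst (1 3 4 6 7 9 10 12) B_def) (simp del: minus_divide_left)
  then show "matrix_inv A \<in> G0" using dB d by (simp add: G0_def iB)
qed

lemma det_inv: "A \<in> G0 \<Longrightarrow> det (matrix_inv A) = 1 / det A"
  by (metis inv_left det_nonzero det_I det_mul nonzero_eq_divide_eq)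

lemma card_Lam: "card Lam = q + 1"
proof -
  have "inj_on (\<lambda>x. vector [x, 1] :: 'a^2) Fq"
    by (auto simp: inj_on_def entries_2)
  moreover have "vector [1, 0] \<notin> (\<lambda>x. vector [x, 1] :: 'a^2) ` Fq"
    by (auto simp: entries_2)
  ultimately show ?thesis by (simp add: Lam_def card_image card_Fq)
qed

lemma Lam_in_Fq: "v \<in> Lam \<Longrightarrow> v$i \<in> Fq"
  using exhaust_2[of i] by (auto simp: Lam_def Fq_closed)

lemma Lam_nonzero: "v \<in> Lam \<Longrightarrow> v \<noteq> 0"
  by (auto simp: Lam_def entries_2)

lemma cross2_in_Fq: "v \<in> Lam \<Longrightarrow> w \<in> Lam \<Longrightarrow> cross2 v w \<in> Fq"
  by (simp add: cross2_def Fq_closed Lam_in_Fq)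

lemma cross2_eq_0_iff: "v \<in> Lam \<Longrightarrow> w \<in> Lam \<Longrightarrow> cross2 v w = 0 \<longleftrightarrow> v = w"
  by (auto simp: Lam_def cross2_def)

lemma nrm_Lam: "v \<in> Lam \<Longrightarrow> nrm v = v"
  by (auto simp: Lam_def nrm_def)

lemma nrm_scale_Lam: "v \<in> Lam \<Longrightarrow> c \<noteq> 0 \<Longrightarrow> nrm (c *s v) = v"
  by (simp add: nrm_scale nrm_Lam)

lemma nrm_in_Lam_iff: "nrm v \<in> Lam \<longleftrightarrow> v$1 / v$2 \<in> Fq"
  by (auto simp: nrm_def Lam_def Fq_closed entries_2)

lemma mult_vec_nonzero: "g \<in> G0 \<Longrightarrow> v \<noteq> 0 \<Longrightarrow> g *v v \<noteq> 0"
  using matrix_vector_mul_assoc[of "matrix_inv g" g v] by (auto simp: inv_left)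

text \<open>The coordinates of v are fixed by the Frobenius map, so each coordinate y of
  \<open>g *v v\<close> satisfies \<open>y ^ q * det g = y\<close>. In the ratio of the two
  coordinates the factor \<open>det g\<close> cancels, which puts the ratio into
  \<open>Fq\<close>.\<close>

lemma act_in_Lam:
  assumes "g \<in> G0" "v \<in> Lam"
  shows "act g v \<in> Lam"
proof -
  have *: "((g *v v)$i) ^ q * det g = (g *v v)$i" for i
  proof -
    have "((g *v v)$i) ^ q * det g
        = (g$i$1 ^ q * det g) * (v$1) ^ q + (g$i$2 ^ q * det g) * (v$2) ^ q"
      by (simp add: entries_2 frobenius_add power_mult_distrib algebra_simps)
    also have "\<dots> = (g *v v)$i"
      using assms Lam_in_Fq[OF assms(2)] by (simp add: G0_def entries_2 Fq_def)
    finally show ?thesis .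
  qed
  have "((g *v v)$1 / (g *v v)$2) ^ q = ((g *v v)$1 ^ q * det g) / ((g *v v)$2 ^ q * det g)"
    using det_nonzero[OF assms(1)] by (simp add: power_divide)
  also have "\<dots> = (g *v v)$1 / (g *v v)$2" unfolding * ..
  finally show ?thesis by (simp add: act_def nrm_in_Lam_iff Fq_def)
qed

lemma ex_act_scale:
  assumes "g \<in> G0" "v \<in> Lam"
  obtains c where "c \<noteq> 0" "g *v v = c *s act g v"
  using ex_scale_nrm[OF mult_vec_nonzero[OF assms(1) Lam_nonzero[OF assms(2)]]]
  by (auto simp: act_def)

lemma act_eqI: "g *v v = c *s w \<Longrightarrow> c \<noteq> 0 \<Longrightarrow> w \<in> Lam \<Longrightarrow> act g v = w"
  by (simp add: act_def nrm_scale_Lam)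

lemma act_mult:
  assumes "h \<in> G0" "v \<in> Lam"
  shows "act (g ** h) v = act g (act h v)"
proof -
  obtain c where "c \<noteq> 0" "h *v v = c *s act h v" using ex_act_scale[OF assms] .
  then have "(g ** h) *v v = c *s (g *v act h v)"
    by (simp add: matrix_vector_mul_assoc[symmetric] vector_scalar_commute)
  then show ?thesis using \<open>c \<noteq> 0\<close> by (simp add: act_def nrm_scale)
qed

lemma act_one: "v \<in> Lam \<Longrightarrow> act (mat 1) v = v"
  by (simp add: act_def nrm_Lam)

lemma act_inv:
  assumes "g \<in> G0" "v \<in> Lam" "w \<in> Lam"
  shows "act (matrix_inv g) v = w \<longleftrightarrow> act g w = v"
  using act_mult[OF assms(1,3), of "matrix_inv g"] act_mult[OF matrix_inv_in_G0[OF assms(1)] assms(2), of g]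
  by (auto simp: inv_left inv_right act_one assms)

lemma act_inj: "g \<in> G0 \<Longrightarrow> v \<in> Lam \<Longrightarrow> w \<in> Lam \<Longrightarrow> act g v = act g w \<longleftrightarrow> v = w"
  using act_inv[of g "act g v" v] act_inv[of g "act g v" w] act_in_Lam[of g v] by auto

lemma act_eigen:
  assumes "g \<in> G0" "v \<in> Lam" "act g v = v"
  obtains c where "c \<noteq> 0" "g *v v = c *s v"
  using ex_act_scale[OF assms(1,2)] unfolding assms(3) .

section \<open>Elements of \<open>G0\<close> with prescribed images of isotropic lines\<close>

lemma scale_semilinear:
  assumes "h \<in> G0" "v \<in> Lam" "w \<in> Lam" "h *v v = a *s w"
  shows "a ^ q * det h = a"
proof -
  have e: "h$i$j ^ q * det h = h$i$j" for i j using assms(1) by (simp add: G0_def)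
  have Fq: "(v$i) ^ q = v$i" "(w$i) ^ q = w$i" for i
    using assms Lam_in_Fq by (auto simp: Fq_def)
  have *: "a * w$i = h$i$1 * v$1 + h$i$2 * v$2" for i
    using assms(4) by (metis matrix_vector_mult_2 vector_smult_component)
  have "(a ^ q * det h) * w$i = a * w$i" for i
  proof -
    have "(a ^ q * det h) * w$i = (a * w$i) ^ q * det h"
      by (simp add: power_mult_distrib Fq mult_ac)
    also have "\<dots> = (h$i$1 ^ q * det h) * v$1 + (h$i$2 ^ q * det h) * v$2"
      by (simp add: * frobenius_add power_mult_distrib Fq algebra_simps)
    finally show ?thesis unfolding e by (simp add: *)
  qed
  moreover have "w$1 \<noteq> 0 \<or> w$2 \<noteq> 0" using Lam_nonzero[OF assms(3)] by (simp add: entries_2)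
  ultimately show ?thesis by auto
qed

text \<open>Two distinct isotropic lines span the plane, so a map is given by its multipliers a and
  b on them. The determinant fixes a * b, and the semilinear condition that
  \<open>scale_semilinear\<close> imposes on a is also sufficient.\<close>

lemma ex_frame_map:
  assumes v: "v \<in> Lam" "v' \<in> Lam" "v \<noteq> v'" and w: "w \<in> Lam" "w' \<in> Lam" "w \<noteq> w'"
    and d: "d \<in> E" and a: "a \<noteq> 0" "a ^ q * d = a"
  shows "\<exists>h. h \<in> G0 \<and> det h = d \<and> h *v v = a *s w \<and> act h v' = w'"
proof -
  define k where "k = cross2 v v'"
  define l where "l = cross2 w w'"
  have kl: "k \<noteq> 0" "l \<noteq> 0" "k \<in> Fq" "l \<in> Fq"
    using v w by (auto simp: k_def l_def cross2_eq_0_iff cross2_in_Fq)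
  have d0: "d \<noteq> 0" using d E_nonzero by blast
  \<comment> \<open>Forced by \<open>det h * cross2 v v' = a * b * cross2 w w'\<close> and
    determinant d.\<close>
  define b where "b = d * k / (a * l)"
  have b0: "b \<noteq> 0" using kl d0 a by (simp add: b_def)
  have "b ^ q * d = (d ^ q * d) * k / (a ^ q * l)"
    using kl by (simp add: b_def power_mult_distrib power_divide Fq_def)
  also have "\<dots> = k / (a ^ q * l)" using d by (simp add: E_iff)
  also have "a ^ q = a / d" using a d0 by (simp add: field_simps)
  finally have b: "b ^ q * d = b" using d0 a kl by (simp add: b_def field_simps)
  \<comment> \<open>Cramer's rule for the linear map that sends v to a w and v' to b w'.\<close>
  define h where "h = mat2 ((a * v'$2 * w$1 - b * v$2 * w'$1) / k) ((b * v$1 * w'$1 - a * v'$1 * w$1) / k)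
     ((a * v'$2 * w$2 - b * v$2 * w'$2) / k) ((b * v$1 * w'$2 - a * v'$1 * w$2) / k)"
  have lin: "(X / k) * x + (Y / k) * y = Z" if "X * x + Y * y = Z * k" for X Y x y Z
    using kl(1) that by (simp add: field_simps)
  have hv: "h *v v = a *s w"
    unfolding h_def vec2_eq_iff matrix_vector_mult_2 vector_2 vector_smult_component
    by (intro conjI lin) (simp_all add: k_def cross2_def algebra_simps)
  have hv': "h *v v' = b *s w'"
    unfolding h_def vec2_eq_iff matrix_vector_mult_2 vector_2 vector_smult_component
    by (intro conjI lin) (simp_all add: k_def cross2_def algebra_simps)
  have "det h * k = cross2 (h *v v) (h *v v')" by (simp add: cross2_mult k_def)
  also have "\<dots> = a * b * l" by (simp add: hv hv' cross2_scale l_def)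
  finally have "det h * k = a * b * l" .
  then have dh: "det h = d" using kl a by (simp add: b_def field_simps)
  have *: "((a * x * y - b * z * u) / k) ^ q * d = (a * x * y - b * z * u) / k"
    "((b * z * u - a * x * y) / k) ^ q * d = (b * z * u - a * x * y) / k"
    if "x \<in> Fq" "y \<in> Fq" "z \<in> Fq" "u \<in> Fq" for x y z u
  proof -
    have "((a * x * y - b * z * u) / k) ^ q * d = ((a ^ q * d) * x * y - (b ^ q * d) * z * u) / k"
      using that kl by (simp add: power_divide frobenius_diff power_mult_distrib Fq_def algebra_simps)
    then show 1: "((a * x * y - b * z * u) / k) ^ q * d = (a * x * y - b * z * u) / k"
      unfolding a b by simp
    have neg: "(b * z * u - a * x * y) / k = - ((a * x * y - b * z * u) / k)"
      by (simp add: minus_divide_left)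
    show "((b * z * u - a * x * y) / k) ^ q * d = (b * z * u - a * x * y) / k"
      unfolding neg frobenius_minus mult_minus_left 1 ..
  qed
  have "h$i$j ^ q * d = h$i$j" for i j
    using exhaust_2[of i] exhaust_2[of j] v w
    by (auto simp: h_def * Lam_in_Fq)
  then have "h \<in> G0" using dh d0 by (simp add: G0_def)
  then show "\<exists>h. h \<in> G0 \<and> det h = d \<and> h *v v = a *s w \<and> act h v' = w'"
    using dh hv act_eqI[OF hv' b0 w(2)] by blast
qed

lemma frame_map_unique:
  assumes v: "v \<in> Lam" "v' \<in> Lam" "v \<noteq> v'" and w: "w \<in> Lam" "w' \<in> Lam" "w \<noteq> w'" and a: "a \<noteq> 0"
    and h: "h \<in> G0" "h *v v = a *s w" "act h v' = w'"
    and h': "h' \<in> G0" "h' *v v = a *s w" "act h' v' = w'"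
    and det: "det h = det h'"
  shows "h = h'"
proof -
  obtain b where b: "h *v v' = b *s w'" using ex_act_scale[OF h(1) v(2)] unfolding h(3) .
  obtain b' where b': "h' *v v' = b' *s w'" using ex_act_scale[OF h'(1) v(2)] unfolding h'(3) .
  have "cross2 (h *v v) (h *v v') = cross2 (h' *v v) (h' *v v')"
    unfolding cross2_mult det ..
  then have "a * b * cross2 w w' = a * b' * cross2 w w'"
    by (simp add: b b' h h' cross2_scale mult_ac)
  then have "b = b'" using a w by (simp add: cross2_eq_0_iff)
  then show "h = h'"
    using h h' b b' v by (intro matrix_eq_on_basis[of v v']) (auto simp: cross2_eq_0_iff)
qed

text \<open>The multiplier on v determines such an element by \<open>frame_map_unique\<close>, and
  it ranges over the q - 1 numbers of \<open>card_semilinear\<close>.\<close>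

lemma card_frame_maps:
  assumes v: "v \<in> Lam" "v' \<in> Lam" "v \<noteq> v'" and w: "w \<in> Lam" "w' \<in> Lam" "w \<noteq> w'" and d: "d \<in> E"
  shows "card {h \<in> G0. det h = d \<and> act h v = w \<and> act h v' = w'} = q - 1"
proof -
  let ?H = "{h \<in> G0. det h = d \<and> act h v = w \<and> act h v' = w'}"
  let ?A = "{a. a \<noteq> 0 \<and> a ^ q * d = a}"
  obtain i where i: "w$i \<noteq> 0" using Lam_nonzero[OF w(1)] by (auto simp: vec_eq_iff)
  \<comment> \<open>Reads the multiplier of h on v from a coordinate in which w does not
    vanish.\<close>
  define c where "c h = (h *v v)$i / w$i" for h
  have c_eq: "c h = a" if "h *v v = a *s w" for h a using i that by (simp add: c_def)
  have c: "h *v v = c h *s w" "c h \<noteq> 0" "c h ^ q * d = c h" if h: "h \<in> ?H" for h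
  proof -
    have hG: "h \<in> G0" "det h = d" "act h v = w" using h by simp_all
    obtain a where a: "a \<noteq> 0" "h *v v = a *s w" using ex_act_scale[OF hG(1) v(1)] unfolding hG(3) .
    have "c h = a" by (rule c_eq[OF a(2)])
    then show *: "h *v v = c h *s w" "c h \<noteq> 0" using a by simp_all
    show "c h ^ q * d = c h" using scale_semilinear[OF hG(1) v(1) w(1) *(1)] unfolding hG(2) .
  qed
  have "bij_betw c ?H ?A"
  proof (rule bij_betw_imageI)
    show "inj_on c ?H"
    proof (rule inj_onI)
      fix h h' assume h: "h \<in> ?H" "h' \<in> ?H" "c h = c h'"
      have "h' *v v = c h *s w" using c(1)[OF h(2)] h(3) by simp
      then show "h = h'"
        using frame_map_unique[OF v w c(2)[OF h(1)] _ c(1)[OF h(1)]] h(1,2) by simp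
    qed
    show "c ` ?H = ?A"
    proof (intro equalityI subsetI)
      fix a assume "a \<in> c ` ?H"
      then obtain h where h: "h \<in> ?H" and "a = c h" by (elim imageE)
      then show "a \<in> ?A" using c(2,3)[OF h] by simp
    next
      fix a assume a: "a \<in> ?A"
      then obtain h where h: "h \<in> G0" "det h = d" "h *v v = a *s w" "act h v' = w'"
        using ex_frame_map[OF v w d, of a] by auto
      moreover have "act h v = w" using act_eqI[OF h(3) _ w(1)] a by simp
      ultimately have "h \<in> ?H" by simp
      moreover have "a = c h" using c_eq[OF h(3)] by simp
      ultimately show "a \<in> c ` ?H" by (rule image_eqI[rotated])
    qed
  qed
  then have "card ?H = card ?A" by (rule bij_betw_same_card)
  then show ?thesis unfolding card_semilinear[OF d] .
qed

lemma ex_other_line: "\<exists>v'\<in>Lam. v' \<noteq> v \<and> v' \<noteq> w"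
proof (rule ccontr)
  assume "\<not> ?thesis"
  then have "Lam \<subseteq> {v, w}" by blast
  then have "card Lam \<le> card {v, w}" by (intro card_mono) simp_all
  also have "\<dots> \<le> 2" by (simp add: card_insert_if)
  finally show False using card_Lam q_ge_3 by simp
qed

text \<open>An auxiliary line v' can go to any of the q lines other than w, and each choice leaves q
  - 1 elements.\<close>

lemma card_line_maps:
  assumes v: "v \<in> Lam" and w: "w \<in> Lam" and d: "d \<in> E"
  shows "card {h \<in> G0. det h = d \<and> act h v = w} = q * (q - 1)"
proof -
  obtain v' where v': "v' \<in> Lam" "v' \<noteq> v" using ex_other_line by blast
  have "{h \<in> G0. det h = d \<and> act h v = w}
      = (\<Union>w'\<in>Lam - {w}. {h \<in> G0. det h = d \<and> act h v = w \<and> act h v' = w'})"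
    using act_in_Lam[OF _ v'(1)] act_inj[OF _ v'(1) v] v'(2) by auto
  also have "card \<dots> = (\<Sum>w'\<in>Lam - {w}. card {h \<in> G0. det h = d \<and> act h v = w \<and> act h v' = w'})"
    by (rule card_UN_disjoint) auto
  also have "\<dots> = (\<Sum>w'\<in>Lam - {w}. q - 1)"
    using v v' w d by (intro sum.cong card_frame_maps) auto
  also have "\<dots> = q * (q - 1)" using card_Lam w by simp
  finally show ?thesis .
qed

text \<open>A root subgroup: the identity together with the transvections whose axis is the line of
  v.\<close>

definition Uset :: "'a^2 \<Rightarrow> ('a^2^2) set" where
  "Uset v = {u \<in> G0. det u = 1 \<and> u *v v = v}"

lemma Uset_act: "v \<in> Lam \<Longrightarrow> u \<in> Uset v \<Longrightarrow> act u v = v"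
  using act_eqI[of u v 1 v] by (simp add: Uset_def)

lemma ex_Uset:
  assumes "v \<in> Lam" "m \<in> Lam" "m' \<in> Lam" "m \<noteq> v" "m' \<noteq> v"
  shows "\<exists>u\<in>Uset v. act u m = m'"
  using ex_frame_map[OF assms(1,2) assms(4)[symmetric] assms(1,3) assms(5)[symmetric] one_in_E, of 1]
  by (auto simp: Uset_def)

lemma Uset_unique:
  assumes "v \<in> Lam" "m \<in> Lam" "m \<noteq> v" "u \<in> Uset v" "u' \<in> Uset v" "act u m = act u' m"
  shows "u = u'"
proof -
  have u: "u \<in> G0" "u *v v = 1 *s v" "u' \<in> G0" "u' *v v = 1 *s v" "det u = det u'"
    using assms(4,5) by (simp_all add: Uset_def)
  have "act u m \<noteq> act u v" using act_inj[OF u(1) assms(2,1)] assms(3) by blast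
  then have "v \<noteq> act u m" using Uset_act[OF assms(1,4)] by simp
  then show ?thesis
    using frame_map_unique[OF assms(1,2) assms(3)[symmetric] assms(1) act_in_Lam[OF u(1) assms(2)] _ _
        u(1,2) refl u(3,4) assms(6)[symmetric] u(5)] by simp
qed

text \<open>The group acts simply transitively on the q lines other than v (\<open>ex_Uset\<close>
  and \<open>Uset_unique\<close>), so evaluation at one of them is a bijection.\<close>

lemma card_Uset:
  assumes v: "v \<in> Lam"
  shows "card (Uset v) = q"
proof -
  obtain m where m: "m \<in> Lam" "m \<noteq> v" using ex_other_line by blast
  have "bij_betw (\<lambda>u. act u m) (Uset v) (Lam - {v})"
  proof (rule bij_betw_imageI)
    show "inj_on (\<lambda>u. act u m) (Uset v)"
      by (rule inj_onI) (rule Uset_unique[OF v m])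
    have "act u m \<in> Lam - {v}" if "u \<in> Uset v" for u
      using that m v act_in_Lam[of u m] act_inj[of u m v] Uset_act[OF v that] by (auto simp: Uset_def)
    then show "(\<lambda>u. act u m) ` Uset v = Lam - {v}"
      using ex_Uset[OF v m(1) _ m(2)] by fastforce
  qed
  then have "card (Uset v) = card (Lam - {v})" by (rule bij_betw_same_card)
  then show ?thesis using card_Lam v by simp
qed

end

section \<open>Convolution operators\<close>

text \<open>The hypothesis on \<open>w\<close> says that the product of the \<open>T - \<alpha>\<close> annihilates it; the component
  of \<open>w\<close> for the eigenvalue \<open>\<alpha>\<close> is a multiple of the product of the other factors applied to \<open>w\<close>.\<close>

lemma eigenvector_decomposition:
  fixes T :: "('m \<Rightarrow> complex) \<Rightarrow> 'm \<Rightarrow> complex"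
  assumes lin: "\<And>a b u v. T (\<lambda>x. a * u x + b * v x) = (\<lambda>x. a * T u x + b * T v x)"
    and X: "\<And>a b u v. u \<in> X \<Longrightarrow> v \<in> X \<Longrightarrow> (\<lambda>x. a * u x + b * v x) \<in> X" "\<And>u. u \<in> X \<Longrightarrow> T u \<in> X"
    and K: "\<And>a b u v. u \<in> K \<Longrightarrow> v \<in> K \<Longrightarrow> (\<lambda>x. a * u x + b * v x) \<in> K" "(\<lambda>x. 0) \<in> K"
    and eigen: "\<And>\<alpha> u. \<alpha> \<in> set as \<Longrightarrow> u \<in> X \<Longrightarrow> T u = (\<lambda>x. \<alpha> * u x) \<Longrightarrow> u \<in> K"
    and "distinct as" "w \<in> X" "foldr (\<lambda>\<alpha> u x. T u x - \<alpha> * u x) as w = (\<lambda>x. 0)"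
  shows "w \<in> K"
  using eigen \<open>distinct as\<close> \<open>w \<in> X\<close> \<open>foldr _ as w = _\<close>
proof (induction as arbitrary: w)
  case Nil
  then show ?case using K(2) by simp
next
  case (Cons \<alpha> as)
  let ?P = "foldr (\<lambda>\<alpha> u x. T u x - \<alpha> * u x) as"
  have P_lin: "?P (\<lambda>x. a * u x + b * v x) = (\<lambda>x. a * ?P u x + b * ?P v x)" for a b u v
    by (induction as) (simp_all add: lin algebra_simps)
  have P_X: "?P u \<in> X" if "u \<in> X" for u
  proof (induction as)
    case (Cons \<beta> as)
    then show ?case using X(1)[OF X(2)[OF Cons.IH] Cons.IH, of 1 "- \<beta>"] by simp
  qed (simp add: that)
  define v where "v = ?P w"
  have "T v = (\<lambda>x. \<alpha> * v x)" using Cons.prems(4) by (simp add: v_def fun_eq_iff)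
  have "v \<in> K"
    by (rule Cons.prems(1)[of \<alpha>]) (use P_X Cons.prems(3) \<open>T v = _\<close> in \<open>simp_all add: v_def\<close>)
  \<comment> \<open>The factors for the remaining roots multiply the eigenvector v by this scalar,
    which is nonzero because the roots are distinct.\<close>
  define c where "c = prod_list (map (\<lambda>\<beta>. \<alpha> - \<beta>) as)"
  have c: "c \<noteq> 0" using Cons.prems(2) by (auto simp: c_def prod_list_zero_iff)
  have "?P v = (\<lambda>x. c * v x)"
    unfolding c_def
  proof (induction as)
    case (Cons \<beta> as)
    have *: "T (\<lambda>x. d * v x) = (\<lambda>x. d * (\<alpha> * v x))" for d
      using lin[of d v 0 v] \<open>T v = _\<close> by simp
    show ?case
      unfolding foldr.simps o_apply Cons.IH * list.map prod_list.Cons by (simp add: fun_eq_iff algebra_simps)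
  qed simp
  \<comment> \<open>Subtracting v / c, the component for \<open>\<alpha>\<close>, leaves a function
    annihilated by the remaining factors, so the induction hypothesis applies to it.\<close>
  then have zero: "?P (\<lambda>x. 1 * w x + (- 1 / c) * v x) = (\<lambda>x. 0)"
    unfolding P_lin using c by (simp add: fun_eq_iff v_def)
  have in_X: "(\<lambda>x. 1 * w x + (- 1 / c) * v x) \<in> X"
    unfolding v_def by (rule X(1)[OF Cons.prems(3) P_X[OF Cons.prems(3)]])
  have "u \<in> K" if "\<beta> \<in> set as" "u \<in> X" "T u = (\<lambda>x. \<beta> * u x)" for \<beta> u
    by (rule Cons.prems(1)[OF _ that(2,3)]) (simp add: that(1))
  moreover have "distinct as" using Cons.prems(2) by simp
  ultimately have "(\<lambda>x. 1 * w x + (- 1 / c) * v x) \<in> K"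
    using in_X zero by (rule Cons.IH)
  from K(1)[OF this \<open>v \<in> K\<close>, of 1 "1 / c"] show ?case by simp
qed

context quad_field begin

text \<open>Functions are taken on all 2 x 2 matrices, on which \<open>G0\<close> acts by left
  multiplication, so that no domain has to be carried along.\<close>

definition kop :: "('a^2^2 \<Rightarrow> complex) \<Rightarrow> ('a^2^2 \<Rightarrow> complex) \<Rightarrow> 'a^2^2 \<Rightarrow> complex" where
  "kop k w x = (\<Sum>g\<in>G0. k g * w (g ** x))"

definition kconv :: "('a^2^2 \<Rightarrow> complex) \<Rightarrow> ('a^2^2 \<Rightarrow> complex) \<Rightarrow> 'a^2^2 \<Rightarrow> complex" where
  "kconv k l z = (\<Sum>g\<in>G0. k g * l (matrix_inv g ** z))"

definition central_fun :: "('a^2^2 \<Rightarrow> complex) \<Rightarrow> bool" where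
  "central_fun k \<longleftrightarrow> (\<forall>g\<in>G0. \<forall>h\<in>G0. k (g ** h) = k (h ** g))"

lemma inv_mult_cancel [simp]:
  "g \<in> G0 \<Longrightarrow> matrix_inv g ** (g ** x) = x" "g \<in> G0 \<Longrightarrow> g ** (matrix_inv g ** x) = x"
  by (simp_all add: matrix_mul_assoc inv_left inv_right)

lemma mult_inv_cancel [simp]:
  "g \<in> G0 \<Longrightarrow> x ** matrix_inv g ** g = x" "g \<in> G0 \<Longrightarrow> x ** g ** matrix_inv g = x"
  by (simp_all add: inv_left inv_right flip: matrix_mul_assoc)

lemma sum_left_mult: "g \<in> G0 \<Longrightarrow> (\<Sum>h\<in>G0. F (g ** h)) = (\<Sum>h\<in>G0. F h)"
  by (rule sum.reindex_bij_witness[where i = "\<lambda>h. matrix_inv g ** h" and j = "\<lambda>h. g ** h"])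
     (simp_all add: mult_in_G0 matrix_inv_in_G0)

lemma sum_right_mult: "g \<in> G0 \<Longrightarrow> (\<Sum>h\<in>G0. F (h ** g)) = (\<Sum>h\<in>G0. F h)"
  by (rule sum.reindex_bij_witness[where i = "\<lambda>h. h ** matrix_inv g" and j = "\<lambda>h. h ** g"])
     (simp_all add: mult_in_G0 matrix_inv_in_G0)

lemma matrix_inv_inv: "g \<in> G0 \<Longrightarrow> matrix_inv (matrix_inv g) = g"
  using inv_mult_cancel(1)[of "matrix_inv g" g] by (simp add: matrix_inv_in_G0 inv_left)

lemma sum_inv: "(\<Sum>h\<in>G0. F (matrix_inv h)) = (\<Sum>h\<in>G0. F h)"
  by (rule sum.reindex_bij_witness[where i = matrix_inv and j = matrix_inv])
     (simp_all add: matrix_inv_in_G0 matrix_inv_inv)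

lemma kop_linear: "kop k (\<lambda>x. a * u x + b * v x) = (\<lambda>x. a * kop k u x + b * kop k v x)"
  by (simp add: kop_def fun_eq_iff sum.distrib sum_distrib_left algebra_simps)

lemma kop_cong: "(\<And>g. g \<in> G0 \<Longrightarrow> k g = l g) \<Longrightarrow> kop k = kop l"
  by (simp add: kop_def fun_eq_iff)

text \<open>Replacing g by \<open>h ** g ** matrix_inv h\<close> does not change a central kernel,
  and it moves a translation by h past the sum; this is the local fact \<open>conj\<close>.\<close>

lemma kop_commute:
  assumes "central_fun k"
  shows "kop k (kop l w) = kop l (kop k w)"
proof
  fix x
  have conj: "(\<Sum>g\<in>G0. k g * w (g ** (h ** x))) = (\<Sum>g\<in>G0. k g * w (h ** (g ** x)))" if h: "h \<in> G0" for h
  proof -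
    have "(\<Sum>g\<in>G0. k g * w (g ** (h ** x))) = (\<Sum>g\<in>G0. k (g ** matrix_inv h) * w (g ** x))"
      using sum_right_mult[OF h, of "\<lambda>g. k (g ** matrix_inv h) * w (g ** x)"] h
      by (simp add: matrix_mul_assoc)
    also have "\<dots> = (\<Sum>g\<in>G0. k (matrix_inv h ** g) * w (g ** x))"
      using assms matrix_inv_in_G0[OF h] by (simp add: central_fun_def)
    also have "\<dots> = (\<Sum>g\<in>G0. k g * w (h ** (g ** x)))"
      using sum_left_mult[OF h, of "\<lambda>g. k (matrix_inv h ** g) * w (g ** x)"] h
      by (simp add: matrix_mul_assoc[symmetric])
    finally show ?thesis .
  qed
  have "kop k (kop l w) x = (\<Sum>g\<in>G0. \<Sum>h\<in>G0. k g * (l h * w (h ** (g ** x))))"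
    by (simp add: kop_def sum_distrib_left)
  also have "\<dots> = (\<Sum>h\<in>G0. \<Sum>g\<in>G0. k g * (l h * w (h ** (g ** x))))"
    by (rule sum.swap)
  also have "\<dots> = (\<Sum>h\<in>G0. l h * (\<Sum>g\<in>G0. k g * w (h ** (g ** x))))"
    by (simp add: sum_distrib_left mult_ac)
  also have "\<dots> = (\<Sum>h\<in>G0. l h * (\<Sum>g\<in>G0. k g * w (g ** (h ** x))))"
    using conj by simp
  also have "\<dots> = kop l (kop k w) x" by (simp add: kop_def)
  finally show "kop k (kop l w) x = kop l (kop k w) x" .
qed

text \<open>The composite translates by h g with g weighted by k and h by l, the order opposite to
  that in \<open>kconv k l\<close>. Commuting the two operators first repairs the order; this is
  where centrality of k enters.\<close>

lemma kop_kop: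
  assumes "central_fun k"
  shows "kop k (kop l w) = kop (kconv k l) w"
proof
  fix x
  have sub: "(\<Sum>h\<in>G0. l h * w (g ** (h ** x))) = (\<Sum>z\<in>G0. l (matrix_inv g ** z) * w (z ** x))"
    if g: "g \<in> G0" for g
    using sum_left_mult[OF g, of "\<lambda>z. l (matrix_inv g ** z) * w (z ** x)"] g
    by (simp add: matrix_mul_assoc[symmetric])
  have "kop k (kop l w) x = kop l (kop k w) x" using kop_commute[OF assms] by simp
  also have "\<dots> = (\<Sum>h\<in>G0. \<Sum>g\<in>G0. l h * (k g * w (g ** (h ** x))))"
    by (simp add: kop_def sum_distrib_left)
  also have "\<dots> = (\<Sum>g\<in>G0. \<Sum>h\<in>G0. l h * (k g * w (g ** (h ** x))))"
    by (rule sum.swap)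
  also have "\<dots> = (\<Sum>g\<in>G0. k g * (\<Sum>h\<in>G0. l h * w (g ** (h ** x))))"
    by (simp add: sum_distrib_left mult_ac)
  also have "\<dots> = (\<Sum>g\<in>G0. \<Sum>z\<in>G0. k g * (l (matrix_inv g ** z) * w (z ** x)))"
    using sub by (simp add: sum_distrib_left)
  also have "\<dots> = (\<Sum>z\<in>G0. \<Sum>g\<in>G0. k g * (l (matrix_inv g ** z) * w (z ** x)))"
    by (rule sum.swap)
  also have "\<dots> = kop (kconv k l) w x"
    by (simp add: kop_def kconv_def sum_distrib_right mult.assoc)
  finally show "kop k (kop l w) x = kop (kconv k l) w x" .
qed

lemma kop_kernel_linear: "kop (\<lambda>g. a * k g + b * l g) w x = a * kop k w x + b * kop l w x"
  by (simp add: kop_def sum.distrib sum_distrib_left algebra_simps)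

text \<open>Operators with a real symmetric kernel are self-adjoint.\<close>

lemma kop_square_zero:
  assumes k: "\<And>g. g \<in> G0 \<Longrightarrow> k (matrix_inv g) = k g" "\<And>g. cnj (k g) = k g"
    and zero: "kop k (kop k w) = (\<lambda>x. 0)"
  shows "kop k w = (\<lambda>x. 0)"
proof -
  define u where "u = kop k w"
  have reindex: "(\<Sum>x\<in>UNIV. w (g ** x) * cnj (u x)) = (\<Sum>y\<in>UNIV. w y * cnj (u (matrix_inv g ** y)))"
    if "g \<in> G0" for g
    by (rule sum.reindex_bij_witness[where i = "\<lambda>y. matrix_inv g ** y" and j = "\<lambda>x. g ** x"])
       (simp_all add: that)
  have adj: "(\<Sum>g\<in>G0. k g * cnj (u (matrix_inv g ** y))) = cnj (kop k u y)" for y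
  proof -
    have "(\<Sum>g\<in>G0. k g * cnj (u (matrix_inv g ** y)))
        = (\<Sum>g\<in>G0. k (matrix_inv g) * cnj (u (matrix_inv g ** y)))"
      using k(1) by simp
    also have "\<dots> = (\<Sum>g\<in>G0. k g * cnj (u (g ** y)))"
      by (rule sum_inv[of "\<lambda>g. k g * cnj (u (g ** y))"])
    finally show ?thesis by (simp add: kop_def k(2))
  qed
  \<comment> \<open>The squared norm of u = K w is the inner product of w with K u, and K u vanishes
    by hypothesis.\<close>
  have "(\<Sum>x\<in>UNIV. u x * cnj (u x)) = (\<Sum>x\<in>UNIV. \<Sum>g\<in>G0. k g * (w (g ** x) * cnj (u x)))"
    by (subst (1) u_def) (simp add: kop_def sum_distrib_right mult.assoc)
  also have "\<dots> = (\<Sum>g\<in>G0. k g * (\<Sum>x\<in>UNIV. w (g ** x) * cnj (u x)))"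
    by (subst sum.swap) (simp add: sum_distrib_left)
  also have "\<dots> = (\<Sum>g\<in>G0. \<Sum>y\<in>UNIV. k g * (w y * cnj (u (matrix_inv g ** y))))"
    by (simp add: reindex sum_distrib_left)
  also have "\<dots> = (\<Sum>y\<in>UNIV. w y * (\<Sum>g\<in>G0. k g * cnj (u (matrix_inv g ** y))))"
    by (subst sum.swap) (simp add: sum_distrib_left mult_ac)
  also have "\<dots> = 0" using zero by (simp add: adj flip: u_def)
  finally have "(\<Sum>x\<in>UNIV. complex_of_real ((cmod (u x))\<^sup>2)) = 0"
    by (simp only: complex_norm_square)
  then have "complex_of_real (\<Sum>x\<in>UNIV. (cmod (u x))\<^sup>2) = 0" by simp
  then have "(\<Sum>x\<in>UNIV. (cmod (u x))\<^sup>2) = 0" by (simp only: of_real_eq_0_iff)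
  then have "u x = 0" for x by (simp add: sum_nonneg_eq_0_iff)
  then show ?thesis by (simp add: u_def fun_eq_iff)
qed

text \<open>At time \<open>\<pi>/2\<close> an eigenvalue \<open>\<theta> \<equiv> 2 (mod 4)\<close> contributes the factor \<open>-1\<close>.\<close>

definition Kspace :: "(('a^2^2 \<Rightarrow> complex) \<Rightarrow> 'a^2^2 \<Rightarrow> complex) \<Rightarrow> ('a^2^2 \<Rightarrow> complex) set" where
  "Kspace A = {w. \<forall>x. (\<lambda>k. (- \<i> * complex_of_real (pi / 2)) ^ k * (A ^^ k) w x / fact k) sums (- w x)}"

lemma kop_funpow_linear:
  "(kop k ^^ n) (\<lambda>x. a * u x + b * v x) = (\<lambda>x. a * (kop k ^^ n) u x + b * (kop k ^^ n) v x)"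
  by (induction n) (simp_all add: kop_linear)

lemma Kspace_linear:
  assumes "u \<in> Kspace (kop k)" "v \<in> Kspace (kop k)"
  shows "(\<lambda>x. a * u x + b * v x) \<in> Kspace (kop k)"
proof -
  let ?c = "- \<i> * complex_of_real (pi / 2)"
  have "(\<lambda>n. ?c ^ n * (a * (kop k ^^ n) u x + b * (kop k ^^ n) v x) / fact n) sums (- (a * u x + b * v x))" for x
  proof -
    have "(\<lambda>n. a * (?c ^ n * (kop k ^^ n) u x / fact n) + b * (?c ^ n * (kop k ^^ n) v x / fact n))
        sums (a * (- u x) + b * (- v x))"
      using assms by (intro sums_add sums_mult) (auto simp: Kspace_def)
    then show ?thesis by (simp add: algebra_simps add_divide_distrib)
  qed
  then show ?thesis by (simp add: Kspace_def kop_funpow_linear)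
qed

lemma eigenvector_in_Kspace:
  assumes "A w = (\<lambda>x. \<theta> * w x)" "\<And>n. A (\<lambda>x. \<theta> ^ n * w x) = (\<lambda>x. \<theta> ^ n * A w x)"
    and "\<theta> = of_int (4 * m + 2)"
  shows "w \<in> Kspace A"
proof -
  let ?c = "- \<i> * complex_of_real (pi / 2)"
  have pow: "(A ^^ n) w = (\<lambda>x. \<theta> ^ n * w x)" for n
    by (induction n) (simp_all add: assms(1,2) mult.assoc mult.left_commute)
  have "?c * \<theta> = complex_of_real (2 * real_of_int (- m) * pi) * \<i> + - (of_real pi * \<i>)"
    by (simp add: assms(3) algebra_simps)
  moreover have "exp (complex_of_real (2 * real_of_int (- m) * pi) * \<i>) = 1"
    by (rule exp_integer_2pi) simp
  ultimately have "exp (?c * \<theta>) = - 1" by (simp only: exp_add exp_minus exp_pi_i) simp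
  then have "(\<lambda>n. (?c * \<theta>) ^ n /\<^sub>R fact n * w x) sums (- 1 * w x)" for x
    using sums_mult2[OF exp_converges[of "?c * \<theta>"], of "w x"] by (simp only:)
  moreover have "(?c * \<theta>) ^ n /\<^sub>R fact n * w x = ?c ^ n * (\<theta> ^ n * w x) / fact n" for n x
    unfolding power_mult_distrib scaleR_conv_of_real by (simp add: field_simps)
  ultimately have "(\<lambda>n. ?c ^ n * (\<theta> ^ n * w x) / fact n) sums (- w x)" for x
    by (simp only: mult_minus1)
  then show ?thesis by (simp add: Kspace_def pow)
qed

end

section \<open>Relations between the class-sum operators\<close>

lemma of_nat_card_filter:
  "finite A \<Longrightarrow> (of_nat (card {x \<in> A. P x}) :: 'b::semiring_1) = (\<Sum>x\<in>A. of_bool (P x))"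
  by (simp add: of_bool_def sum.If_cases Int_def)

context quad_field begin

definition fixed_lines :: "'a^2^2 \<Rightarrow> ('a^2) set" where
  "fixed_lines g = {v \<in> Lam. act g v = v}"

text \<open>For \<psi> = 1 this is the permutation character on the isotropic lines; in general it
  is twisted by a function of the determinant.\<close>

definition Mk :: "('a \<Rightarrow> complex) \<Rightarrow> 'a^2^2 \<Rightarrow> complex" where
  "Mk \<psi> g = \<psi> (det g) * of_nat (card (fixed_lines g))"

definition Nk :: "('a \<Rightarrow> complex) \<Rightarrow> 'a^2^2 \<Rightarrow> complex" where
  "Nk \<psi> g = \<psi> (det g)"

text \<open>The sum of the indicators of the q + 1 root subgroups: a transvection in one of them
  counts once, the identity q + 1 times.\<close>

definition Uk :: "'a^2^2 \<Rightarrow> complex" where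
  "Uk g = of_nat (card {v \<in> Lam. g \<in> Uset v})"

definition Zk :: "'a^2^2 \<Rightarrow> complex" where
  "Zk g = of_bool (\<exists>x. g = mat x)"

definition Dk :: "'a^2^2 \<Rightarrow> complex" where
  "Dk g = of_bool (g$1$1 + g$2$2 = 0 \<and> det g = - 1)"

abbreviation delta1 :: "'a \<Rightarrow> complex" where "delta1 x \<equiv> of_bool (x = 1)"

text \<open>The instances used are the unit mass at \<open>1\<close>, the trivial character and the quadratic
  character.\<close>

definition quasi_idem :: "complex \<Rightarrow> ('a \<Rightarrow> complex) \<Rightarrow> bool" where
  "quasi_idem n \<psi> \<longleftrightarrow> (\<forall>\<eta>\<in>E. (\<Sum>\<delta>\<in>E. \<psi> \<delta> * \<psi> (\<eta> / \<delta>)) = n * \<psi> \<eta>)"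

lemma quasi_idem_delta1: "quasi_idem 1 delta1"
proof -
  have "(\<Sum>\<delta>\<in>E. delta1 \<delta> * delta1 (\<eta> / \<delta>)) = delta1 \<eta>" for \<eta>
    using sum.remove[of E 1 "\<lambda>\<delta>. delta1 \<delta> * delta1 (\<eta> / \<delta>)"] one_in_E by simp
  then show ?thesis by (simp add: quasi_idem_def)
qed

lemma quasi_idem_char:
  assumes "\<And>x y. x \<in> E \<Longrightarrow> y \<in> E \<Longrightarrow> \<psi> (x * y) = \<psi> x * \<psi> y"
  shows "quasi_idem (of_nat (q + 1)) \<psi>"
  unfolding quasi_idem_def
proof
  fix \<eta> assume \<eta>: "\<eta> \<in> E"
  have "\<psi> \<delta> * \<psi> (\<eta> / \<delta>) = \<psi> \<eta>" if "\<delta> \<in> E" for \<delta>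
    using assms[OF that E_divide[OF \<eta> that]] E_nonzero[OF that] by simp
  then have "(\<Sum>\<delta>\<in>E. \<psi> \<delta> * \<psi> (\<eta> / \<delta>)) = (\<Sum>\<delta>\<in>E. \<psi> \<eta>)" by (intro sum.cong) auto
  then show "(\<Sum>\<delta>\<in>E. \<psi> \<delta> * \<psi> (\<eta> / \<delta>)) = of_nat (q + 1) * \<psi> \<eta>" by (simp add: card_E)
qed

lemma central_M: "central_fun (Mk \<psi>)"
  unfolding central_fun_def Mk_def
proof (intro ballI)
  fix g h assume g: "g \<in> G0" and h: "h \<in> G0"
  have "bij_betw (act h) (fixed_lines (g ** h)) (fixed_lines (h ** g))"
  proof (rule bij_betwI[where g = "act g"])
    show "act h \<in> fixed_lines (g ** h) \<rightarrow> fixed_lines (h ** g)"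
      using act_mult[OF g] act_mult[OF h, of _ g] act_in_Lam[OF h] by (auto simp: fixed_lines_def)
    show "act g \<in> fixed_lines (h ** g) \<rightarrow> fixed_lines (g ** h)"
      using act_mult[OF h] act_mult[OF g, of _ h] act_in_Lam[OF g] by (auto simp: fixed_lines_def)
    show "act g (act h v) = v" if "v \<in> fixed_lines (g ** h)" for v
      using that by (simp add: fixed_lines_def flip: act_mult[OF h])
    show "act h (act g v) = v" if "v \<in> fixed_lines (h ** g)" for v
      using that by (simp add: fixed_lines_def flip: act_mult[OF g])
  qed
  then have "card (fixed_lines (g ** h)) = card (fixed_lines (h ** g))" by (rule bij_betw_same_card)
  then show "\<psi> (det (g ** h)) * of_nat (card (fixed_lines (g ** h)))
      = \<psi> (det (h ** g)) * of_nat (card (fixed_lines (h ** g)))"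
    by (simp add: det_mul mult.commute)
qed

lemma Uset_conj:
  assumes "g \<in> G0" "h \<in> G0" "v \<in> Lam" "g ** h \<in> Uset v"
  shows "h ** g \<in> Uset (act h v)"
proof -
  obtain c where c: "c \<noteq> 0" "h *v v = c *s act h v" using ex_act_scale[OF assms(2,3)] .
  have "c *s ((h ** g) *v act h v) = (h ** g) *v (h *v v)"
    by (simp add: c vector_scalar_commute)
  also have "\<dots> = h *v ((g ** h) *v v)"
    by (simp add: matrix_vector_mul_assoc matrix_mul_assoc)
  also have "\<dots> = c *s act h v" using assms(4) c by (simp add: Uset_def)
  finally have "(h ** g) *v act h v = act h v" using c(1) by (simp add: vec2_eq_iff)
  then show ?thesis using assms by (simp add: Uset_def mult_in_G0 det_mul mult.commute)
qed

lemma central_U: "central_fun Uk"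
  unfolding central_fun_def Uk_def
proof (intro ballI)
  fix g h assume g: "g \<in> G0" and h: "h \<in> G0"
  have "bij_betw (act h) {v \<in> Lam. g ** h \<in> Uset v} {v \<in> Lam. h ** g \<in> Uset v}"
  proof (rule bij_betwI[where g = "act g"])
    show "act h \<in> {v \<in> Lam. g ** h \<in> Uset v} \<rightarrow> {v \<in> Lam. h ** g \<in> Uset v}"
      using Uset_conj[OF g h] act_in_Lam[OF h] by auto
    show "act g \<in> {v \<in> Lam. h ** g \<in> Uset v} \<rightarrow> {v \<in> Lam. g ** h \<in> Uset v}"
      using Uset_conj[OF h g] act_in_Lam[OF g] by auto
    show "act g (act h v) = v" if "v \<in> {v \<in> Lam. g ** h \<in> Uset v}" for v
      using that act_mult[OF h, of v g] Uset_act[of v "g ** h"] by simp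
    show "act h (act g v) = v" if "v \<in> {v \<in> Lam. h ** g \<in> Uset v}" for v
      using that act_mult[OF g, of v h] Uset_act[of v "h ** g"] by simp
  qed
  then have "card {v \<in> Lam. g ** h \<in> Uset v} = card {v \<in> Lam. h ** g \<in> Uset v}"
    by (rule bij_betw_same_card)
  then show "(of_nat (card {v \<in> Lam. g ** h \<in> Uset v}) :: complex) = of_nat (card {v \<in> Lam. h ** g \<in> Uset v})"
    by simp
qed

lemma central_D: "central_fun Dk"
  by (simp add: central_fun_def Dk_def det_mul mult.commute matrix_mult_2 algebra_simps)

lemma mat_mult_commute: "mat x ** A = A ** mat x" for A :: "'a^2^2"
  by (simp add: mat2_eq_iff matrix_mult_2 mult.commute)

lemma scalar_conj:
  assumes "h \<in> G0" "g ** h = mat x"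
  shows "h ** g = mat x"
proof -
  have "h ** g = (h ** (g ** h)) ** matrix_inv h"
    using assms(1) by (simp add: matrix_mul_assoc)
  also have "\<dots> = mat x" using assms by (simp flip: mat_mult_commute)
  finally show ?thesis .
qed

lemma central_Z: "central_fun Zk"
  unfolding central_fun_def Zk_def using scalar_conj by (intro ballI arg_cong[where f = of_bool] iffI) blast+

lemma mat_in_G0_iff: "mat x \<in> G0 \<longleftrightarrow> x \<in> E"
proof -
  have "x ^ q * (x * x) = x \<longleftrightarrow> x ^ q * x = 1" if "x \<noteq> 0"
    using that mult_cancel_right[of "x ^ q * x" x 1] by (simp add: mult.assoc)
  moreover have "x \<noteq> 0" if "x \<in> E" using that by (rule E_nonzero)
  moreover have "0 ^ q = (0::'a)" using q_ge_3 by (simp add: power_0_left)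
  ultimately show ?thesis by (auto simp: G0_def forall_2 det_2 E_iff)
qed

lemma card_scalars: "card {g \<in> G0. \<exists>x. g = mat x} = q + 1"
proof -
  have "{g \<in> G0. \<exists>x. g = mat x} = (mat :: 'a \<Rightarrow> 'a^2^2) ` E" using mat_in_G0_iff by auto
  moreover have "inj_on (mat :: 'a \<Rightarrow> 'a^2^2) E" by (auto simp: inj_on_def mat2_eq_iff)
  ultimately show ?thesis by (simp add: card_image card_E)
qed

lemma kconv_ZZ:
  assumes "z \<in> G0"
  shows "kconv Zk Zk z = of_nat (q + 1) * Zk z"
proof -
  have "Zk g * Zk (matrix_inv g ** z) = of_bool (\<exists>x. g = mat x) * Zk z" if g: "g \<in> G0" for g
  proof (cases "\<exists>x. g = mat x")
    case True
    then obtain x where x: "g = mat x" by blast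
    have "(\<exists>y. matrix_inv g ** z = mat y) \<longleftrightarrow> (\<exists>y. z = mat y)"
    proof
      assume "\<exists>y. matrix_inv g ** z = mat y"
      then obtain y where "matrix_inv g ** z = mat y" by blast
      then have "z = mat x ** mat y" using inv_mult_cancel(2)[OF g, of z] x by simp
      then have "z = mat (x * y)" by (simp add: mat2_eq_iff matrix_mult_2)
      then show "\<exists>y. z = mat y" by blast
    next
      assume "\<exists>y. z = mat y"
      then obtain y where y: "z = mat y" by blast
      have "x \<noteq> 0" using g x E_nonzero mat_in_G0_iff by blast
      then have "g ** mat (y / x) = z" by (simp add: x y mat2_eq_iff matrix_mult_2)
      then have "matrix_inv g ** z = mat (y / x)" using inv_mult_cancel(1)[OF g] by metis
      then show "\<exists>y. matrix_inv g ** z = mat y" by blast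
    qed
    then show ?thesis using True by (simp add: Zk_def)
  qed (simp add: Zk_def)
  then have "kconv Zk Zk z = (\<Sum>g\<in>G0. of_bool (\<exists>x. g = mat x)) * Zk z"
    by (simp add: kconv_def sum_distrib_right)
  also have "(\<Sum>g\<in>G0. of_bool (\<exists>x. g = mat x) :: complex) = of_nat (card {g \<in> G0. \<exists>x. g = mat x})"
    by (simp add: of_nat_card_filter)
  finally show ?thesis unfolding card_scalars .
qed

text \<open>Lets a twist by the determinant factor out of a count that is the same for all
  determinants.\<close>

lemma sum_over_det:
  assumes "\<And>\<delta>. \<delta> \<in> E \<Longrightarrow> card {g \<in> G0. det g = \<delta> \<and> P g} = c"
  shows "(\<Sum>g\<in>G0. F (det g) * of_bool (P g)) = (\<Sum>\<delta>\<in>E. F \<delta>) * (of_nat c :: complex)"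
proof -
  have "(\<Sum>g\<in>G0. F (det g) * of_bool (P g))
      = (\<Sum>\<delta>\<in>E. \<Sum>g\<in>{g \<in> G0. det g = \<delta>}. F (det g) * of_bool (P g))"
    by (rule sum.group[symmetric]) (use det_in_E in auto)
  also have "\<dots> = (\<Sum>\<delta>\<in>E. F \<delta> * of_nat (card {g \<in> {g \<in> G0. det g = \<delta>}. P g}))"
    by (intro sum.cong refl, subst of_nat_card_filter) (simp_all add: sum_distrib_left)
  also have "\<dots> = (\<Sum>\<delta>\<in>E. F \<delta> * of_nat c)"
    by (intro sum.cong refl) (use assms in \<open>simp add: conj_assoc\<close>)
  finally show ?thesis by (simp add: sum_distrib_right)
qed

text \<open>The summation common to \<open>kconv_MM\<close> and \<open>kconv_UM\<close>. There v is
  a line fixed by g, \<open>m v'\<close> is the image of v' under z, and g has to send v' to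
  \<open>m v'\<close>. A counts the g when v = v' is fixed by m, and B counts them in general
  position; in the two mixed cases injectivity of g leaves none.\<close>

lemma sum_pairs_of_lines:
  assumes m: "\<And>v. v \<in> Lam \<Longrightarrow> m v \<in> Lam"
  shows "(\<Sum>v'\<in>Lam. \<Sum>v\<in>Lam. if v = v' then (if m v' = v' then A else 0) else if m v' = v then 0 else B)
    = of_nat ((q + 1) * (q - 1)) * B + of_nat (card {v \<in> Lam. m v = v}) * (A + B :: complex)"
proof -
  have "(\<Sum>v\<in>Lam. if v = v' then (if m v' = v' then A else 0) else if m v' = v then 0 else B)
      = of_nat (q - 1) * B + of_bool (m v' = v') * (A + B)" if v': "v' \<in> Lam" for v'
  proof -
    have "(\<Sum>v\<in>Lam. if v = v' then (if m v' = v' then A else 0) else if m v' = v then 0 else B)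
        = (if m v' = v' then A else 0) + (\<Sum>v\<in>Lam - {v'}. if m v' = v then 0 else B)"
      by (subst sum.remove[OF _ v']) auto
    also have "(\<Sum>v\<in>Lam - {v'}. if m v' = v then 0 else B) = (\<Sum>v\<in>Lam - {v'} - {m v'}. B)"
      by (rule sum.mono_neutral_cong_right) auto
    also have "\<dots> = of_nat (card (Lam - {v'} - {m v'})) * B" by simp
    also have "card (Lam - {v'} - {m v'}) = (if m v' = v' then q else q - 1)"
      using v' m[OF v'] card_Lam by simp
    finally show ?thesis using q_ge_3 by (simp add: of_nat_diff algebra_simps)
  qed
  then have "(\<Sum>v'\<in>Lam. \<Sum>v\<in>Lam. if v = v' then (if m v' = v' then A else 0) else if m v' = v then 0 else B)
      = (\<Sum>v'\<in>Lam. of_nat (q - 1) * B + of_bool (m v' = v') * (A + B))"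
    by (intro sum.cong) auto
  also have "\<dots> = of_nat (card Lam) * (of_nat (q - 1) * B) + (\<Sum>v'\<in>Lam. of_bool (m v' = v')) * (A + B)"
    by (simp add: sum.distrib sum_distrib_right)
  finally show ?thesis by (simp only: of_nat_card_filter[OF finite] card_Lam of_nat_mult mult.assoc)
qed

section \<open>Products with the twisted permutation character \<open>Mk\<close>\<close>

lemma det_inv_mult: "g \<in> G0 \<Longrightarrow> det (matrix_inv g ** z) = det z / det g"
  by (simp add: det_mul det_inv)

lemma act_inv_mult:
  assumes "g \<in> G0" "z \<in> G0" "v \<in> Lam"
  shows "act (matrix_inv g ** z) v = v \<longleftrightarrow> act g v = act z v"
  using assms by (simp add: act_mult act_inv act_in_Lam)

lemma kconv_MN:
  assumes z: "z \<in> G0" and \<psi>: "quasi_idem n \<psi>"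
  shows "kconv (Mk \<psi>) (Nk \<psi>) z = n * of_nat ((q + 1) * (q * (q - 1))) * Nk \<psi> z"
proof -
  let ?F = "\<lambda>\<delta>. \<psi> \<delta> * \<psi> (det z / \<delta>)"
  have "kconv (Mk \<psi>) (Nk \<psi>) z = (\<Sum>g\<in>G0. \<Sum>v\<in>Lam. ?F (det g) * of_bool (act g v = v))"
    unfolding kconv_def Mk_def Nk_def fixed_lines_def
    by (intro sum.cong refl) (simp only: of_nat_card_filter[OF finite] det_inv_mult sum_distrib_left
        sum_distrib_right mult_ac)
  also have "\<dots> = (\<Sum>v\<in>Lam. \<Sum>g\<in>G0. ?F (det g) * of_bool (act g v = v))"
    by (rule sum.swap)
  also have "\<dots> = (\<Sum>v\<in>Lam. (\<Sum>\<delta>\<in>E. ?F \<delta>) * of_nat (q * (q - 1)))"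
    by (intro sum.cong refl sum_over_det card_line_maps)
  also have "\<dots> = of_nat (card Lam) * ((n * \<psi> (det z)) * of_nat (q * (q - 1)))"
    using \<psi> det_in_E[OF z] by (simp add: quasi_idem_def)
  finally show ?thesis by (simp only: card_Lam Nk_def of_nat_mult mult_ac)
qed

text \<open>The matrix \<open>matrix_inv g ** z\<close> fixes v' exactly when g and z agree on v'.
  So the product counts g together with a fixed line v and a line v' of agreement with z: by
  \<open>card_line_maps\<close> if v = v', and by \<open>card_frame_maps\<close> if v differs from
  both v' and its image under z.\<close>

lemma kconv_MM:
  assumes z: "z \<in> G0" and \<psi>: "quasi_idem n \<psi>"
  shows "kconv (Mk \<psi>) (Mk \<psi>) z = n * of_nat ((q + 1) * (q - 1)) * Mk \<psi> z
    + n * of_nat ((q - 1) * ((q + 1) * (q - 1))) * Nk \<psi> z"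
proof -
  let ?F = "\<lambda>\<delta>. \<psi> \<delta> * \<psi> (det z / \<delta>)"
  let ?C = "\<lambda>v v'. if v = v' then (if act z v' = v' then q * (q - 1) else 0)
    else if act z v' = v then 0 else q - 1"
  have C: "card {g \<in> G0. det g = \<delta> \<and> (act g v = v \<and> act g v' = act z v')} = ?C v v'"
    if v: "v \<in> Lam" "v' \<in> Lam" and \<delta>: "\<delta> \<in> E" for v v' \<delta>
  proof -
    consider "v = v'" "act z v' = v'" | "v = v'" "act z v' \<noteq> v'" | "v \<noteq> v'" "act z v' = v"
      | "v \<noteq> v'" "act z v' \<noteq> v" by blast
    then show ?thesis
    proof cases
      case 1
      then show ?thesis using card_line_maps[OF v(2) v(2) \<delta>] by simp
    next
      case 2
      then have "{g \<in> G0. det g = \<delta> \<and> (act g v = v \<and> act g v' = act z v')} = {}" by auto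
      then show ?thesis using 2 by simp
    next
      case 3
      have "act g v' \<noteq> v" if "g \<in> G0" "act g v = v" for g
        using act_inj[OF that(1) v] that(2) 3(1) by auto
      then have "{g \<in> G0. det g = \<delta> \<and> (act g v = v \<and> act g v' = act z v')} = {}"
        using 3(2) by auto
      then show ?thesis using 3 by simp
    next
      case 4
      then show ?thesis
        using card_frame_maps[OF v _ v(1) act_in_Lam[OF z v(2)] _ \<delta>] by simp
    qed
  qed
  have prod: "of_nat (card (fixed_lines g)) * of_nat (card (fixed_lines (matrix_inv g ** z)))
      = (\<Sum>v'\<in>Lam. \<Sum>v\<in>Lam. of_bool (act g v = v \<and> act g v' = act z v') :: complex)" if g: "g \<in> G0" for g
  proof -
    have "fixed_lines (matrix_inv g ** z) = {v \<in> Lam. act g v = act z v}"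
      using act_inv_mult[OF g z] by (auto simp: fixed_lines_def)
    then show ?thesis
      unfolding fixed_lines_def
      by (simp add: of_nat_card_filter sum_product of_bool_conj mult.commute sum.swap[of _ Lam Lam])
  qed
  have "kconv (Mk \<psi>) (Mk \<psi>) z
      = (\<Sum>g\<in>G0. ?F (det g) * (of_nat (card (fixed_lines g)) * of_nat (card (fixed_lines (matrix_inv g ** z)))))"
    unfolding kconv_def Mk_def by (intro sum.cong refl) (simp add: det_inv_mult mult_ac)
  also have "\<dots> = (\<Sum>g\<in>G0. \<Sum>v'\<in>Lam. \<Sum>v\<in>Lam. ?F (det g) * of_bool (act g v = v \<and> act g v' = act z v'))"
    by (intro sum.cong refl) (simp only: prod sum_distrib_left)
  also have "\<dots> = (\<Sum>v'\<in>Lam. \<Sum>v\<in>Lam. \<Sum>g\<in>G0. ?F (det g) * of_bool (act g v = v \<and> act g v' = act z v'))"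
    by (subst sum.swap) (intro sum.cong refl sum.swap)
  also have "\<dots> = (\<Sum>v'\<in>Lam. \<Sum>v\<in>Lam. (\<Sum>\<delta>\<in>E. ?F \<delta>) * of_nat (?C v v'))"
    by (intro sum.cong refl sum_over_det C)
  also have "\<dots> = (\<Sum>\<delta>\<in>E. ?F \<delta>) * (\<Sum>v'\<in>Lam. \<Sum>v\<in>Lam. if v = v' then (if act z v' = v' then of_nat (q * (q - 1)) else 0)
      else if act z v' = v then 0 else of_nat (q - 1))"
    unfolding sum_distrib_left by (intro sum.cong refl) simp
  also have "\<dots> = n * \<psi> (det z) * (of_nat ((q + 1) * (q - 1)) * of_nat (q - 1)
      + of_nat (card {v \<in> Lam. act z v = v}) * (of_nat (q * (q - 1)) + of_nat (q - 1)))"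
    using \<psi> det_in_E[OF z] act_in_Lam[OF z]
    by (subst sum_pairs_of_lines) (auto simp: quasi_idem_def)
  finally show ?thesis
    by (simp only: Mk_def Nk_def fixed_lines_def of_nat_mult of_nat_add of_nat_1) (simp add: algebra_simps)
qed

section \<open>Products with the transvection sum \<open>Uk\<close>\<close>

lemma sum_U:
  "(\<Sum>g\<in>G0. Uk g * F g) = (\<Sum>v\<in>Lam. \<Sum>g\<in>Uset v. F g)"
proof -
  have "(\<Sum>g\<in>G0. Uk g * F g) = (\<Sum>g\<in>G0. \<Sum>v\<in>Lam. of_bool (g \<in> Uset v) * F g)"
    unfolding Uk_def
    by (intro sum.cong refl, subst of_nat_card_filter) (simp_all add: sum_distrib_right)
  also have "\<dots> = (\<Sum>v\<in>Lam. \<Sum>g\<in>G0. of_bool (g \<in> Uset v) * F g)" by (rule sum.swap)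
  also have "\<dots> = (\<Sum>v\<in>Lam. \<Sum>g\<in>Uset v. F g)"
    by (intro sum.cong refl sum.mono_neutral_cong_right) (auto simp: Uset_def)
  finally show ?thesis .
qed

lemma kconv_UN:
  assumes "z \<in> G0"
  shows "kconv Uk (Nk delta1) z = of_nat (q * (q + 1)) * Nk delta1 z"
proof -
  have "kconv Uk (Nk delta1) z = (\<Sum>v\<in>Lam. \<Sum>g\<in>Uset v. Nk delta1 (matrix_inv g ** z))"
    unfolding kconv_def sum_U ..
  also have "\<dots> = (\<Sum>v\<in>Lam. \<Sum>g\<in>Uset v. Nk delta1 z)"
    by (intro sum.cong refl) (simp add: Nk_def Uset_def det_inv_mult)
  also have "\<dots> = (\<Sum>v\<in>Lam. of_nat q * Nk delta1 z)"
    by (intro sum.cong refl) (simp add: card_Uset)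
  finally show ?thesis by (simp add: card_Lam algebra_simps)
qed

text \<open>The count of \<open>kconv_MM\<close> inside a root subgroup: simple transitivity gives
  exactly one element in general position, and the whole subgroup, of order q, qualifies when v = v'
  is fixed by z.\<close>

lemma kconv_UM:
  assumes z: "z \<in> G0"
  shows "kconv Uk (Mk delta1) z = of_nat (q + 1) * Mk delta1 z + of_nat ((q + 1) * (q - 1)) * Nk delta1 z"
proof -
  let ?C = "\<lambda>v v'. if v = v' then (if act z v' = v' then q else 0) else if act z v' = v then 0 else 1"
  have C: "card {g \<in> Uset v. act g v' = act z v'} = ?C v v'"
    if v: "v \<in> Lam" "v' \<in> Lam" for v v'
  proof (cases "v = v'")
    case True
    then have "{g \<in> Uset v. act g v' = act z v'} = (if act z v' = v' then Uset v else {})"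
      using Uset_act[OF v(1)] by auto
    then show ?thesis using True card_Uset[OF v(1)] by simp
  next
    case False
    show ?thesis
    proof (cases "act z v' = v")
      case True
      have "act g v' \<noteq> v" if "g \<in> Uset v" for g
        using that Uset_act[OF v(1) that] act_inj[of g v' v] v False by (auto simp: Uset_def)
      then have "{g \<in> Uset v. act g v' = act z v'} = {}" using True by auto
      then show ?thesis using False True by simp
    next
      case F: False
      obtain u where u: "u \<in> Uset v" "act u v' = act z v'"
        using ex_Uset[OF v act_in_Lam[OF z v(2)] _ F] False by blast
      then have "{g \<in> Uset v. act g v' = act z v'} = {u}"
        using Uset_unique[OF v False[symmetric]] by auto
      then show ?thesis using False F by simp
    qed
  qed
  have "kconv Uk (Mk delta1) z = (\<Sum>v\<in>Lam. \<Sum>g\<in>Uset v. Mk delta1 (matrix_inv g ** z))"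
    unfolding kconv_def sum_U ..
  also have "\<dots> = (\<Sum>v\<in>Lam. \<Sum>g\<in>Uset v. delta1 (det z) * (\<Sum>v'\<in>Lam. of_bool (act g v' = act z v')))"
  proof (intro sum.cong refl)
    fix v g assume "g \<in> Uset v"
    then have g: "g \<in> G0" "det g = 1" by (simp_all add: Uset_def)
    have "fixed_lines (matrix_inv g ** z) = {v' \<in> Lam. act g v' = act z v'}"
      using act_inv_mult[OF g(1) z] by (auto simp: fixed_lines_def)
    then show "Mk delta1 (matrix_inv g ** z) = delta1 (det z) * (\<Sum>v'\<in>Lam. of_bool (act g v' = act z v'))"
      using g by (simp add: Mk_def det_inv_mult of_nat_card_filter)
  qed
  also have "\<dots> = delta1 (det z) * (\<Sum>v\<in>Lam. \<Sum>v'\<in>Lam. \<Sum>g\<in>Uset v. of_bool (act g v' = act z v'))"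
    by (simp only: sum_distrib_left[symmetric] sum.swap[of _ Lam "Uset _"])
  also have "\<dots> = delta1 (det z) * (\<Sum>v'\<in>Lam. \<Sum>v\<in>Lam. \<Sum>g\<in>Uset v. of_bool (act g v' = act z v'))"
    by (subst sum.swap) simp
  also have "(\<Sum>v'\<in>Lam. \<Sum>v\<in>Lam. \<Sum>g\<in>Uset v. of_bool (act g v' = act z v') :: complex)
     = (\<Sum>v'\<in>Lam. \<Sum>v\<in>Lam. if v = v' then (if act z v' = v' then of_nat q else 0)
         else if act z v' = v then 0 else 1)"
  proof (intro sum.cong refl)
    fix v v' assume v: "v' \<in> Lam" "v \<in> Lam"
    have "(\<Sum>g\<in>Uset v. of_bool (act g v' = act z v') :: complex) = of_nat (?C v v')"
      unfolding C[OF v(2,1), symmetric] by (simp add: of_nat_card_filter)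
    then show "(\<Sum>g\<in>Uset v. of_bool (act g v' = act z v') :: complex)
      = (if v = v' then (if act z v' = v' then of_nat q else 0) else if act z v' = v then 0 else 1)"
      by simp
  qed
  also have "\<dots> = of_nat ((q + 1) * (q - 1)) * 1 + of_nat (card {v \<in> Lam. act z v = v}) * (of_nat q + 1)"
    using act_in_Lam[OF z] by (intro sum_pairs_of_lines)
  finally show ?thesis
    by (simp add: Mk_def[of _ z] Nk_def[of _ z] fixed_lines_def distrib_left distrib_right mult_ac add_ac
        del: of_nat_mult of_bool_eq(2))
qed

text \<open>An element of \<open>Uset v\<close> moves every vector by a multiple of v. So if z moves
  the line v', the axis must be the line of \<open>z *v v' - v'\<close>, and exactly one element
  does it. If z fixes the line v' with a multiplier other than 1, preservation of
  \<open>cross2\<close> leaves none. If z fixes the vector v', the identity qualifies for each of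
  the q axes.\<close>

lemma card_Uset_meeting:
  assumes z: "z \<in> G0" "det z = 1" and v': "v' \<in> Lam"
  shows "(\<Sum>v\<in>Lam - {v'}. card {g \<in> Uset v. g *v v' = z *v v'})
    = (if z *v v' = v' then q else if act z v' = v' then 0 else 1)"
proof -
  let ?S = "\<lambda>v. {g \<in> Uset v. g *v v' = z *v v'}"
  consider "z *v v' = v'" | "z *v v' \<noteq> v'" "act z v' = v'" | "act z v' \<noteq> v'" "z *v v' \<noteq> v'"
    by blast
  then show ?thesis
  proof cases
    case 1
    have "?S v = {mat 1}" if v: "v \<in> Lam - {v'}" for v
    proof -
      have one: "mat 1 \<in> Uset v" by (simp add: Uset_def one_in_G0)
      moreover have "g = mat 1" if "g \<in> ?S v" for g
        using that 1 v v' one by (intro Uset_unique[of v v']) (auto simp: act_def)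
      ultimately show ?thesis using 1 by auto
    qed
    then have "(\<Sum>v\<in>Lam - {v'}. card (?S v)) = (\<Sum>v\<in>Lam - {v'}. 1)"
      by (intro sum.cong refl) simp
    then show ?thesis using 1 v' card_Lam by simp
  next
    case 2
    obtain c where c: "z *v v' = c *s v'" using act_eigen[OF z(1) v' 2(2)] .
    have "?S v = {}" if v: "v \<in> Lam - {v'}" for v
    proof -
      have False if "g \<in> ?S v" for g
      proof -
        have "cross2 v (c *s v') = cross2 v v'"
          using cross2_mult[of g v v'] that c by (simp add: Uset_def)
        then have "c = 1" using v v' by (simp add: cross2_scale cross2_eq_0_iff)
        then show False using 2(1) c by simp
      qed
      then show ?thesis by blast
    qed
    then show ?thesis using 2 by simp
  next
    case 3
    define w where "w = act z v'"
    have w: "w \<in> Lam" "w \<noteq> v'" using act_in_Lam[OF z(1) v'] 3 by (auto simp: w_def)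
    \<comment> \<open>Spans the only possible axis. Its coordinates lie in \<open>Fq\<close> because
      determinant 1 puts the entries of z there.\<close>
    define s where "s = z *v v' - v'"
    define v0 where "v0 = nrm s"
    have "s \<noteq> 0" using 3 by (simp add: s_def)
    then obtain c where c: "c \<noteq> 0" "s = c *s v0" unfolding v0_def by (rule ex_scale_nrm)
    have "z$i$j \<in> Fq" for i j using z by (auto simp: G0_def Fq_def)
    then have "s$i \<in> Fq" for i
      using Lam_in_Fq[OF v'] by (simp add: s_def matrix_vector_mult_2 Fq_closed)
    then have v0: "v0 \<in> Lam" by (simp add: v0_def nrm_in_Lam_iff Fq_closed)
    have zv: "z *v v' = v' + c *s v0" using c(2) by (simp add: s_def algebra_simps)
    have v0v': "v0 \<noteq> v'"
    proof
      assume "v0 = v'"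
      then have e: "z *v v' = (1 + c) *s v'" using zv by (simp add: entries_2 algebra_simps)
      have "1 + c \<noteq> 0"
      proof
        assume "1 + c = 0"
        then have "z *v v' = 0" using e by simp
        then show False using mult_vec_nonzero[OF z(1) Lam_nonzero[OF v']] by simp
      qed
      from act_eqI[OF e this v'] show False using 3(1) by simp
    qed
    have cr: "cross2 v0 (z *v v') = cross2 v0 v'"
      by (simp add: zv cross2_def algebra_simps)
    obtain a where a: "z *v v' = a *s w" using ex_act_scale[OF z(1) v'] unfolding w_def .
    have v0w: "v0 \<noteq> w"
      using cr v0v' cross2_eq_0_iff[OF v0 v'] by (auto simp: a cross2_scale cross2_def)
    obtain u where u: "u \<in> Uset v0" "act u v' = w"
      using ex_Uset[OF v0 v' w(1) v0v'[symmetric] v0w[symmetric]] by blast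
    have uG: "u \<in> G0" "det u = 1" "u *v v0 = v0" using u(1) by (simp_all add: Uset_def)
    obtain b where b: "u *v v' = b *s w" using ex_act_scale[OF uG(1) v'] unfolding u(2) .
    have "b * cross2 v0 w = a * cross2 v0 w"
      using cross2_mult[of u v0 v'] cr uG by (simp add: a b cross2_scale)
    then have "a = b" using v0w cross2_eq_0_iff[OF v0 w(1)] by simp
    then have "u \<in> ?S v0" using u a b by simp
    moreover have "g = u" if "g \<in> ?S v0" for g
      using that u a b \<open>a = b\<close> by (intro Uset_unique[OF v0 v' v0v'[symmetric]]) (auto simp: act_def)
    ultimately have "?S v0 = {u}" by blast
    moreover have "?S v = {}" if v: "v \<in> Lam" "v \<noteq> v0" for v
    proof -
      have False if "g \<in> ?S v" for g
      proof -
        have "cross2 v (v' + c *s v0) = cross2 v v'"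
          using cross2_mult[of g v v'] that zv by (simp add: Uset_def)
        then have "c * cross2 v v0 = 0" by (simp add: cross2_def algebra_simps)
        then show False using v v0 c by (simp add: cross2_eq_0_iff)
      qed
      then show ?thesis by blast
    qed
    ultimately have "(\<Sum>v\<in>Lam - {v'}. card (?S v)) = (\<Sum>v\<in>Lam - {v'}. of_bool (v = v0))"
      by (intro sum.cong refl) auto
    then show ?thesis using 3 v0 v0v' by simp
  qed
qed

text \<open>Axes v and v' contribute the g in \<open>Uset v\<close> with
  \<open>g *v v' = z *v v'\<close>. For z of determinant 1 and fixed v', the sum over v is 2q if z
  fixes the vector v', 0 if it fixes only the line, and 1 if it moves the line. That is 2q times the
  indicator of \<open>Uset v'\<close>, plus 1, minus the indicator of v' being a fixed line.\<close>

lemma kconv_UU: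
  assumes z: "z \<in> G0"
  shows "kconv Uk Uk z = 2 * of_nat q * Uk z - Mk delta1 z + of_nat (q + 1) * Nk delta1 z"
proof -
  have S: "(\<Sum>g\<in>Uset v. Uk (matrix_inv g ** z))
      = of_bool (det z = 1) * (\<Sum>v'\<in>Lam. of_nat (card {g \<in> Uset v. g *v v' = z *v v'}))"
    if v: "v \<in> Lam" for v
  proof -
    have "Uk (matrix_inv g ** z) = of_bool (det z = 1) * (\<Sum>v'\<in>Lam. of_bool (g *v v' = z *v v'))"
      if "g \<in> Uset v" for g
    proof -
      have g: "g \<in> G0" "det g = 1" using that by (simp_all add: Uset_def)
      have "(matrix_inv g ** z) *v v' = v' \<longleftrightarrow> g *v v' = z *v v'" for v'
      proof
        assume "(matrix_inv g ** z) *v v' = v'"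
        then have "g *v v' = g *v ((matrix_inv g ** z) *v v')" by simp
        then show "g *v v' = z *v v'" using g by (simp add: matrix_vector_mul_assoc)
      next
        assume "g *v v' = z *v v'"
        then have "(matrix_inv g ** z) *v v' = matrix_inv g *v (g *v v')"
          by (simp add: matrix_vector_mul_assoc)
        then show "(matrix_inv g ** z) *v v' = v'" using g by (simp add: matrix_vector_mul_assoc inv_left)
      qed
      then have "{v' \<in> Lam. matrix_inv g ** z \<in> Uset v'} = {v' \<in> Lam. det z = 1 \<and> g *v v' = z *v v'}"
        using g z by (auto simp: Uset_def mult_in_G0 matrix_inv_in_G0 det_inv_mult)
      then show ?thesis by (simp add: Uk_def of_nat_card_filter)
    qed
    then have "(\<Sum>g\<in>Uset v. Uk (matrix_inv g ** z))
        = of_bool (det z = 1) * (\<Sum>g\<in>Uset v. \<Sum>v'\<in>Lam. of_bool (g *v v' = z *v v'))"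
      by (simp add: sum_distrib_left)
    also have "(\<Sum>g\<in>Uset v. \<Sum>v'\<in>Lam. of_bool (g *v v' = z *v v') :: complex)
        = (\<Sum>v'\<in>Lam. of_nat (card {g \<in> Uset v. g *v v' = z *v v'}))"
      by (subst sum.swap) (simp add: of_nat_card_filter)
    finally show ?thesis .
  qed
  have "kconv Uk Uk z = of_bool (det z = 1)
      * (\<Sum>v\<in>Lam. \<Sum>v'\<in>Lam. of_nat (card {g \<in> Uset v. g *v v' = z *v v'}))"
    unfolding kconv_def sum_U sum_distrib_left[of _ _ Lam] by (intro sum.cong refl) (simp add: S sum_distrib_left)
  also have "(\<Sum>v\<in>Lam. \<Sum>v'\<in>Lam. of_nat (card {g \<in> Uset v. g *v v' = z *v v'}))
      = (of_nat (\<Sum>v'\<in>Lam. \<Sum>v\<in>Lam. card {g \<in> Uset v. g *v v' = z *v v'}) :: complex)"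
    by (subst sum.swap) simp
  finally have e: "kconv Uk Uk z = of_bool (det z = 1)
      * of_nat (\<Sum>v'\<in>Lam. \<Sum>v\<in>Lam. card {g \<in> Uset v. g *v v' = z *v v'})" .
  show ?thesis
  proof (cases "det z = 1")
    case False
    then show ?thesis using e by (simp add: Mk_def Nk_def Uk_def Uset_def)
  next
    case det: True
    have "(\<Sum>v\<in>Lam. card {g \<in> Uset v. g *v v' = z *v v'}) + of_bool (act z v' = v')
        = 2 * q * of_bool (z \<in> Uset v') + 1" if v': "v' \<in> Lam" for v'
    proof -
      have "{g \<in> Uset v'. g *v v' = z *v v'} = (if z *v v' = v' then Uset v' else {})"
        by (auto simp: Uset_def)
      moreover have "z *v v' = v' \<Longrightarrow> act z v' = v'" using v' by (simp add: act_def nrm_Lam)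
      ultimately show ?thesis
        unfolding sum.remove[OF finite v', of "\<lambda>v. card {g \<in> Uset v. g *v v' = z *v v'}"]
          card_Uset_meeting[OF z det v']
        using card_Uset[OF v'] z det by (auto simp: Uset_def)
    qed
    then have "(\<Sum>v'\<in>Lam. (\<Sum>v\<in>Lam. card {g \<in> Uset v. g *v v' = z *v v'}) + of_bool (act z v' = v'))
        = (\<Sum>v'\<in>Lam. 2 * q * of_bool (z \<in> Uset v') + 1)"
      by (intro sum.cong refl)
    then have "(\<Sum>v'\<in>Lam. \<Sum>v\<in>Lam. card {g \<in> Uset v. g *v v' = z *v v'}) + card (fixed_lines z)
        = 2 * q * card {v \<in> Lam. z \<in> Uset v} + (q + 1)"
      unfolding sum.distrib sum_distrib_left[symmetric] fixed_lines_def
        of_nat_card_filter[OF finite, where 'b = nat, unfolded of_nat_id] by (simp add: card_Lam)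
    from arg_cong[OF this, of "of_nat :: nat \<Rightarrow> complex"]
    have "of_nat (\<Sum>v'\<in>Lam. \<Sum>v\<in>Lam. card {g \<in> Uset v. g *v v' = z *v v'}) + of_nat (card (fixed_lines z))
        = (of_nat (2 * q * card {v \<in> Lam. z \<in> Uset v} + (q + 1)) :: complex)"
      by (simp only: of_nat_add)
    then have "kconv Uk Uk z = of_nat (2 * q * card {v \<in> Lam. z \<in> Uset v} + (q + 1)) - of_nat (card (fixed_lines z))"
      using e det by (simp only: eq_diff_eq) simp
    then show ?thesis
      using det by (simp add: Mk_def[of _ z] Nk_def[of _ z] Uk_def[of z])
  qed
qed

section \<open>The square of the involution sum \<open>Dk\<close>\<close>

definition trace_pair :: "'a^2^2 \<Rightarrow> ('a^2^2) set" where
  "trace_pair z = {s \<in> G0. s$1$1 + s$2$2 = 0 \<and> det s = - 1 \<and> (s ** z)$1$1 + (s ** z)$2$2 = 0}"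

text \<open>Trace 0 and determinant -1 make s an involution, so for determinant 1 the factorisations
  of z into two elements of the class correspond to the s for which \<open>s ** z\<close> again has
  trace 0. These are collected in \<open>trace_pair\<close>.\<close>

lemma kconv_DD_card:
  assumes z: "z \<in> G0"
  shows "kconv Dk Dk z = of_bool (det z = 1) * of_nat (card (trace_pair z))"
proof -
  have "Dk s * Dk (matrix_inv s ** z) = of_bool (det z = 1) * of_bool (s$1$1 + s$2$2 = 0 \<and> det s = - 1
      \<and> (s ** z)$1$1 + (s ** z)$2$2 = 0)" if s: "s \<in> G0" for s
  proof (cases "s$1$1 + s$2$2 = 0 \<and> det s = - 1")
    case True
    have "s ** s = mat 1"
    proof -
      have "s$2$2 = - s$1$1" using True by (simp add: add_eq_0_iff2)
      moreover from this have "s$1$1 * s$1$1 + s$1$2 * s$2$1 = 1"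
        using True by (simp add: det_2) algebra
      ultimately show ?thesis by (simp add: mat2_eq_iff matrix_mult_2 mult.commute add.commute)
    qed
    then have "matrix_inv s = s"
      using inv_mult_cancel(1)[OF s, of s] mult_inv_cancel(1)[OF s, of s]
      by (metis matrix_mul_lid matrix_mul_rid s inv_left matrix_mul_assoc)
    then show ?thesis using True by (auto simp: Dk_def det_mul)
  qed (auto simp: Dk_def)
  then have "kconv Dk Dk z = of_bool (det z = 1) * (\<Sum>s\<in>G0. of_bool (s$1$1 + s$2$2 = 0 \<and> det s = - 1
      \<and> (s ** z)$1$1 + (s ** z)$2$2 = 0))"
    by (simp only: kconv_def sum_distrib_left cong: sum.cong)
  then show ?thesis by (simp only: trace_pair_def of_nat_card_filter[OF finite])
qed

lemma trace_pair_conj: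
  assumes h: "h \<in> G0"
  shows "card (trace_pair (h ** z ** matrix_inv h)) = card (trace_pair z)"
proof -
  have tr: "(A ** B)$1$1 + (A ** B)$2$2 = (B ** A)$1$1 + (B ** A)$2$2" for A B :: "'a^2^2"
    by (simp add: matrix_mult_2 algebra_simps)
  have conj: "k ** s ** matrix_inv k \<in> trace_pair (k ** y ** matrix_inv k)"
    if k: "k \<in> G0" and s: "s \<in> trace_pair y" for k s y
  proof -
    have "(k ** s ** matrix_inv k)$1$1 + (k ** s ** matrix_inv k)$2$2 = s$1$1 + s$2$2"
      using k by (subst tr) (simp add: matrix_mul_assoc inv_left)
    moreover have "k ** s ** matrix_inv k ** (k ** y ** matrix_inv k) = k ** (s ** y) ** matrix_inv k"
      using k by (simp flip: matrix_mul_assoc)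
    moreover have "(k ** (s ** y) ** matrix_inv k)$1$1 + (k ** (s ** y) ** matrix_inv k)$2$2
        = (s ** y)$1$1 + (s ** y)$2$2"
      using k by (subst tr) (simp add: matrix_mul_assoc inv_left)
    ultimately show ?thesis
      using s k det_nonzero[OF k]
      by (simp add: trace_pair_def mult_in_G0 matrix_inv_in_G0 det_mul det_inv)
  qed
  have "bij_betw (\<lambda>s. h ** s ** matrix_inv h) (trace_pair z) (trace_pair (h ** z ** matrix_inv h))"
  proof (rule bij_betwI[where g = "\<lambda>s. matrix_inv h ** s ** h"])
    show "(\<lambda>s. matrix_inv h ** s ** h) \<in> trace_pair (h ** z ** matrix_inv h) \<rightarrow> trace_pair z"
      using conj[OF matrix_inv_in_G0[OF h], of _ "h ** z ** matrix_inv h"] h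
      by (auto simp: matrix_inv_inv matrix_mul_assoc inv_left)
  qed (use conj[OF h] h in \<open>auto simp: matrix_mul_assoc inv_left inv_right\<close>)
  then show ?thesis by (simp add: bij_betw_same_card)
qed

text \<open>With s written as rows (a, b) and (c, -a), the trace of \<open>s ** z\<close> is linear
  in a, b, c. The count becomes that of a plane section of the quadric
  \<open>a\<^sup>2 + b * c = 1\<close> over \<open>Fm\<close>.\<close>

lemma trace_pair_eq:
  "trace_pair z = (\<lambda>(a, b, c). mat2 a b c (- a)) ` {(a, b, c). a \<in> Fm \<and> b \<in> Fm \<and> c \<in> Fm \<and> a\<^sup>2 + b * c = 1
    \<and> a * (z$1$1 - z$2$2) + b * z$2$1 + c * z$1$2 = 0}"
  (is "_ = ?f ` ?T")
proof (intro equalityI subsetI)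
  fix s assume s: "s \<in> trace_pair z"
  then have d: "s$2$2 = - s$1$1" "det s = - 1" and e: "s$i$j ^ q * det s = s$i$j" for i j
    by (auto simp: trace_pair_def G0_def add_eq_0_iff2)
  have "s$i$j ^ q = - s$i$j" for i j
    using e[of i j] unfolding d(2) by (metis minus_minus mult_minus1_right)
  then have "(s$1$1, s$1$2, s$2$1) \<in> ?T"
    using s d by (auto simp: trace_pair_def Fm_def det_2 matrix_mult_2 power2_eq_square algebra_simps)
  moreover have "s = ?f (s$1$1, s$1$2, s$2$1)" using d by (simp add: mat2_eq_iff)
  ultimately show "s \<in> ?f ` ?T" by (rule image_eqI[rotated])
next
  fix s assume "s \<in> ?f ` ?T"
  then obtain a b c where s: "s = mat2 a b c (- a)" and abc: "(a, b, c) \<in> ?T" by auto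
  have d: "det s = - 1" using abc by (simp add: s det_2 power2_eq_square) algebra
  have "s$1$1 + s$2$2 = 0" "(s ** z)$1$1 + (s ** z)$2$2 = 0"
    using abc by (simp_all add: s matrix_mult_2 algebra_simps)
  moreover have "\<forall>i j. s$i$j ^ q * (- 1) = s$i$j"
    using abc by (simp add: s forall_2 Fm_def frobenius_minus)
  ultimately show "s \<in> trace_pair z" by (simp add: trace_pair_def G0_def d)
qed

lemma card_trace_pair:
  "card (trace_pair z) = card {(a, b, c). a \<in> Fm \<and> b \<in> Fm \<and> c \<in> Fm \<and> a\<^sup>2 + b * c = 1
    \<and> a * (z$1$1 - z$2$2) + b * z$2$1 + c * z$1$2 = 0}"
  unfolding trace_pair_eq by (rule card_image) (auto simp: inj_on_def mat2_eq_iff)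

lemma Fm_closed:
  "x \<in> Fm \<Longrightarrow> y \<in> Fq \<Longrightarrow> x * y \<in> Fm" "y \<in> Fq \<Longrightarrow> x \<in> Fm \<Longrightarrow> y * x \<in> Fm"
  "x \<in> Fm \<Longrightarrow> y \<in> Fm \<Longrightarrow> x * y \<in> Fq" "x \<in> Fm \<Longrightarrow> y \<in> Fm \<Longrightarrow> x / y \<in> Fq"
  "x \<in> Fq \<Longrightarrow> y \<in> Fm \<Longrightarrow> x / y \<in> Fm" "x \<in> Fm \<Longrightarrow> y \<in> Fq \<Longrightarrow> x / y \<in> Fm"
  "x \<in> Fm \<Longrightarrow> - x \<in> Fm" "x \<in> Fm \<Longrightarrow> y \<in> Fm \<Longrightarrow> x + y \<in> Fm"
  by (auto simp: Fm_def Fq_def power_mult_distrib power_divide frobenius_minus frobenius_add)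

text \<open>Consequently b and c are nonzero on the quadric \<open>a\<^sup>2 + b * c = 1\<close>
  over \<open>Fm\<close>, and the counts may divide by them.\<close>

lemma Fm_square_ne_1: "x \<in> Fm \<Longrightarrow> x\<^sup>2 \<noteq> 1"
  using Fq_Fm_0[of x] Fq_closed by (auto simp: power2_eq_1_iff)

text \<open>For scalar z the linear condition is vacuous: a and a nonzero b are free, and c is
  determined by them.\<close>

lemma card_trace_pair_scalar:
  assumes "z = mat x"
  shows "card (trace_pair z) = q * (q - 1)"
proof -
  have "bij_betw (\<lambda>(a, b, c). (a, b)) {(a, b, c). a \<in> Fm \<and> b \<in> Fm \<and> c \<in> Fm \<and> a\<^sup>2 + b * c = 1
    \<and> a * (z$1$1 - z$2$2) + b * z$2$1 + c * z$1$2 = 0} (Fm \<times> (Fm - {0}))"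
  proof (rule bij_betwI[where g = "\<lambda>(a, b). (a, b, (1 - a\<^sup>2) / b)"])
    have solve: "(1 - a\<^sup>2) / b = c" if "a \<in> Fm" "a\<^sup>2 + b * c = 1" for a b c :: 'a
    proof -
      have "b \<noteq> 0" using that Fm_square_ne_1 by auto
      moreover have "1 - a\<^sup>2 = b * c" using that by (metis add_diff_cancel_left')
      ultimately show ?thesis by simp
    qed
    show "(\<lambda>(a, b, c). (a, b)) \<in> {(a, b, c). a \<in> Fm \<and> b \<in> Fm \<and> c \<in> Fm \<and> a\<^sup>2 + b * c = 1
        \<and> a * (z$1$1 - z$2$2) + b * z$2$1 + c * z$1$2 = 0} \<rightarrow> Fm \<times> (Fm - {0})"
      using Fm_square_ne_1 by auto
    show "(\<lambda>(a, b). (a, b, (1 - a\<^sup>2) / b)) \<in> Fm \<times> (Fm - {0}) \<rightarrow> {(a, b, c). a \<in> Fm \<and> b \<in> Fm \<and> c \<in> Fm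
        \<and> a\<^sup>2 + b * c = 1 \<and> a * (z$1$1 - z$2$2) + b * z$2$1 + c * z$1$2 = 0}"
      by (auto simp: assms power2_eq_square Fm_closed Fq_closed)
    show "(case (case p of (a, b, c) \<Rightarrow> (a, b)) of (a, b) \<Rightarrow> (a, b, (1 - a\<^sup>2) / b)) = p"
      if "p \<in> {(a, b, c). a \<in> Fm \<and> b \<in> Fm \<and> c \<in> Fm \<and> a\<^sup>2 + b * c = 1
        \<and> a * (z$1$1 - z$2$2) + b * z$2$1 + c * z$1$2 = 0}" for p
      using that solve by auto
  qed auto
  then have "card (trace_pair z) = card (Fm \<times> (Fm - {0}))"
    unfolding card_trace_pair by (rule bij_betw_same_card)
  moreover have "0 \<in> Fm" using q_ge_3 by (simp add: Fm_def power_0_left)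
  ultimately show ?thesis by (simp add: card_cartesian_product card_Fm)
qed

text \<open>The affine hyperbola is parametrised by \<open>u = x - h - y\<close>.\<close>

lemma card_hyperbola:
  assumes h: "h \<in> Fq" and k: "k \<in> Fq" "k \<noteq> 0"
  shows "card {(x, y). x \<in> Fq \<and> y \<in> Fq \<and> y\<^sup>2 = (x - h)\<^sup>2 - k} = q - 1"
proof -
  define i :: 'a where "i = 1 / 2"
  have i: "2 * i = 1" "i \<in> Fq" using two_neq_zero by (simp_all add: i_def Fq_closed numeral_in_Fq)
  have iff: "y\<^sup>2 = (x - h)\<^sup>2 - k \<longleftrightarrow> (x - h - y) * (x - h + y) = k" for x y
    by (auto simp: power2_eq_square algebra_simps)
  have uv: "(u + v) * i - (v - u) * i = u" "(u + v) * i + (v - u) * i = v" for u v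
  proof -
    have "(u + v) * i - (v - u) * i = u * (2 * i)" "(u + v) * i + (v - u) * i = v * (2 * i)"
      by (simp_all add: algebra_simps)
    then show "(u + v) * i - (v - u) * i = u" "(u + v) * i + (v - u) * i = v"
      unfolding i by simp_all
  qed
  have xy: "h + ((x - h - y) + (x - h + y)) * i = x" "((x - h + y) - (x - h - y)) * i = y" for x y
  proof -
    have "h + ((x - h - y) + (x - h + y)) * i = h + (x - h) * (2 * i)"
      "((x - h + y) - (x - h - y)) * i = y * (2 * i)" by (simp_all add: algebra_simps)
    then show "h + ((x - h - y) + (x - h + y)) * i = x" "((x - h + y) - (x - h - y)) * i = y"
      unfolding i by simp_all
  qed
  let ?H = "{(x, y). x \<in> Fq \<and> y \<in> Fq \<and> (x - h - y) * (x - h + y) = k}"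
  have "bij_betw (\<lambda>(x, y). x - h - y) ?H (Fq - {0})"
  proof (rule bij_betwI[where g = "\<lambda>u. (h + (u + k / u) * i, (k / u - u) * i)"])
    show "(\<lambda>(x, y). x - h - y) \<in> ?H \<rightarrow> Fq - {0}"
      using h k by (auto simp: Fq_closed)
    show "(\<lambda>u. (h + (u + k / u) * i, (k / u - u) * i)) \<in> Fq - {0} \<rightarrow> ?H"
      using h k i(2) by (auto simp: Fq_closed uv)
    show "(case (h + (u + k / u) * i, (k / u - u) * i) of (x, y) \<Rightarrow> x - h - y) = u" for u
      by (simp add: uv)
    show "(\<lambda>u. (h + (u + k / u) * i, (k / u - u) * i)) (case p of (x, y) \<Rightarrow> x - h - y) = p" if H: "p \<in> ?H" for p
    proof -
      obtain x y where p: "p = (x, y)" "(x - h - y) * (x - h + y) = k" using H by auto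
      have "x - h - y \<noteq> 0" using p(2) k(2) by auto
      then have v: "k / (x - h - y) = x - h + y" using p(2)[symmetric] by simp
      show ?thesis unfolding p(1) prod.case v xy ..
    qed
  qed
  then have "card ?H = card (Fq - {0})" by (rule bij_betw_same_card)
  then show ?thesis unfolding iff using Fq_closed(1) card_Fq by simp
qed

text \<open>Let p be the value of \<open>(x - h)\<^sup>2 - k\<close>. If p is nonzero, 1 / p has two
  square roots in \<open>Fq\<close> and \<open>Fm\<close> together, and those in \<open>Fq\<close>
  are the inverses of the square roots of p counted by \<open>card_hyperbola\<close>. So the
  solutions in \<open>Fm\<close> number 2q, less the q - 1 points of the hyperbola, less the zeros
  of p. For k = 0 the left-hand side is the square of an element of \<open>Fm\<close> and is never
  1.\<close>

lemma card_twisted_conic: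
  assumes h: "h \<in> Fq" and k: "k \<in> Fq"
  shows "card {(x, c). x \<in> Fq \<and> c \<in> Fm \<and> c\<^sup>2 * ((x - h)\<^sup>2 - k) = 1}
    = (if k = 0 then 0 else q + 1 - card {x \<in> Fq. (x - h)\<^sup>2 = k})"
proof (cases "k = 0")
  case True
  have "c\<^sup>2 * ((x - h)\<^sup>2 - k) \<noteq> 1" if "x \<in> Fq" "c \<in> Fm" for x c
    using Fm_square_ne_1[of "c * (x - h)"] that h True by (simp add: Fm_closed Fq_closed power_mult_distrib)
  then have "{(x, c). x \<in> Fq \<and> c \<in> Fm \<and> c\<^sup>2 * ((x - h)\<^sup>2 - k) = 1} = {}" by auto
  then show ?thesis using True by simp
next
  case False
  let ?p = "\<lambda>x. (x - h)\<^sup>2 - k"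
  \<comment> \<open>Where p vanishes, y = 0 is the only root, and the indicator supplies the missing
    one.\<close>
  have fib: "card {c \<in> Fm. c\<^sup>2 * ?p x = 1} + card {y \<in> Fq. y\<^sup>2 = ?p x} + of_bool ((x - h)\<^sup>2 = k) = 2"
    if x: "x \<in> Fq" for x
  proof (cases "?p x = 0")
    case True
    then have "{y \<in> Fq. y\<^sup>2 = ?p x} = {0}" using Fq_closed by auto
    then show ?thesis using True by simp
  next
    case F: False
    have pF: "1 / ?p x \<in> Fq" using x h k by (simp add: Fq_closed power2_eq_square)
    have "{c \<in> Fm. c\<^sup>2 * ?p x = 1} = {c \<in> Fm. c\<^sup>2 = 1 / ?p x}"
      using F by (simp add: nonzero_eq_divide_eq)
    moreover have "card {y \<in> Fq. y\<^sup>2 = ?p x} = card {y \<in> Fq. y\<^sup>2 = 1 / ?p x}"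
    proof (rule bij_betw_same_card[where f = "\<lambda>y. 1 / y"], rule bij_betwI[where g = "\<lambda>y. 1 / y"])
      show "(\<lambda>y. 1 / y) \<in> {y \<in> Fq. y\<^sup>2 = ?p x} \<rightarrow> {y \<in> Fq. y\<^sup>2 = 1 / ?p x}"
        "(\<lambda>y. 1 / y) \<in> {y \<in> Fq. y\<^sup>2 = 1 / ?p x} \<rightarrow> {y \<in> Fq. y\<^sup>2 = ?p x}"
        by (auto simp: Fq_closed power_one_over)
    qed auto
    ultimately show ?thesis using card_square_roots[OF pF] F by simp
  qed
  have A: "card {(x, y). x \<in> Fq \<and> P x y} = (\<Sum>x\<in>Fq. card {y. P x y})" for P :: "'a \<Rightarrow> 'a \<Rightarrow> bool"
  proof -
    have "{(x, y). x \<in> Fq \<and> P x y} = (SIGMA x:Fq. {y. P x y})" by auto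
    then show ?thesis by simp
  qed
  have "(\<Sum>x\<in>Fq. card {c \<in> Fm. c\<^sup>2 * ?p x = 1} + card {y \<in> Fq. y\<^sup>2 = ?p x} + of_bool ((x - h)\<^sup>2 = k)) = (\<Sum>x\<in>Fq. 2)"
    using fib by (intro sum.cong refl)
  then have "(\<Sum>x\<in>Fq. card {c \<in> Fm. c\<^sup>2 * ?p x = 1}) + (\<Sum>x\<in>Fq. card {y \<in> Fq. y\<^sup>2 = ?p x})
      + card {x \<in> Fq. (x - h)\<^sup>2 = k} = q * 2"
    unfolding sum.distrib of_nat_card_filter[OF finite, where 'b = nat, unfolded of_nat_id] by (simp add: card_Fq)
  moreover have "(\<Sum>x\<in>Fq. card {y \<in> Fq. y\<^sup>2 = ?p x}) = q - 1"
    using card_hyperbola[OF h k False] A[of "\<lambda>x y. y \<in> Fq \<and> y\<^sup>2 = ?p x"] by simp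
  moreover have "card {(x, c). x \<in> Fq \<and> c \<in> Fm \<and> c\<^sup>2 * ?p x = 1} = (\<Sum>x\<in>Fq. card {c \<in> Fm. c\<^sup>2 * ?p x = 1})"
    using A[of "\<lambda>x c. c \<in> Fm \<and> c\<^sup>2 * ?p x = 1"] by simp
  ultimately show ?thesis using False q_ge_3 by simp
qed

lemma act_eq_iff_cross2:
  assumes "g \<in> G0" "v \<in> Lam" "w \<in> Lam"
  shows "act g v = w \<longleftrightarrow> cross2 w (g *v v) = 0"
proof -
  obtain c where c: "c \<noteq> 0" "g *v v = c *s act g v" using ex_act_scale[OF assms(1,2)] .
  have "cross2 w (act g v) = 0 \<longleftrightarrow> w = act g v"
    by (rule cross2_eq_0_iff[OF assms(3) act_in_Lam[OF assms(1,2)]])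
  then show ?thesis using c by (auto simp: cross2_scale)
qed

lemma eigenvalue_char_poly:
  fixes g :: "'a^2^2"
  assumes "g *v v = c *s v" "v \<noteq> 0"
  shows "c\<^sup>2 - (g$1$1 + g$2$2) * c + det g = 0"
proof -
  have "g *v (g *v v) = (g$1$1 + g$2$2) *s (g *v v) - det g *s v"
    by (simp add: entries_2 algebra_simps)
  then have "(c\<^sup>2 - (g$1$1 + g$2$2) * c + det g) *s v = 0"
    unfolding assms(1) by (simp add: vector_scalar_commute assms(1) vec2_eq_iff power2_eq_square algebra_simps)
  then show ?thesis using assms(2) by (simp only: vector_mul_eq_0 simp_thms)
qed

text \<open>On a fixed line the multiplier c satisfies c^2 - T c + 1 = 0, where T is the trace. So
  T^2 = 4 exactly if c is 1 or -1, that is, if z or -z lies in the root subgroup of the line; never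
  both, since v differs from -v in odd characteristic.\<close>

lemma Uk_plus_minus:
  assumes z: "z \<in> G0" "det z = 1"
  shows "Uk z + Uk (- z) = of_nat (if (z$1$1 + z$2$2)\<^sup>2 = 4 then card (fixed_lines z) else 0)"
proof -
  let ?T = "z$1$1 + z$2$2"
  have neg: "- z *v v = v \<longleftrightarrow> z *v v = - v" for v
  proof -
    have "- z *v v = - (z *v v)" by (simp add: vec2_eq_iff matrix_vector_mult_2)
    then show ?thesis by (metis minus_minus)
  qed
  have U: "z \<in> Uset v \<longleftrightarrow> z *v v = v" "- z \<in> Uset v \<longleftrightarrow> z *v v = - v" for v
    using z uminus_in_G0[OF z(1)] by (simp_all add: Uset_def neg)
  have sub: "{v \<in> Lam. z \<in> Uset v \<or> - z \<in> Uset v} = (if ?T\<^sup>2 = 4 then fixed_lines z else {})"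
  proof -
    have "(z *v v = v \<or> z *v v = - v) \<longleftrightarrow> (?T\<^sup>2 = 4 \<and> act z v = v)" if v: "v \<in> Lam" for v
    proof
      assume "z *v v = v \<or> z *v v = - v"
      then have "z *v v = 1 *s v \<or> z *v v = (- 1) *s v" by (simp add: vec2_eq_iff)
      then obtain c where c: "z *v v = c *s v" "c = 1 \<or> c = - 1" by blast
      have "c \<noteq> 0" using c(2) by auto
      have "?T\<^sup>2 = 4"
      proof -
        define t where "t = ?T"
        have t: "c\<^sup>2 - t * c + 1 = 0"
          using eigenvalue_char_poly[OF c(1) Lam_nonzero[OF v]] z(2) by (simp add: t_def)
        from c(2) have "t = 2 \<or> t = - 2"
        proof
          assume "c = 1"
          then have "2 - t = 1\<^sup>2 - t * 1 + 1" by simp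
          also have "\<dots> = 0" using t \<open>c = 1\<close> by simp
          finally show ?thesis by simp
        next
          assume "c = - 1"
          then have "t - (- 2) = (- 1)\<^sup>2 - t * (- 1) + 1" by simp
          also have "\<dots> = 0" using t \<open>c = - 1\<close> by simp
          finally show ?thesis by (simp only: right_minus_eq simp_thms)
        qed
        then have "?T = 2 \<or> ?T = - 2" by (simp only: t_def)
        then show ?thesis by (elim disjE) simp_all
      qed
      then show "?T\<^sup>2 = 4 \<and> act z v = v" using act_eqI[OF c(1) \<open>c \<noteq> 0\<close> v] by simp
    next
      assume a: "?T\<^sup>2 = 4 \<and> act z v = v"
      then obtain c where c: "z *v v = c *s v" using act_eigen[OF z(1) v] by blast
      have "?T = 2 \<or> ?T = - 2"
      proof -
        have "(?T - 2) * (?T + 2) = 0" using a by (simp add: power2_eq_square algebra_simps)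
        then show ?thesis by (auto simp: add_eq_0_iff2)
      qed
      moreover have "c\<^sup>2 - ?T * c + 1 = 0"
        using eigenvalue_char_poly[OF c Lam_nonzero[OF v]] z(2) by simp
      ultimately have "c\<^sup>2 - 2 * c + 1 = 0 \<or> c\<^sup>2 - (- 2) * c + 1 = 0" by metis
      moreover have "(c - 1)\<^sup>2 = c\<^sup>2 - 2 * c + 1" "(c + 1)\<^sup>2 = c\<^sup>2 - (- 2) * c + 1"
        by (simp_all add: power2_eq_square algebra_simps)
      ultimately have "(c - 1)\<^sup>2 = 0 \<or> (c + 1)\<^sup>2 = 0" by simp
      then have "c = 1 \<or> c = - 1" by (auto simp: add_eq_0_iff2)
      then show "z *v v = v \<or> z *v v = - v" using c by (auto simp: vec2_eq_iff)
    qed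
    then show ?thesis by (auto simp: U fixed_lines_def)
  qed
  have "v \<noteq> - v" if "v \<in> Lam" for v
  proof
    assume "v = - v"
    then have e: "v$i = - (v$i)" for i by (metis vector_uminus_component)
    have "2 * v$i = 0" for i
    proof -
      have "2 * v$i = v$i - - (v$i)" by simp
      then show ?thesis unfolding e[of i, symmetric] by simp
    qed
    then have "v$i = 0" for i using two_neq_zero by simp
    then show False using Lam_nonzero[OF that] by (simp add: vec_eq_iff)
  qed
  then have "{v \<in> Lam. z \<in> Uset v} \<inter> {v \<in> Lam. - z \<in> Uset v} = {}" by (auto simp: U)
  then have "card {v \<in> Lam. z \<in> Uset v} + card {v \<in> Lam. - z \<in> Uset v}
      = card ({v \<in> Lam. z \<in> Uset v} \<union> {v \<in> Lam. - z \<in> Uset v})"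
    by (simp add: card_Un_disjoint)
  also have "{v \<in> Lam. z \<in> Uset v} \<union> {v \<in> Lam. - z \<in> Uset v} = {v \<in> Lam. z \<in> Uset v \<or> - z \<in> Uset v}" by auto
  finally have "card {v \<in> Lam. z \<in> Uset v} + card {v \<in> Lam. - z \<in> Uset v}
      = (if ?T\<^sup>2 = 4 then card (fixed_lines z) else 0)" unfolding sub by simp
  from arg_cong[OF this, of "of_nat :: nat \<Rightarrow> complex"]
  show ?thesis unfolding Uk_def of_nat_add .
qed

lemma card_fixed_lines_le: "card (fixed_lines z) \<le> q + 1"
  using card_mono[of Lam "fixed_lines z"] by (simp add: fixed_lines_def card_Lam)

text \<open>As \<open>z$2$1\<close> is nonzero, the linear condition can be solved for b, and a = x
  c turns the quadric into the curve of \<open>card_twisted_conic\<close>. Its quadratic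
  \<open>(x - h)\<^sup>2 = k\<close> is also the condition that z fixes the line of
  \<open>vector [x, 1]\<close>, so the fixed lines are the points missing from the conic. The conic
  degenerates exactly if the trace squares to 4.\<close>

lemma trace_pair_count_companion:
  assumes z: "z \<in> G0" "det z = 1" "z$2$1 \<noteq> 0"
  shows "card (trace_pair z) + q * (if (z$1$1 + z$2$2)\<^sup>2 = 4 then card (fixed_lines z) else 0)
    + card (fixed_lines z) = q + 1"
proof -
  define \<gamma> where "\<gamma> = z$2$1"
  \<comment> \<open>Completing the square in the equation \<gamma> x^2 - (z11 - z22) x - z12 = 0 for
    fixed lines gives the centre h and the constant k; its discriminant 4 k \<gamma>^2 is the
    squared trace minus 4.\<close>
  define h where "h = (z$1$1 - z$2$2) / (2 * \<gamma>)"
  define k where "k = h\<^sup>2 + z$1$2 / \<gamma>"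
  have \<gamma>: "\<gamma> \<noteq> 0" "z$2$1 = \<gamma>" using z(3) by (simp_all add: \<gamma>_def)
  have zF: "z$i$j \<in> Fq" for i j using z by (auto simp: G0_def Fq_def)
  have hk: "h \<in> Fq" "k \<in> Fq"
    using zF by (simp_all add: h_def k_def \<gamma>_def power2_eq_square Fq_closed numeral_in_Fq)
  have h: "z$1$1 - z$2$2 = 2 * h * \<gamma>" using \<gamma> two_neq_zero by (simp add: h_def)
  have k: "z$1$2 = (k - h\<^sup>2) * \<gamma>" using \<gamma> by (simp add: k_def)
  have "bij_betw (\<lambda>(a, b, c). (a / c, c)) {(a, b, c). a \<in> Fm \<and> b \<in> Fm \<and> c \<in> Fm \<and> a\<^sup>2 + b * c = 1
    \<and> a * (z$1$1 - z$2$2) + b * z$2$1 + c * z$1$2 = 0} {(x, c). x \<in> Fq \<and> c \<in> Fm \<and> c\<^sup>2 * ((x - h)\<^sup>2 - k) = 1}"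
    (is "bij_betw _ ?T ?C")
  proof (rule bij_betwI[where g = "\<lambda>(x, c). (x * c, - (2 * h * x + (k - h\<^sup>2)) * c, c)"])
    have T: "c \<noteq> 0 \<and> b = - (2 * h * a + (k - h\<^sup>2) * c)" if "(a, b, c) \<in> ?T" for a b c
    proof
      show "c \<noteq> 0" using that Fm_square_ne_1[of a] by auto
      have "(2 * h * a + b + (k - h\<^sup>2) * c) * \<gamma> = 0"
        using that unfolding mem_Collect_eq prod.case h k \<gamma>(2) by (simp add: algebra_simps)
      then show "b = - (2 * h * a + (k - h\<^sup>2) * c)" using \<gamma>(1) by (simp add: add_eq_0_iff2) algebra
    qed
    show "(\<lambda>(a, b, c). (a / c, c)) \<in> ?T \<rightarrow> ?C"
    proof
      fix p assume p: "p \<in> ?T"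
      then obtain a b c where abc: "p = (a, b, c)" by (cases p) auto
      have c: "c \<noteq> 0" "b = - (2 * h * a + (k - h\<^sup>2) * c)" using T[OF p[unfolded abc]] by blast+
      have "c\<^sup>2 * ((a / c - h)\<^sup>2 - k) = (a - h * c)\<^sup>2 - k * c\<^sup>2"
        using c(1) by (simp add: power2_eq_square field_simps)
      also have "\<dots> = a\<^sup>2 + b * c" unfolding c(2) by (simp add: power2_eq_square algebra_simps)
      finally have "c\<^sup>2 * ((a / c - h)\<^sup>2 - k) = 1" using p abc by simp
      then show "(case p of (a, b, c) \<Rightarrow> (a / c, c)) \<in> ?C" using p abc by (simp add: Fm_closed)
    qed
    show "(\<lambda>(x, c). (x * c, - (2 * h * x + (k - h\<^sup>2)) * c, c)) \<in> ?C \<rightarrow> ?T"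
    proof
      fix p assume p: "p \<in> ?C"
      then obtain x c where xc: "p = (x, c)" by (cases p) auto
      let ?b = "- (2 * h * x + (k - h\<^sup>2)) * c"
      have "(x * c)\<^sup>2 + ?b * c = c\<^sup>2 * ((x - h)\<^sup>2 - k)" by (simp add: power2_eq_square algebra_simps)
      moreover have "x * c * (2 * h * \<gamma>) + ?b * \<gamma> + c * ((k - h\<^sup>2) * \<gamma>) = 0" by (simp add: algebra_simps)
      moreover have "x * c \<in> Fm" "?b \<in> Fm"
        using p hk xc by (simp_all add: Fm_closed Fq_closed power2_eq_square numeral_in_Fq)
      ultimately show "(case p of (x, c) \<Rightarrow> (x * c, - (2 * h * x + (k - h\<^sup>2)) * c, c)) \<in> ?T"
        using p xc unfolding h k \<gamma>(2) by simp
    qed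
    fix p assume p: "p \<in> ?T"
    then obtain a b c where abc: "p = (a, b, c)" by (cases p) auto
    have c: "c \<noteq> 0" "b = - (2 * h * a + (k - h\<^sup>2) * c)" using T[OF p[unfolded abc]] by blast+
    show "(case case p of (a, b, c) \<Rightarrow> (a / c, c) of (x, c) \<Rightarrow> (x * c, - (2 * h * x + (k - h\<^sup>2)) * c, c)) = p"
      using c(1) by (simp add: abc c(2) algebra_simps)
  next
    fix p assume p: "p \<in> ?C"
    then obtain x c where xc: "p = (x, c)" by (cases p) auto
    have "c \<noteq> 0" using p xc by auto
    then show "(case case p of (x, c) \<Rightarrow> (x * c, - (2 * h * x + (k - h\<^sup>2)) * c, c) of (a, b, c) \<Rightarrow> (a / c, c)) = p"
      by (simp add: xc)
  qed
  then have tp: "card (trace_pair z) = (if k = 0 then 0 else q + 1 - card {x \<in> Fq. (x - h)\<^sup>2 = k})"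
    unfolding card_trace_pair card_twisted_conic[OF hk, symmetric] by (rule bij_betw_same_card)
  have "bij_betw (\<lambda>x. vector [x, 1] :: 'a^2) {x \<in> Fq. (x - h)\<^sup>2 = k} (fixed_lines z)"
  proof (rule bij_betw_imageI)
    show "inj_on (\<lambda>x. vector [x, 1] :: 'a^2) {x \<in> Fq. (x - h)\<^sup>2 = k}"
      by (auto simp: inj_on_def vec2_eq_iff)
    have "act z (vector [1, 0]) \<noteq> vector [1, 0]"
      using act_eq_iff_cross2[OF z(1), of "vector [1, 0]" "vector [1, 0]"] \<gamma>
      by (simp add: Lam_def cross2_def matrix_vector_mult_2)
    moreover have "act z (vector [x, 1]) = vector [x, 1] \<longleftrightarrow> (x - h)\<^sup>2 = k" if x: "x \<in> Fq" for x
    proof -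
      have L: "vector [x, 1] \<in> Lam" using x by (simp add: Lam_def)
      have "cross2 (vector [x, 1]) (z *v vector [x, 1]) = x * (\<gamma> * x + z$2$2) - (z$1$1 * x + z$1$2)"
        by (simp add: cross2_def matrix_vector_mult_2 \<gamma>(2))
      also have "\<dots> = x * x * \<gamma> - x * (z$1$1 - z$2$2) - z$1$2" by (simp add: algebra_simps)
      also have "\<dots> = ((x - h)\<^sup>2 - k) * \<gamma>" unfolding h k by (simp add: power2_eq_square algebra_simps)
      finally show ?thesis using act_eq_iff_cross2[OF z(1) L L] \<gamma>(1) by simp
    qed
    ultimately show "(\<lambda>x. vector [x, 1]) ` {x \<in> Fq. (x - h)\<^sup>2 = k} = fixed_lines z"
      by (auto simp: fixed_lines_def Lam_def)
  qed
  then have fl: "card {x \<in> Fq. (x - h)\<^sup>2 = k} = card (fixed_lines z)" by (rule bij_betw_same_card)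
  have "(z$1$1 + z$2$2)\<^sup>2 - 4 = (z$1$1 - z$2$2)\<^sup>2 + 4 * (z$1$2 * \<gamma>)"
    using z(2) unfolding det_2 \<gamma>(2) by algebra
  also have "\<dots> = 4 * k * \<gamma>\<^sup>2" unfolding h k by (simp add: power2_eq_square algebra_simps)
  finally have "(z$1$1 + z$2$2)\<^sup>2 - 4 = 4 * k * \<gamma>\<^sup>2" .
  moreover have "(4::'a) \<noteq> 0" using two_neq_zero by (metis mult_2 mult_eq_0_iff numeral_Bit0)
  ultimately have T: "(z$1$1 + z$2$2)\<^sup>2 = 4 \<longleftrightarrow> k = 0" using \<gamma>(1) by auto
  show ?thesis
  proof (cases "k = 0")
    case True
    have "{x \<in> Fq. (x - h)\<^sup>2 = k} = {h}" using True hk by auto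
    then have "card (fixed_lines z) = 1" using fl by simp
    then show ?thesis using True T tp by simp
  next
    case False
    then show ?thesis using T tp fl card_fixed_lines_le[of z] by simp
  qed
qed

text \<open>A matrix that fixes the lines of the two unit vectors and of their sum is already
  scalar.\<close>

lemma ex_moved_line:
  assumes z: "z \<in> G0" and "\<nexists>x. z = mat x"
  shows "\<exists>v\<in>Lam. act z v \<noteq> v"
proof (rule ccontr)
  assume "\<not> ?thesis"
  then have *: "cross2 v (z *v v) = 0" if "v \<in> Lam" for v
    using that act_eq_iff_cross2[OF z that that] by blast
  have "vector [1, 0] \<in> Lam" "vector [0, 1] \<in> Lam" "vector [1, 1] \<in> Lam"
    using Fq_closed by (auto simp: Lam_def)
  from this[THEN *] have "z$2$1 = 0" "z$1$2 = 0" "z$1$1 = z$2$2"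
    by (auto simp: cross2_def matrix_vector_mult_2)
  then have "z = mat (z$1$1)" by (simp add: mat2_eq_iff)
  then show False using assms(2) by blast
qed

lemma ex_line_map:
  assumes "v \<in> Lam" "w \<in> Lam"
  shows "\<exists>h\<in>G0. act h v = w"
proof -
  have "card {h \<in> G0. det h = 1 \<and> act h v = w} \<noteq> 0"
    using card_line_maps[OF assms one_in_E] q_ge_3 by simp
  then have "{h \<in> G0. det h = 1 \<and> act h v = w} \<noteq> {}" by (metis card.empty)
  then show ?thesis by blast
qed

lemma card_fixed_lines_conj:
  assumes "h \<in> G0" "z \<in> G0"
  shows "card (fixed_lines (h ** z ** matrix_inv h)) = card (fixed_lines z)"
proof -
  have "Mk (\<lambda>_. 1) (h ** z ** matrix_inv h) = Mk (\<lambda>_. 1) (matrix_inv h ** (h ** z))"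
    using central_M assms by (simp add: central_fun_def mult_in_G0 matrix_inv_in_G0)
  then show ?thesis using assms by (simp add: Mk_def)
qed

text \<open>A non-scalar z moves some isotropic line. Conjugating that line to
  \<open>vector [1, 0]\<close> makes the lower left entry nonzero, and everything counted is
  invariant under conjugation. A scalar z of determinant 1 is 1 or -1, and the surplus there is q (q
  - 1) + q (q + 1) = 2 q^2.\<close>

lemma trace_pair_count:
  assumes z: "z \<in> G0" "det z = 1"
  shows "card (trace_pair z) + q * (if (z$1$1 + z$2$2)\<^sup>2 = 4 then card (fixed_lines z) else 0)
    + card (fixed_lines z) = q + 1 + 2 * q\<^sup>2 * of_bool (z = mat 1 \<or> z = - mat 1)"
proof (cases "\<exists>x. z = mat x")
  case True
  then obtain x where x: "z = mat x" by blast
  have "x\<^sup>2 = 1" using z(2) by (simp add: x det_2 power2_eq_square)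
  then have pm: "z = mat 1 \<or> z = - mat 1" by (auto simp: x power2_eq_1_iff mat2_eq_iff)
  have "(x + x)\<^sup>2 = 4" using \<open>x\<^sup>2 = 1\<close> by (simp add: power2_eq_square algebra_simps)
  then have "(z$1$1 + z$2$2)\<^sup>2 = 4" by (simp add: x)
  moreover have "fixed_lines z = Lam"
  proof -
    have "x \<noteq> 0" using \<open>x\<^sup>2 = 1\<close> by auto
    moreover have "z *v v = x *s v" for v by (simp add: x vec2_eq_iff matrix_vector_mult_2)
    ultimately show ?thesis using act_eqI by (auto simp: fixed_lines_def)
  qed
  moreover have "n * (n - 1) + n * (n + 1) + (n + 1) = n + 1 + 2 * n\<^sup>2 * 1" for n :: nat
    by (cases n) (simp_all add: power2_eq_square)
  moreover have "of_bool (z = mat 1 \<or> z = - mat 1) = (1::nat)" using pm by simp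
  ultimately show ?thesis
    by (simp only: card_trace_pair_scalar[OF x] card_Lam if_True refl)
next
  case False
  obtain v where v: "v \<in> Lam" "act z v \<noteq> v" using ex_moved_line[OF z(1) False] by blast
  let ?e = "vector [1, 0] :: 'a^2"
  have e: "?e \<in> Lam" by (simp add: Lam_def)
  obtain h where h: "h \<in> G0" "act h ?e = v" using ex_line_map[OF e v(1)] by blast
  let ?k = "matrix_inv h"
  have k: "?k \<in> G0" by (rule matrix_inv_in_G0[OF h(1)])
  define y where "y = ?k ** z ** matrix_inv ?k"
  have y_eq: "y = ?k ** z ** h" by (simp add: y_def matrix_inv_inv[OF h(1)])
  have y: "y \<in> G0" "det y = 1"
    using h k z det_nonzero[OF h(1)] by (simp_all add: y_eq mult_in_G0 det_mul det_inv)
  have "act y ?e = act ?k (act z v)"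
    using h e z k v by (simp add: y_eq act_mult matrix_mul_assoc[symmetric] mult_in_G0 act_in_Lam)
  also have "\<dots> \<noteq> ?e"
    using act_inv[OF h(1) act_in_Lam[OF z(1) v(1)] e] h(2) v(2) by auto
  finally have "y$2$1 \<noteq> 0"
    using act_eq_iff_cross2[OF y(1) e e] by (auto simp: cross2_def matrix_vector_mult_2)
  moreover have "y$1$1 + y$2$2 = z$1$1 + z$2$2"
  proof -
    have "(A ** B)$1$1 + (A ** B)$2$2 = (B ** A)$1$1 + (B ** A)$2$2" for A B :: "'a^2^2"
      by (simp add: matrix_mult_2 algebra_simps)
    then have "y$1$1 + y$2$2 = (h ** (?k ** z))$1$1 + (h ** (?k ** z))$2$2" unfolding y_eq .
    then show ?thesis using h(1) by simp
  qed
  moreover have "card (trace_pair y) = card (trace_pair z)" unfolding y_def by (rule trace_pair_conj[OF k])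
  moreover have "card (fixed_lines y) = card (fixed_lines z)"
    unfolding y_def by (rule card_fixed_lines_conj[OF k z(1)])
  moreover have "z \<noteq> mat 1" using False by blast
  moreover have "z \<noteq> - mat 1"
  proof
    assume "z = - mat 1"
    then have "z = mat (- 1)" by (simp add: mat2_eq_iff)
    then show False using False by blast
  qed
  ultimately show ?thesis using trace_pair_count_companion[OF y] by (auto split: if_splits)
qed

lemma kconv_DD:
  assumes z: "z \<in> G0"
  shows "kconv Dk Dk z = of_nat (q + 1) * Nk delta1 z - Mk delta1 z
    + 2 * of_nat q ^ 2 * (of_bool (z = mat 1) + of_bool (z = - mat 1)) - of_nat q * (Uk z + Uk (- z))"
proof (cases "det z = 1")
  case True
  have ne: "mat 1 \<noteq> (- mat 1 :: 'a^2^2)"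
    using minus_one_neq_one by (auto simp: mat2_eq_iff)
  from arg_cong[OF trace_pair_count[OF z True], of "of_nat :: nat \<Rightarrow> complex"]
  have "of_nat (card (trace_pair z)) + of_nat q * (Uk z + Uk (- z)) + of_nat (card (fixed_lines z))
      = of_nat (q + 1) + 2 * of_nat q ^ 2 * of_bool (z = mat 1 \<or> z = - mat 1)"
    unfolding Uk_plus_minus[OF z True] by simp
  moreover have "(of_bool (z = mat 1 \<or> z = - mat 1) :: complex) = of_bool (z = mat 1) + of_bool (z = - mat 1)"
    using ne by auto
  ultimately have "of_nat (card (trace_pair z)) = of_nat (q + 1)
      + 2 * of_nat q ^ 2 * (of_bool (z = mat 1) + of_bool (z = - mat 1))
      - of_nat (card (fixed_lines z)) - of_nat q * (Uk z + Uk (- z))"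
    by (simp only: eq_diff_eq)
  then show ?thesis using kconv_DD_card[OF z] True by (simp add: Mk_def[of _ z] Nk_def[of _ z])
next
  case False
  then have "z \<noteq> mat 1" "z \<noteq> - mat 1" by (auto simp: det_2)
  moreover have "Uk z = 0" "Uk (- z) = 0" using False by (simp_all add: Uk_def Uset_def)
  ultimately show ?thesis using kconv_DD_card[OF z] False by (simp add: Mk_def[of _ z] Nk_def[of _ z])
qed

section \<open>Splitting the even functions into joint eigenspaces\<close>

definition Wplus :: "('a^2^2 \<Rightarrow> complex) set" where
  "Wplus = {w. \<forall>x. w (- x) = w x}"

text \<open>Invariance under every central operator at once survives the passage to an eigenspace of
  any one of them, so that the splitting steps can be nested.\<close>

definition stable :: "('a^2^2 \<Rightarrow> complex) set \<Rightarrow> bool" where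
  "stable X \<longleftrightarrow> (\<forall>u\<in>X. \<forall>v\<in>X. \<forall>a b. (\<lambda>x. a * u x + b * v x) \<in> X)
     \<and> (\<forall>k. central_fun k \<longrightarrow> (\<forall>u\<in>X. kop k u \<in> X))"

definition eigenspace :: "('a^2^2 \<Rightarrow> complex) \<Rightarrow> complex \<Rightarrow> ('a^2^2 \<Rightarrow> complex) set" where
  "eigenspace k \<alpha> = {w. kop k w = (\<lambda>x. \<alpha> * w x)}"

lemma kop_scale: "kop k (\<lambda>x. a * u x) = (\<lambda>x. a * kop k u x)"
  using kop_linear[of k a u 0 u] by simp

lemma matrix_mult_uminus: "g ** - x = - (g ** x)" for g x :: "'a^2^2"
  by (simp add: mat2_eq_iff matrix_mult_2)

lemma stable_Wplus: "stable Wplus"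
  by (simp add: stable_def Wplus_def kop_def matrix_mult_uminus)

lemma stable_eigenspace:
  assumes "stable X" "central_fun k"
  shows "stable (X \<inter> eigenspace k \<alpha>)"
  unfolding stable_def
proof (intro conjI ballI allI impI)
  fix u v a b assume uv: "u \<in> X \<inter> eigenspace k \<alpha>" "v \<in> X \<inter> eigenspace k \<alpha>"
  then show "(\<lambda>x. a * u x + b * v x) \<in> X \<inter> eigenspace k \<alpha>"
    using assms(1) by (simp add: stable_def eigenspace_def kop_linear fun_eq_iff algebra_simps)
next
  fix l u assume l: "central_fun l" "u \<in> X \<inter> eigenspace k \<alpha>"
  have "kop k (kop l u) = (\<lambda>x. \<alpha> * kop l u x)"
    using l(2) by (simp add: kop_commute[OF assms(2)] eigenspace_def kop_scale)
  then show "kop l u \<in> X \<inter> eigenspace k \<alpha>"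
    using assms(1) l by (simp add: stable_def eigenspace_def)
qed

text \<open>Splits X along the roots of a polynomial relation for \<open>kop k\<close>, which leaves
  the claim to be shown on each eigenspace inside X.\<close>

lemma Kspace_step:
  assumes X: "stable X" and k: "central_fun k" and "distinct as"
    and zero: "\<And>w. w \<in> X \<Longrightarrow> foldr (\<lambda>\<alpha> u x. kop k u x - \<alpha> * u x) as w = (\<lambda>x. 0)"
    and sub: "\<And>\<alpha>. \<alpha> \<in> set as \<Longrightarrow> X \<inter> eigenspace k \<alpha> \<subseteq> Kspace (kop s)"
  shows "X \<subseteq> Kspace (kop s)"
proof
  fix w assume w: "w \<in> X"
  show "w \<in> Kspace (kop s)"
  proof (rule eigenvector_decomposition[where T = "kop k" and X = X and as = as])
    show "(\<lambda>x. a * u x + b * v x) \<in> X" if "u \<in> X" "v \<in> X" for a b u v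
      using X that by (simp add: stable_def)
    show "kop k u \<in> X" if "u \<in> X" for u using X k that by (simp add: stable_def)
    show "(\<lambda>x. a * u x + b * v x) \<in> Kspace (kop s)" if "u \<in> Kspace (kop s)" "v \<in> Kspace (kop s)" for a b u v
      using that by (rule Kspace_linear)
    have "kop s (\<lambda>x. 0) = (\<lambda>x. 0)" by (simp add: kop_def fun_eq_iff)
    then have "(kop s ^^ n) (\<lambda>x. 0) = (\<lambda>x. 0)" for n by (induction n) simp_all
    then show "(\<lambda>x. 0) \<in> Kspace (kop s)" by (simp add: Kspace_def)
    show "u \<in> Kspace (kop s)" if "\<alpha> \<in> set as" "u \<in> X" "kop k u = (\<lambda>x. \<alpha> * u x)" for \<alpha> u
      using sub[OF that(1)] that(2,3) by (auto simp: eigenspace_def)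
  qed (use assms w in \<open>simp_all add: kop_linear\<close>)
qed

lemma kop_Z_Z: "kop Zk (kop Zk w) = (\<lambda>x. of_nat (q + 1) * kop Zk w x)"
proof -
  have "kop (kconv Zk Zk) = kop (\<lambda>z. of_nat (q + 1) * Zk z)"
    by (rule kop_cong) (rule kconv_ZZ)
  then show ?thesis unfolding kop_kop[OF central_Z]
    using kop_kernel_linear[of "of_nat (q + 1)" Zk 0 Zk w] by (simp add: fun_eq_iff)
qed

lemma kop_M_N:
  assumes "quasi_idem n \<psi>"
  shows "kop (Mk \<psi>) (kop (Nk \<psi>) w) = (\<lambda>x. n * of_nat ((q + 1) * (q * (q - 1))) * kop (Nk \<psi>) w x)"
proof -
  have "kop (kconv (Mk \<psi>) (Nk \<psi>)) = kop (\<lambda>z. n * of_nat ((q + 1) * (q * (q - 1))) * Nk \<psi> z)"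
    by (rule kop_cong) (rule kconv_MN[OF _ assms])
  then show ?thesis unfolding kop_kop[OF central_M]
    using kop_kernel_linear[of "n * of_nat ((q + 1) * (q * (q - 1)))" "Nk \<psi>" 0 "Nk \<psi>" w] by (simp add: fun_eq_iff)
qed

lemma kop_M_M:
  assumes "quasi_idem n \<psi>"
  shows "kop (Mk \<psi>) (kop (Mk \<psi>) w) = (\<lambda>x. n * of_nat ((q + 1) * (q - 1)) * kop (Mk \<psi>) w x
    + n * of_nat ((q - 1) * ((q + 1) * (q - 1))) * kop (Nk \<psi>) w x)"
proof -
  have "kop (kconv (Mk \<psi>) (Mk \<psi>)) = kop (\<lambda>z. n * of_nat ((q + 1) * (q - 1)) * Mk \<psi> z
    + n * of_nat ((q - 1) * ((q + 1) * (q - 1))) * Nk \<psi> z)"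
    by (rule kop_cong) (rule kconv_MM[OF _ assms])
  then show ?thesis unfolding kop_kop[OF central_M]
    by (simp only: kop_kernel_linear fun_eq_iff simp_thms)
qed

lemma kop_U_N: "kop Uk (kop (Nk delta1) w) = (\<lambda>x. of_nat (q * (q + 1)) * kop (Nk delta1) w x)"
proof -
  have "kop (kconv Uk (Nk delta1)) = kop (\<lambda>z. of_nat (q * (q + 1)) * Nk delta1 z)"
    by (rule kop_cong) (rule kconv_UN)
  then show ?thesis unfolding kop_kop[OF central_U]
    using kop_kernel_linear[of "of_nat (q * (q + 1))" "Nk delta1" 0 "Nk delta1" w] by (simp add: fun_eq_iff)
qed

lemma kop_U_M: "kop Uk (kop (Mk delta1) w)
    = (\<lambda>x. of_nat (q + 1) * kop (Mk delta1) w x + of_nat ((q + 1) * (q - 1)) * kop (Nk delta1) w x)"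
proof -
  have "kop (kconv Uk (Mk delta1)) = kop (\<lambda>z. of_nat (q + 1) * Mk delta1 z + of_nat ((q + 1) * (q - 1)) * Nk delta1 z)"
    by (rule kop_cong) (rule kconv_UM)
  then show ?thesis unfolding kop_kop[OF central_U]
    by (simp only: kop_kernel_linear fun_eq_iff simp_thms)
qed

lemma kop_U_U: "kop Uk (kop Uk w)
    = (\<lambda>x. 2 * of_nat q * kop Uk w x - kop (Mk delta1) w x + of_nat (q + 1) * kop (Nk delta1) w x)"
proof -
  have "kop (kconv Uk Uk) = kop (\<lambda>z. 1 * (2 * of_nat q * Uk z + (- 1) * Mk delta1 z) + of_nat (q + 1) * Nk delta1 z)"
    by (rule kop_cong) (use kconv_UU in simp)
  then show ?thesis unfolding kop_kop[OF central_U]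
    by (simp only: kop_kernel_linear fun_eq_iff) simp
qed

lemma kop_uminus_kernel:
  assumes w: "w \<in> Wplus"
  shows "kop (\<lambda>g. k (- g)) w x = kop k w x"
proof -
  have "(- g) ** x = - (g ** x)" for g :: "'a^2^2" by (simp add: mat2_eq_iff matrix_mult_2)
  then have "w ((- g) ** x) = w (g ** x)" for g :: "'a^2^2" using w by (simp add: Wplus_def)
  then have "kop (\<lambda>g. k (- g)) w x = (\<Sum>g\<in>G0. k (- g) * w ((- g) ** x))" by (simp add: kop_def)
  also have "\<dots> = kop k w x"
    unfolding kop_def by (rule sum.reindex_bij_witness[where i = uminus and j = uminus]) (auto simp: uminus_in_G0)
  finally show ?thesis .
qed

text \<open>By \<open>kop_U_U\<close> the combination (q + 1) N - M in \<open>kconv_DD\<close> is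
  U^2 - 2q U. Even functions do not distinguish g from -g, so the unit masses at 1 and -1 give 4 q^2
  and the two \<open>Uk\<close> terms give another -2q U; the total is (2q - U)^2.\<close>

lemma kop_D_D:
  assumes w: "w \<in> Wplus"
  shows "kop Dk (kop Dk w)
    = (\<lambda>x. kop Uk (kop Uk w) x - 4 * of_nat q * kop Uk w x + 4 * of_nat q ^ 2 * w x)"
proof
  fix x
  have one: "kop (\<lambda>g. of_bool (g = mat 1)) w x = w x"
  proof -
    have "kop (\<lambda>g. of_bool (g = mat 1)) w x = (\<Sum>g\<in>{mat 1}. of_bool (g = mat 1) * w (g ** x))"
      unfolding kop_def by (rule sum.mono_neutral_right) (auto simp: one_in_G0)
    then show ?thesis by simp
  qed
  have minus: "kop (\<lambda>g. of_bool (g = - mat 1)) w x = w x"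
  proof -
    have "kop (\<lambda>g. of_bool (g = - mat 1)) w x = (\<Sum>g\<in>{- mat 1}. of_bool (g = - mat 1) * w (g ** x))"
      unfolding kop_def by (rule sum.mono_neutral_right) (auto simp: one_in_G0 uminus_in_G0)
    then show ?thesis using w by (simp add: Wplus_def flip: uminus_eq_mult)
  qed
  have U: "kop (\<lambda>g. Uk (- g)) w x = kop Uk w x" by (rule kop_uminus_kernel[OF w])
  have "kop (kconv Dk Dk) = kop (\<lambda>z. of_nat (q + 1) * Nk delta1 z + 1 * ((- 1) * Mk delta1 z
    + 1 * (2 * of_nat q ^ 2 * (1 * of_bool (z = mat 1) + 1 * of_bool (z = - mat 1))
    + (- of_nat q) * (1 * Uk z + 1 * Uk (- z)))))"
    by (rule kop_cong) (use kconv_DD in \<open>simp add: algebra_simps\<close>)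
  then have "kop Dk (kop Dk w) x = of_nat (q + 1) * kop (Nk delta1) w x + 1 * ((- 1) * kop (Mk delta1) w x
    + 1 * (2 * of_nat q ^ 2 * (1 * w x + 1 * w x) + (- of_nat q) * (1 * kop Uk w x + 1 * kop Uk w x)))"
    unfolding kop_kop[OF central_D] by (simp only: kop_kernel_linear one minus U)
  then show "kop Dk (kop Dk w) x
    = kop Uk (kop Uk w) x - 4 * of_nat q * kop Uk w x + 4 * of_nat q ^ 2 * w x"
    unfolding kop_U_U by (simp add: algebra_simps)
qed

text \<open>The symmetry of the kernel that \<open>kop_square_zero\<close> asks for; inversion
  divides the trace by the determinant.\<close>

lemma D_inv:
  assumes "g \<in> G0"
  shows "Dk (matrix_inv g) = Dk g"
proof -
  have "matrix_inv g = s" if "s ** g = mat 1" for s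
    by (metis that assms inv_right matrix_mul_assoc matrix_mul_lid matrix_mul_rid)
  have "mat2 (g$2$2 / det g) (- g$1$2 / det g) (- g$2$1 / det g) (g$1$1 / det g) ** g = mat 1"
    using det_nonzero[OF assms] by (simp add: mat2_eq_iff matrix_mult_2 diff_divide_distrib[symmetric]
        add_divide_distrib[symmetric] mult.commute) (simp add: det_2 mult.commute)
  from \<open>\<And>s. s ** g = mat 1 \<Longrightarrow> matrix_inv g = s\<close>[OF this]
  have "(matrix_inv g)$1$1 + (matrix_inv g)$2$2 = (g$1$1 + g$2$2) / det g"
    by (simp add: add_divide_distrib add.commute)
  then show ?thesis using det_nonzero[OF assms] det_inv[OF assms]
    by (auto simp: Dk_def divide_eq_minus_1_iff minus_equation_iff)
qed

lemma Kspace_step_of_nat: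
  assumes X: "stable X" and k: "central_fun k" and "distinct ns"
    and zero: "\<And>w. w \<in> X \<Longrightarrow> foldr (\<lambda>\<alpha> u x. kop k u x - \<alpha> * u x) (map of_nat ns) w = (\<lambda>x. 0)"
    and sub: "\<And>n. n \<in> set ns \<Longrightarrow> X \<inter> eigenspace k (of_nat n) \<subseteq> Kspace (kop s)"
  shows "X \<subseteq> Kspace (kop s)"
proof (rule Kspace_step[OF X k])
  show "distinct (map of_nat ns :: complex list)"
    using assms(3) by (simp add: distinct_map inj_on_def)
qed (use zero sub in auto)

text \<open>By \<open>kop_M_M\<close>, M times M - m (q^2 - 1) is a multiple of N, and by
  \<open>kop_M_N\<close> the image of N consists of eigenvectors of M for m q (q^2 - 1). This
  accounts for the three roots.\<close>

lemma Kspace_step_M: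
  assumes X: "stable X" and \<psi>: "quasi_idem (of_nat m) \<psi>" "0 < m"
    and sub: "\<And>j. j \<in> {0, m * ((q + 1) * (q - 1)), m * ((q + 1) * (q * (q - 1)))} \<Longrightarrow>
      X \<inter> eigenspace (Mk \<psi>) (of_nat j) \<subseteq> Kspace (kop s)"
  shows "X \<subseteq> Kspace (kop s)"
proof (rule Kspace_step_of_nat[OF X central_M])
  \<comment> \<open>\<open>foldr\<close> applies the last root first: 0 and the middle root produce
    the multiple of N that the first root annihilates.\<close>
  let ?ns = "[m * ((q + 1) * (q * (q - 1))), m * ((q + 1) * (q - 1)), 0]"
  have "distinct [m * (a * q), m * a, 0]" if "0 < a" for a
    using \<psi>(2) q_ge_3 that by simp
  from this[of "(q + 1) * (q - 1)"] show "distinct ?ns" using q_ge_3 by (simp only: mult_ac) simp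
  show "foldr (\<lambda>\<alpha> u x. kop (Mk \<psi>) u x - \<alpha> * u x) (map of_nat ?ns) w = (\<lambda>x. 0)" for w
  proof -
    have 1: "(\<lambda>x. kop (Mk \<psi>) (\<lambda>x. kop (Mk \<psi>) w x - of_nat 0 * w x) x
        - of_nat (m * ((q + 1) * (q - 1))) * (kop (Mk \<psi>) w x - of_nat 0 * w x))
      = (\<lambda>x. of_nat m * of_nat ((q - 1) * ((q + 1) * (q - 1))) * kop (Nk \<psi>) w x)"
      by (simp add: kop_M_M[OF \<psi>(1)])
    show ?thesis
      unfolding list.map foldr.simps o_apply id_apply 1 kop_scale kop_M_N[OF \<psi>(1)] by simp
  qed
  show "X \<inter> eigenspace (Mk \<psi>) (of_nat n) \<subseteq> Kspace (kop s)" if "n \<in> set ?ns" for n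
    by (rule sub) (use that in auto)
qed

text \<open>By \<open>kop_U_U\<close>, U^2 - 2q U is a combination of M and N. The root q + 1
  eliminates M by \<open>kop_U_M\<close>, and the root q (q + 1) annihilates what remains of
  N.\<close>

lemma Kspace_step_U:
  assumes X: "stable X"
    and sub: "\<And>j. j \<in> {0, 2 * q, q + 1, q * (q + 1)} \<Longrightarrow> X \<inter> eigenspace Uk (of_nat j) \<subseteq> Kspace (kop s)"
  shows "X \<subseteq> Kspace (kop s)"
proof (rule Kspace_step_of_nat[OF X central_U])
  let ?ns = "[q * (q + 1), q + 1, 2 * q, 0]"
  show "distinct ?ns" using q_ge_3 by auto
  show "foldr (\<lambda>\<alpha> u x. kop Uk u x - \<alpha> * u x) (map of_nat ?ns) w = (\<lambda>x. 0)" for w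
  proof -
    have 1: "(\<lambda>x. kop Uk (\<lambda>x. kop Uk w x - of_nat 0 * w x) x - of_nat (2 * q) * (kop Uk w x - of_nat 0 * w x))
      = (\<lambda>x. (- 1) * kop (Mk delta1) w x + of_nat (q + 1) * kop (Nk delta1) w x)"
      by (simp add: kop_U_U)
    have 2: "(\<lambda>x. kop Uk (\<lambda>x. (- 1) * kop (Mk delta1) w x + of_nat (q + 1) * kop (Nk delta1) w x) x
        - of_nat (q + 1) * ((- 1) * kop (Mk delta1) w x + of_nat (q + 1) * kop (Nk delta1) w x))
      = (\<lambda>x. (of_nat (q + 1) * (of_nat q * of_nat (q + 1) - of_nat (q - 1) - of_nat (q + 1))) * kop (Nk delta1) w x)"
      unfolding kop_linear kop_U_M kop_U_N of_nat_mult by (simp add: fun_eq_iff algebra_simps)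
    show ?thesis
      unfolding list.map foldr.simps o_apply id_apply 1 2 kop_scale kop_U_N by simp
  qed
  show "X \<inter> eigenspace Uk (of_nat n) \<subseteq> Kspace (kop s)" if "n \<in> set ?ns" for n
    by (rule sub) (use that in auto)
qed

lemma Kspace_step_Z:
  assumes X: "stable X"
    and sub: "\<And>j. j \<in> {0, q + 1} \<Longrightarrow> X \<inter> eigenspace Zk (of_nat j) \<subseteq> Kspace (kop s)"
  shows "X \<subseteq> Kspace (kop s)"
proof (rule Kspace_step_of_nat[OF X central_Z])
  show "distinct [q + 1, 0]" by simp
  show "foldr (\<lambda>\<alpha> u x. kop Zk u x - \<alpha> * u x) (map of_nat [q + 1, 0]) w = (\<lambda>x. 0)" for w
    by (simp add: kop_Z_Z)
  show "X \<inter> eigenspace Zk (of_nat n) \<subseteq> Kspace (kop s)" if "n \<in> set [q + 1, 0]" for n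
    by (rule sub) (use that in auto)
qed

text \<open>On \<open>Wplus\<close> the square of \<open>Dk\<close> is the square of \<open>2q - Uk\<close>; where the latter vanishes,
  so does \<open>Dk\<close> by self-adjointness.\<close>

lemma Kspace_step_D:
  assumes X: "stable X" "X \<subseteq> Wplus \<inter> eigenspace Uk u"
    and sub: "\<And>d. d \<in> {2 * of_nat q - u, u - 2 * of_nat q} \<Longrightarrow> X \<inter> eigenspace Dk d \<subseteq> Kspace (kop s)"
  shows "X \<subseteq> Kspace (kop s)"
proof -
  define e where "e = 2 * of_nat q - u"
  have DD: "kop Dk (kop Dk w) = (\<lambda>x. e ^ 2 * w x)" if "w \<in> X" for w
  proof -
    have "w \<in> Wplus" and U: "kop Uk w = (\<lambda>x. u * w x)" using X(2) that by (auto simp: eigenspace_def)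
    from kop_D_D[OF this(1)] show ?thesis
      unfolding U kop_scale by (simp add: e_def fun_eq_iff power2_eq_square algebra_simps)
  qed
  have sub': "X \<inter> eigenspace Dk d \<subseteq> Kspace (kop s)" if "d \<in> {e, - e}" for d
    by (rule sub) (use that in \<open>auto simp: e_def\<close>)
  show ?thesis
  proof (cases "e = 0")
    case True
    have "kop Dk w = (\<lambda>x. 0)" if "w \<in> X" for w
    proof (rule kop_square_zero)
      show "kop Dk (kop Dk w) = (\<lambda>x. 0)" using DD[OF that] True by simp
      show "Dk (matrix_inv g) = Dk g" if "g \<in> G0" for g by (rule D_inv[OF that])
      show "cnj (Dk g) = Dk g" for g by (simp add: Dk_def)
    qed
    then have "X \<subseteq> X \<inter> eigenspace Dk e" unfolding True by (auto simp: eigenspace_def)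
    also have "\<dots> \<subseteq> Kspace (kop s)" by (rule sub') simp
    finally show ?thesis .
  next
    case False
    show ?thesis
    proof (rule Kspace_step[OF X(1) central_D])
      show "distinct [e, - e]" using False by simp
      show "foldr (\<lambda>\<alpha> u x. kop Dk u x - \<alpha> * u x) [e, - e] w = (\<lambda>x. 0)" if "w \<in> X" for w
      proof -
        have "kop Dk (\<lambda>x. 1 * kop Dk w x + e * w x) = (\<lambda>x. e ^ 2 * w x + e * kop Dk w x)"
          unfolding kop_linear DD[OF that] by simp
        then show ?thesis by (simp add: fun_eq_iff power2_eq_square algebra_simps)
      qed
    qed (rule sub', simp)
  qed
qed

text \<open>All combinations of the listed eigenvalues are treated alike, whether or not a joint
  eigenvector exists. The eigenvalue of \<open>kop s\<close> is the sum of d - u, \<zeta> (u - (q +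
  1)), \<mu> / 2 and (\<epsilon> - \<sigma>) / 4. The second term is a product of two even numbers,
  8 divides \<mu>, and 16 divides \<epsilon> and \<sigma>, so only d - u counts modulo 4.\<close>

lemma Wplus_subset_Kspace:
  assumes s: "\<And>w x. w \<in> Wplus \<Longrightarrow> kop s w x = kop Dk w x + kop Zk (kop Uk w) x - of_nat (q + 1) * kop Zk w x
    - kop Uk w x + (kop (Mk delta1) w x + (kop (Mk (\<lambda>_. 1)) w x - kop (Mk sgnE) w x) / 2) / 2"
  shows "Wplus \<subseteq> Kspace (kop s)"
proof -
  obtain r where r: "q = 2 * r + 1" using odd_q by (rule oddE)
  \<comment> \<open>The source of divisibility by 8: q^2 - 1 = 4 r (r + 1).\<close>
  have "even (r * (r + 1))" by simp
  then obtain t where t: "r * (r + 1) = 2 * t" by (rule evenE)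
  have q1: "(q + 1) * (q - 1) = 8 * t" using t by (simp add: r algebra_simps)
  have q2: "(q + 1) * (q * (q - 1)) = 8 * (t * q)"
  proof -
    have "(q + 1) * (q * (q - 1)) = (q + 1) * (q - 1) * q" by (simp only: mult_ac)
    then show ?thesis unfolding q1 by simp
  qed
  have leaf: "w \<in> Kspace (kop s)"
    if w: "w \<in> Wplus" and U: "w \<in> eigenspace Uk (of_nat u)" "u \<in> {0, 2 * q, q + 1, q * (q + 1)}"
      and Z: "w \<in> eigenspace Zk (of_nat \<zeta>)" "\<zeta> \<in> {0, q + 1}"
      and M: "w \<in> eigenspace (Mk delta1) (of_nat \<mu>)" "\<mu> \<in> {0, 1 * ((q + 1) * (q - 1)), 1 * ((q + 1) * (q * (q - 1)))}"
      and M1: "w \<in> eigenspace (Mk (\<lambda>_. 1)) (of_nat \<epsilon>)"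
        "\<epsilon> \<in> {0, (q + 1) * ((q + 1) * (q - 1)), (q + 1) * ((q + 1) * (q * (q - 1)))}"
      and MS: "w \<in> eigenspace (Mk sgnE) (of_nat \<sigma>)"
        "\<sigma> \<in> {0, (q + 1) * ((q + 1) * (q - 1)), (q + 1) * ((q + 1) * (q * (q - 1)))}"
      and D: "w \<in> eigenspace Dk d" "d \<in> {2 * of_nat q - of_nat u, of_nat u - 2 * of_nat q}"
    for w u \<zeta> \<mu> \<epsilon> \<sigma> d
  proof -
    have "even u" using U(2) odd_q by auto
    then obtain u' where u': "u = 2 * u'" by (rule evenE)
    have "even \<zeta>" using Z(2) odd_q by auto
    then obtain z' where z': "\<zeta> = 2 * z'" by (rule evenE)
    have "8 dvd \<mu>" using M(2) unfolding q1 q2 by auto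
    then obtain m' where m': "\<mu> = 8 * m'" by (rule dvdE)
    have qr: "q + 1 = 2 * (r + 1)" by (simp add: r)
    have 16: "16 dvd x" if "x \<in> {0, (q + 1) * ((q + 1) * (q - 1)), (q + 1) * ((q + 1) * (q * (q - 1)))}" for x
    proof -
      have "x \<in> {0, 16 * ((r + 1) * t), 16 * ((r + 1) * (t * q))}"
        using that unfolding q1 q2 unfolding qr by auto
      then show ?thesis by auto
    qed
    obtain e' where e': "\<epsilon> = 16 * e'" using 16[OF M1(2)] by (elim dvdE)
    obtain s' where s': "\<sigma> = 16 * s'" using 16[OF MS(2)] by (elim dvdE)
    define \<theta> where "\<theta> = d + of_nat \<zeta> * of_nat u - of_nat (q + 1) * of_nat \<zeta> - of_nat u
      + (of_nat \<mu> + (of_nat \<epsilon> - of_nat \<sigma>) / 2) / 2"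
    have eig: "kop s w = (\<lambda>x. \<theta> * w x)"
    proof
      fix x
      have "kop Zk (kop Uk w) x = of_nat u * (of_nat \<zeta> * w x)"
        using U(1) Z(1) by (simp add: eigenspace_def kop_scale)
      then show "kop s w x = \<theta> * w x"
        using U(1) Z(1) M(1) M1(1) MS(1) D(1) unfolding s[OF w]
        by (simp add: eigenspace_def \<theta>_def algebra_simps add_divide_distrib diff_divide_distrib)
    qed
    \<comment> \<open>A quarter of the sum of all terms other than d - u.\<close>
    define b where "b = int z' * (int u' - int r - 1) + int m' + int e' - int s'"
    have \<theta>: "\<theta> = d - of_nat u + 4 * of_int b"
      by (simp add: \<theta>_def b_def u' z' m' e' s' r algebra_simps add_divide_distrib diff_divide_distrib)
    have "\<exists>n. \<theta> = of_int (4 * n + 2)"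
      using D(2)
    proof (elim insertE emptyE)
      assume "d = 2 * of_nat q - of_nat u"
      then have "\<theta> = of_int (4 * (int r - int u' + b) + 2)" by (simp add: \<theta> u' r)
      then show ?thesis by blast
    next
      assume "d = of_nat u - 2 * of_nat q"
      then have "\<theta> = of_int (4 * (- int r - 1 + b) + 2)" by (simp add: \<theta> u' r)
      then show ?thesis by blast
    qed
    then obtain n where "\<theta> = of_int (4 * n + 2)" ..
    then show ?thesis by (rule eigenvector_in_Kspace[OF eig kop_scale])
  qed
  have q1': "quasi_idem (of_nat 1) delta1" using quasi_idem_delta1 by simp
  have q2': "quasi_idem (of_nat (q + 1)) (\<lambda>_. 1)" by (rule quasi_idem_char) simp
  have q3': "quasi_idem (of_nat (q + 1)) sgnE" by (rule quasi_idem_char) (rule sgnE_mult)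
  have pos: "0 < (1::nat)" "0 < q + 1" by simp_all
  show ?thesis
  proof (rule Kspace_step_U[OF stable_Wplus])
    fix u assume u: "u \<in> {0, 2 * q, q + 1, q * (q + 1)}"
    let ?X1 = "Wplus \<inter> eigenspace Uk (of_nat u)"
    have st1: "stable ?X1" by (rule stable_eigenspace[OF stable_Wplus central_U])
    show "?X1 \<subseteq> Kspace (kop s)"
    proof (rule Kspace_step_Z[OF st1])
      fix \<zeta> assume \<zeta>: "\<zeta> \<in> {0, q + 1}"
      let ?X2 = "?X1 \<inter> eigenspace Zk (of_nat \<zeta>)"
      have st2: "stable ?X2" by (rule stable_eigenspace[OF st1 central_Z])
      show "?X2 \<subseteq> Kspace (kop s)"
      proof (rule Kspace_step_M[OF st2 q1' pos(1)])
        fix \<mu> assume \<mu>: "\<mu> \<in> {0, 1 * ((q + 1) * (q - 1)), 1 * ((q + 1) * (q * (q - 1)))}"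
        let ?X3 = "?X2 \<inter> eigenspace (Mk delta1) (of_nat \<mu>)"
        have st3: "stable ?X3" by (rule stable_eigenspace[OF st2 central_M])
        show "?X3 \<subseteq> Kspace (kop s)"
        proof (rule Kspace_step_M[OF st3 q2' pos(2)])
          fix \<epsilon> assume \<epsilon>: "\<epsilon> \<in> {0, (q + 1) * ((q + 1) * (q - 1)), (q + 1) * ((q + 1) * (q * (q - 1)))}"
          let ?X4 = "?X3 \<inter> eigenspace (Mk (\<lambda>_. 1)) (of_nat \<epsilon>)"
          have st4: "stable ?X4" by (rule stable_eigenspace[OF st3 central_M])
          show "?X4 \<subseteq> Kspace (kop s)"
          proof (rule Kspace_step_M[OF st4 q3' pos(2)])
            fix \<sigma> assume \<sigma>: "\<sigma> \<in> {0, (q + 1) * ((q + 1) * (q - 1)), (q + 1) * ((q + 1) * (q * (q - 1)))}"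
            let ?X5 = "?X4 \<inter> eigenspace (Mk sgnE) (of_nat \<sigma>)"
            have st5: "stable ?X5" by (rule stable_eigenspace[OF st4 central_M])
            show "?X5 \<subseteq> Kspace (kop s)"
            proof (rule Kspace_step_D[OF st5])
              show "?X5 \<subseteq> Wplus \<inter> eigenspace Uk (of_nat u)" by (intro subsetI) (elim IntE, intro IntI)
              fix d :: complex assume d: "d \<in> {2 * of_nat q - of_nat u, of_nat u - 2 * of_nat q}"
              show "?X5 \<inter> eigenspace Dk d \<subseteq> Kspace (kop s)"
                by (intro subsetI, elim IntE) (rule leaf[OF _ _ u _ \<zeta> _ \<mu> _ \<epsilon> _ \<sigma> _ d])
            qed
          qed
        qed
      qed
    qed
  qed
qed

end

section \<open>The connection set\<close>

text \<open>The first two candidates are the columns of the adjugate of c - g; if both vanish, g is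
  scalar. They are spelled out because \<open>ex_fixed_line\<close> has to recognise the ratio of
  their coordinates as an element of \<open>Fq\<close>.\<close>

lemma ex_eigenvector_2:
  fixes g :: "'b::field^2^2"
  assumes "c\<^sup>2 - (g$1$1 + g$2$2) * c + det g = 0"
  shows "\<exists>v. v \<noteq> 0 \<and> g *v v = c *s v \<and> (v = vector [g$1$2, c - g$1$1] \<or> v = vector [c - g$2$2, g$2$1] \<or> v = vector [1, 0])"
proof -
  have *: "g$2$1 * g$1$2 + g$2$2 * (c - g$1$1) = c * (c - g$1$1)" "g$1$1 * (c - g$2$2) + g$1$2 * g$2$1 = c * (c - g$2$2)"
    using assms unfolding det_2 by algebra+
  consider "g$1$2 \<noteq> 0 \<or> c \<noteq> g$1$1" | "c \<noteq> g$2$2 \<or> g$2$1 \<noteq> 0"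
    | "g$1$2 = 0" "g$2$1 = 0" "c = g$1$1" "c = g$2$2" by blast
  then show ?thesis
  proof cases
    case 1
    then have "vector [g$1$2, c - g$1$1] \<noteq> (0 :: 'b^2)" by (auto simp: vec2_eq_iff)
    moreover have "g *v vector [g$1$2, c - g$1$1] = c *s vector [g$1$2, c - g$1$1]"
      using * by (simp add: vec2_eq_iff matrix_vector_mult_2 algebra_simps)
    ultimately show ?thesis by blast
  next
    case 2
    then have "vector [c - g$2$2, g$2$1] \<noteq> (0 :: 'b^2)" by (auto simp: vec2_eq_iff)
    moreover have "g *v vector [c - g$2$2, g$2$1] = c *s vector [c - g$2$2, g$2$1]"
      using * by (simp add: vec2_eq_iff matrix_vector_mult_2 algebra_simps)
    ultimately show ?thesis by blast
  next
    case 3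
    then have "vector [1, 0] \<noteq> (0 :: 'b^2)" "g *v vector [1, 0] = c *s vector [1, 0]"
      by (simp_all add: vec2_eq_iff matrix_vector_mult_2)
    then show ?thesis by blast
  qed
qed

lemma similar_matrixI:
  fixes A B P :: "'b::field^'n^'n"
  assumes "det P \<noteq> 0" "A ** P = P ** B"
  shows "similar_matrix A B"
proof -
  have P: "invertible P" using assms(1) by (simp add: invertible_det_nz)
  then have "P ** matrix_inv P = mat 1"
    unfolding invertible_def matrix_inv_def by (metis (mono_tags, lifting) someI_ex)
  then have "A = P ** B ** matrix_inv P"
    using assms(2) by (metis matrix_mul_assoc matrix_mul_rid)
  then show ?thesis using P by (auto simp: similar_matrix_def)
qed

lemma similar_matrixE:
  fixes A B :: "'b::field^'n^'n"
  assumes "similar_matrix A B"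
  obtains P where "det P \<noteq> 0" "A ** P = P ** B"
proof -
  obtain P where P: "invertible P" "A = P ** B ** matrix_inv P"
    using assms by (auto simp: similar_matrix_def)
  then have "matrix_inv P ** P = mat 1"
    unfolding invertible_def matrix_inv_def by (metis (mono_tags, lifting) someI_ex)
  then have "A ** P = P ** B" using P(2) by (metis matrix_mul_assoc matrix_mul_rid)
  then show ?thesis using P(1) that by (simp add: invertible_det_nz)
qed

lemma similar_trace_det:
  fixes A B :: "'b::field^2^2"
  assumes "similar_matrix A B"
  shows "A$1$1 + A$2$2 = B$1$1 + B$2$2" "det A = det B"
proof -
  obtain P where P: "invertible P" "A = P ** B ** matrix_inv P"
    using assms by (auto simp: similar_matrix_def)
  then have inv: "matrix_inv P ** P = mat 1"
    unfolding invertible_def matrix_inv_def by (metis (mono_tags, lifting) someI_ex)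
  have "(A ** B)$1$1 + (A ** B)$2$2 = (B ** A)$1$1 + (B ** A)$2$2" for A B :: "'b^2^2"
    by (simp add: matrix_mult_2 algebra_simps)
  from this[of "P ** B" "matrix_inv P"] show "A$1$1 + A$2$2 = B$1$1 + B$2$2"
    unfolding P(2) matrix_mul_assoc inv by simp
  have "det (matrix_inv P) * det P = 1" using inv by (metis det_I det_mul)
  then show "det A = det B" unfolding P(2) det_mul by (metis mult.commute mult.left_commute mult_1_right)
qed

lemma columns_mult:
  fixes g :: "'b::field^2^2" and v w :: "'b^2"
  shows "det (mat2 (v$1) (w$1) (v$2) (w$2)) = cross2 v w"
    and "g ** mat2 (v$1) (w$1) (v$2) (w$2) = mat2 ((g *v v)$1) ((g *v w)$1) ((g *v v)$2) ((g *v w)$2)"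
  by (simp_all add: det_2 cross2_def mat2_eq_iff matrix_mult_2 matrix_vector_mult_2 mult.commute)

lemma cross2_zero_scale:
  fixes v w :: "'b::field^2"
  assumes "cross2 v w = 0" "v \<noteq> 0"
  shows "\<exists>c. w = c *s v"
proof -
  have e: "v$1 * w$2 = v$2 * w$1" using assms(1) by (simp add: cross2_def)
  show ?thesis
  proof (cases "v$1 = 0")
    case True
    then have "v$2 \<noteq> 0" using assms(2) by (simp add: vec2_eq_iff)
    then have "w = (w$2 / v$2) *s v" using True e by (simp add: vec2_eq_iff)
    then show ?thesis by blast
  next
    case False
    then have "w = (w$1 / v$1) *s v" using e by (simp add: vec2_eq_iff field_simps)
    then show ?thesis by blast
  qed
qed

lemma similar_diag_iff:
  fixes g :: "'b::field^2^2"
  assumes "z \<noteq> w"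
  shows "similar_matrix g (mat2 z 0 0 w) \<longleftrightarrow> g$1$1 + g$2$2 = z + w \<and> det g = z * w"
proof
  assume "similar_matrix g (mat2 z 0 0 w)"
  from similar_trace_det[OF this] show "g$1$1 + g$2$2 = z + w \<and> det g = z * w"
    by (simp add: det_2)
next
  assume *: "g$1$1 + g$2$2 = z + w \<and> det g = z * w"
  have "z\<^sup>2 - (g$1$1 + g$2$2) * z + det g = 0" "w\<^sup>2 - (g$1$1 + g$2$2) * w + det g = 0"
    using * by (simp_all add: power2_eq_square algebra_simps)
  from this[THEN ex_eigenvector_2] obtain v v'
    where v: "v \<noteq> 0" "g *v v = z *s v" "v' \<noteq> 0" "g *v v' = w *s v'" by metis
  have "cross2 v v' \<noteq> 0"
  proof
    assume "cross2 v v' = 0"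
    then obtain c where c: "v' = c *s v" using cross2_zero_scale v(1) by blast
    then have "w *s v' = c *s (z *s v)" using v(2,4) by (auto simp: vector_scalar_commute)
    then have "w *s v' = z *s v'" by (simp add: c vec2_eq_iff mult.left_commute)
    then have "(w - z) *s v' = 0" by (simp add: vec2_eq_iff algebra_simps)
    then show False using v(3) assms by (simp only: vector_mul_eq_0 right_minus_eq) simp
  qed
  then show "similar_matrix g (mat2 z 0 0 w)"
    using columns_mult(1)[of v v'] columns_mult(2)[of g v v'] v
    by (intro similar_matrixI[of "mat2 (v$1) (v'$1) (v$2) (v'$2)"])
      (simp_all add: mat2_eq_iff matrix_mult_2 mult.commute)
qed

text \<open>By Cayley-Hamilton n = g - x squares to zero, so n w and w form a Jordan basis for any w
  that n does not annihilate.\<close>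

lemma similar_jordan_iff:
  fixes g :: "'b::field^2^2"
  shows "similar_matrix g (mat2 x 1 0 x) \<longleftrightarrow> g$1$1 + g$2$2 = 2 * x \<and> det g = x\<^sup>2 \<and> g \<noteq> mat x"
proof
  assume *: "similar_matrix g (mat2 x 1 0 x)"
  obtain P where P: "det P \<noteq> 0" "g ** P = P ** mat2 x 1 0 x" using similar_matrixE[OF *] .
  have "g \<noteq> mat x"
  proof
    assume "g = mat x"
    then have "P$1$1 = 0" "P$2$1 = 0"
      using P(2) by (simp_all add: mat2_eq_iff matrix_mult_2 mult.commute)
    then show False using P(1) by (simp add: det_2)
  qed
  then show "g$1$1 + g$2$2 = 2 * x \<and> det g = x\<^sup>2 \<and> g \<noteq> mat x"
    using similar_trace_det[OF *] by (simp add: det_2 power2_eq_square)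
next
  assume *: "g$1$1 + g$2$2 = 2 * x \<and> det g = x\<^sup>2 \<and> g \<noteq> mat x"
  define n where "n w = g *v w - x *s w" for w
  have nn: "n (n w) = 0" for w
  proof -
    have "g *v (g *v w) = (g$1$1 + g$2$2) *s (g *v w) - det g *s w"
      by (simp add: vec2_eq_iff matrix_vector_mult_2 det_2 algebra_simps)
    then show ?thesis
      using * unfolding n_def matrix_vector_mult_diff_distrib vector_scalar_commute
      by (simp add: vec2_eq_iff power2_eq_square algebra_simps)
  qed
  obtain w where w: "n w \<noteq> 0"
  proof (rule ccontr)
    assume "\<not> thesis"
    then have "n (vector [1, 0]) = 0" "n (vector [0, 1]) = 0" using that by blast+
    then have "g = mat x" by (simp add: n_def vec2_eq_iff matrix_vector_mult_2 mat2_eq_iff)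
    then show False using * by blast
  qed
  have g: "g *v n w = x *s n w" "g *v w = n w + x *s w" using nn[of w] by (simp_all add: n_def)
  have "cross2 (n w) w \<noteq> 0"
  proof
    assume "cross2 (n w) w = 0"
    then obtain c where c: "w = c *s n w" using cross2_zero_scale w by blast
    have "n (c *s n w) = c *s n (n w)" by (simp add: n_def[of "c *s _"] n_def[of "n w"] vec2_eq_iff matrix_vector_mult_2 algebra_simps)
    then show False using w nn[of w] c by (metis vector_smult_rzero)
  qed
  then show "similar_matrix g (mat2 x 1 0 x)"
    using columns_mult(1)[of "n w" w] columns_mult(2)[of g "n w" w] g
    by (intro similar_matrixI[of "mat2 (n w$1) (w$1) (n w$2) (w$2)"])
      (simp_all add: mat2_eq_iff matrix_mult_2 mult.commute)
qed

context quad_field begin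

text \<open>The counterpart of \<open>connection_set\<close> inside \<open>G0\<close>. Similarity is
  insensitive to a change of basis, so conjugation to the given form carries one set to the
  other.\<close>

definition conn_set :: "('a^2^2) set" where
  "conn_set = {g \<in> G0. similar_matrix g (mat2 1 0 0 (-1)) \<or>
     (\<exists>x\<in>norm_one_group q. similar_matrix g (mat2 x 1 0 x)) \<or>
     (\<exists>z. z \<noteq> 0 \<and> z \<notin> norm_one_group q \<and> z ^ (q - 1) \<in> {1} \<union> norm_one_nonsquares q \<and>
        similar_matrix g (mat2 z 0 0 (z powi (- int q))))}"

text \<open>The condition on \<open>z ^ (q - 1)\<close>, expressed through the determinant z^(1 - q)
  of the diagonal matrix and thus independent of the choice of z.\<close>

definition good_det :: "'a \<Rightarrow> bool" where
  "good_det d \<longleftrightarrow> d = 1 \<or> sgnE d = - 1"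

lemma power_in_E: "z \<noteq> 0 \<Longrightarrow> z ^ (q - 1) \<in> E"
  using power_card_minus_one[of z] unfolding E_eq mem_Collect_eq power_mult[symmetric] card_factor(1) .

text \<open>The argument of \<open>good_det\<close> is the inverse of \<open>z ^ (q - 1)\<close>,
  and inversion preserves non-squares.\<close>

lemma good_det_iff:
  assumes "z \<noteq> 0"
  shows "z ^ (q - 1) \<in> {1} \<union> norm_one_nonsquares q \<longleftrightarrow> good_det (z * inverse (z ^ q))"
proof -
  define y where "y = z ^ (q - 1)"
  have y: "y \<in> E" "y \<noteq> 0" using power_in_E[OF assms] assms by (auto simp: y_def)
  have e: "z * inverse (z ^ q) = 1 / y" using assms by (simp add: y_def power_q field_simps)
  have "1 / y * y = 1" using y(2) by simp
  then have "sgnE (1 / y) * sgnE y = 1"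
    using sgnE_mult[OF E_divide[OF one_in_E y(1)] y(1)] sgnE_1 by simp
  then have "sgnE (1 / y) = - 1 \<longleftrightarrow> sgnE y = - 1" by (auto simp: sgnE_def split: if_splits)
  moreover have "sgnE y = - 1 \<longleftrightarrow> y \<in> norm_one_nonsquares q"
    using y(1) by (auto simp: sgnE_def norm_one_nonsquares_def)
  ultimately show ?thesis unfolding e good_det_def y_def[symmetric] using y(2) by auto
qed

text \<open>For z outside \<open>E\<close> the two diagonal entries differ, so every similarity type
  in question is determined by trace and determinant, apart from excluding scalars in the Jordan
  case.\<close>

lemma conn_set_iff:
  "g \<in> conn_set \<longleftrightarrow> g \<in> G0 \<and> ((g$1$1 + g$2$2 = 0 \<and> det g = - 1)
    \<or> (\<exists>x\<in>E. g$1$1 + g$2$2 = 2 * x \<and> det g = x\<^sup>2 \<and> g \<noteq> mat x)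
    \<or> (\<exists>z. z \<noteq> 0 \<and> z \<notin> E \<and> good_det (det g) \<and> g$1$1 + g$2$2 = z + inverse (z ^ q) \<and> det g = z * inverse (z ^ q)))"
proof -
  have 1: "similar_matrix g (mat2 1 0 0 (-1)) \<longleftrightarrow> g$1$1 + g$2$2 = 0 \<and> det g = - 1"
    using similar_diag_iff[of 1 "- 1" g] minus_one_neq_one by auto
  have 3: "(z \<noteq> 0 \<and> z \<notin> E \<and> z ^ (q - 1) \<in> {1} \<union> norm_one_nonsquares q \<and>
        similar_matrix g (mat2 z 0 0 (z powi (- int q)))) \<longleftrightarrow>
     (z \<noteq> 0 \<and> z \<notin> E \<and> good_det (det g) \<and> g$1$1 + g$2$2 = z + inverse (z ^ q) \<and> det g = z * inverse (z ^ q))" for z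
  proof (cases "z \<noteq> 0 \<and> z \<notin> E")
    case True
    have ne: "z \<noteq> inverse (z ^ q)"
    proof
      assume "z = inverse (z ^ q)"
      then have "z ^ q * z = z ^ q * inverse (z ^ q)" by simp
      then show False using True by (simp add: E_iff)
    qed
    have pw: "z powi (- int q) = inverse (z ^ q)" by (simp add: power_int_minus)
    show ?thesis unfolding pw similar_diag_iff[OF ne] using True good_det_iff[of z] by auto
  qed auto
  show ?thesis
    unfolding conn_set_def mem_Collect_eq unfolding 1 similar_jordan_iff 3 ..
qed

lemma uminus_in_conn_set:
  assumes "g \<in> conn_set"
  shows "- g \<in> conn_set"
proof -
  let ?T = "g$1$1 + g$2$2"
  have g: "- g \<in> G0" and tr: "(- g)$1$1 + (- g)$2$2 = - ?T"
    using assms uminus_in_G0 unfolding conn_set_iff by auto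
  from assms have "?T = 0 \<and> det g = - 1 \<or> (\<exists>x\<in>E. ?T = 2 * x \<and> det g = x\<^sup>2 \<and> g \<noteq> mat x)
    \<or> (\<exists>z. z \<noteq> 0 \<and> z \<notin> E \<and> good_det (det g) \<and> ?T = z + inverse (z ^ q) \<and> det g = z * inverse (z ^ q))"
    unfolding conn_set_iff by (rule conjunct2)
  then show ?thesis
  proof (elim disjE bexE exE)
    assume "?T = 0 \<and> det g = - 1"
    then show ?thesis unfolding conn_set_iff tr det_uminus by (intro conjI g disjI1) simp_all
  next
    fix x assume x: "x \<in> E" "?T = 2 * x \<and> det g = x\<^sup>2 \<and> g \<noteq> mat x"
    have "- g \<noteq> mat (- x)" using x(2) by (auto simp: mat2_eq_iff)
    then show ?thesis unfolding conn_set_iff tr det_uminus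
      by (intro conjI g disjI2 disjI1 bexI[of _ "- x"] E_minus) (use x in simp_all)
  next
    fix z assume z: "z \<noteq> 0 \<and> z \<notin> E \<and> good_det (det g) \<and> ?T = z + inverse (z ^ q) \<and> det g = z * inverse (z ^ q)"
    have "- z \<notin> E" using z E_minus[of "- z"] by auto
    moreover have "inverse ((- z) ^ q) = - inverse (z ^ q)" by (simp add: frobenius_minus)
    ultimately show ?thesis unfolding conn_set_iff tr det_uminus
      by (intro conjI g disjI2 exI[of _ "- z"]) (use z in auto)
  qed
qed

text \<open>If c obeys the same semilinear condition as the entries of g, then so do the coordinates
  of an adjugate column of c - g. Their ratio lies in \<open>Fq\<close>, which makes the eigenline
  isotropic.\<close>

lemma ex_fixed_line:
  assumes g: "g \<in> G0" and c: "c ^ q * det g = c" "c\<^sup>2 - (g$1$1 + g$2$2) * c + det g = 0"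
  shows "\<exists>v\<in>Lam. g *v v = c *s v"
proof -
  obtain v where v: "v \<noteq> 0" "g *v v = c *s v"
    "v = vector [g$1$2, c - g$1$1] \<or> v = vector [c - g$2$2, g$2$1] \<or> v = vector [1, 0]"
    using ex_eigenvector_2[OF c(2)] by (elim exE conjE)
  have e: "x ^ q * det g = x" if "x \<in> {g$1$2, c - g$1$1, c - g$2$2, g$2$1}" for x
    using that g c(1) by (auto simp: G0_def frobenius_diff left_diff_distrib)
  have d: "det g \<noteq> 0" using g by (rule det_nonzero)
  have "x / y \<in> Fq" if "x ^ q * det g = x" "y ^ q * det g = y" for x y
  proof -
    have "(x / y) ^ q = (x ^ q * det g) / (y ^ q * det g)" using d by (simp add: power_divide)
    then show ?thesis unfolding that by (simp add: Fq_def)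
  qed
  then have "v$1 / v$2 \<in> Fq" using v(3) e by (auto simp: Fq_closed)
  then have L: "nrm v \<in> Lam" by (simp add: nrm_in_Lam_iff)
  obtain k where k: "k \<noteq> 0" "v = k *s nrm v" using ex_scale_nrm[OF v(1)] .
  have "k *s (g *v nrm v) = k *s (c *s nrm v)"
    using v(2) k(2) by (metis vector_scalar_commute vector_smult_assoc mult.commute)
  then have "g *v nrm v = c *s nrm v" using k(1) by (simp add: vec2_eq_iff)
  then show ?thesis using L by blast
qed

text \<open>The multiplier is semilinear by \<open>scale_semilinear\<close>, so the other
  eigenvalue, det g / c, equals c^(-q). This is the source of the entries z and z^(-q) in the
  connection set.\<close>

lemma fixed_lineE:
  assumes g: "g \<in> G0" "v \<in> fixed_lines g"
  obtains c where "c \<noteq> 0" "g *v v = c *s v" "c ^ q * det g = c" "g$1$1 + g$2$2 = c + inverse (c ^ q)"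
    "det g = c * inverse (c ^ q)"
proof -
  have v: "v \<in> Lam" "act g v = v" using g by (auto simp: fixed_lines_def)
  obtain c where c: "c \<noteq> 0" "g *v v = c *s v" using act_eigen[OF g(1) v] .
  have s: "c ^ q * det g = c" by (rule scale_semilinear[OF g(1) v(1) v(1) c(2)])
  then have d: "det g = c * inverse (c ^ q)" using c(1) by (simp add: field_simps)
  have "c * ((c + inverse (c ^ q)) - (g$1$1 + g$2$2)) = 0"
    using eigenvalue_char_poly[OF c(2) Lam_nonzero[OF v(1)]] unfolding d
    by (simp add: power2_eq_square algebra_simps)
  then have "(c + inverse (c ^ q)) - (g$1$1 + g$2$2) = 0" using c(1) unfolding mult_eq_0_iff by blast
  then have "g$1$1 + g$2$2 = c + inverse (c ^ q)" by simp
  from that[OF c s this d] show ?thesis .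
qed

lemma same_eigenvalue_scalar:
  assumes "v \<in> Lam" "v' \<in> Lam" "v \<noteq> v'" "g *v v = c *s v" "g *v v' = c *s v'"
  shows "g = mat c"
proof (rule matrix_eq_on_basis[of v v'])
  show "cross2 v v' \<noteq> 0" unfolding cross2_eq_0_iff[OF assms(1,2)] by (rule assms(3))
  have m: "mat c *v x = c *s x" for x :: "'a^2" by (simp add: vec2_eq_iff matrix_vector_mult_2)
  show "g *v v = mat c *v v" "g *v v' = mat c *v v'" unfolding m by (rule assms)+
qed

lemma conn_set_jordanI:
  assumes "g \<in> G0" "x \<in> E" "g$1$1 + g$2$2 = 2 * x" "det g = x\<^sup>2" "g \<noteq> mat x"
  shows "g \<in> conn_set"
  unfolding conn_set_iff by (intro conjI disjI2 disjI1 bexI[of _ x]) (rule assms)+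

lemma conn_set_splitI:
  assumes "g \<in> G0" "z \<noteq> 0" "z \<notin> E" "good_det (det g)" "g$1$1 + g$2$2 = z + inverse (z ^ q)"
    "det g = z * inverse (z ^ q)"
  shows "g \<in> conn_set"
  unfolding conn_set_iff by (intro conjI disjI2 exI[of _ z]) (rule assms)+

lemma conn_setE:
  assumes "g \<in> conn_set"
  obtains (involution) "g$1$1 + g$2$2 = 0" "det g = - 1"
    | (jordan) x where "x \<in> E" "g$1$1 + g$2$2 = 2 * x" "det g = x\<^sup>2" "g \<noteq> mat x"
    | (split) z where "z \<noteq> 0" "z \<notin> E" "good_det (det g)" "g$1$1 + g$2$2 = z + inverse (z ^ q)"
        "det g = z * inverse (z ^ q)"
proof -
  let ?T = "g$1$1 + g$2$2"
  from assms have "?T = 0 \<and> det g = - 1 \<or> (\<exists>x\<in>E. ?T = 2 * x \<and> det g = x\<^sup>2 \<and> g \<noteq> mat x)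
    \<or> (\<exists>z. z \<noteq> 0 \<and> z \<notin> E \<and> good_det (det g) \<and> ?T = z + inverse (z ^ q) \<and> det g = z * inverse (z ^ q))"
    unfolding conn_set_iff by (rule conjunct2)
  then show ?thesis
  proof (elim disjE bexE exE conjE)
    show "?T = 0 \<Longrightarrow> det g = - 1 \<Longrightarrow> thesis" by (rule that(1))
    show "x \<in> E \<Longrightarrow> ?T = 2 * x \<Longrightarrow> det g = x\<^sup>2 \<Longrightarrow> g \<noteq> mat x \<Longrightarrow> thesis" for x by (rule that(2))
    show "z \<noteq> 0 \<Longrightarrow> z \<notin> E \<Longrightarrow> good_det (det g) \<Longrightarrow> ?T = z + inverse (z ^ q) \<Longrightarrow> det g = z * inverse (z ^ q) \<Longrightarrow> thesis"
      for z by (rule that(3))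
  qed
qed

text \<open>The lines v for which g is a scalar of \<open>G0\<close> times an element of
  \<open>Uset v\<close>.\<close>

definition E_lines :: "'a^2^2 \<Rightarrow> ('a^2) set" where
  "E_lines g = {v \<in> Lam. \<exists>y\<in>E. g *v v = y *s v \<and> det g = y\<^sup>2}"

lemma mat_mult_vec: "mat y *v v = y *s v" for v :: "'a^2"
  by (simp add: vec2_eq_iff matrix_vector_mult_2)

text \<open>At most one scalar normalises the multiplier on a given line to 1, so no line is counted
  twice.\<close>

lemma kconv_ZU:
  assumes g: "g \<in> G0"
  shows "kconv Zk Uk g = of_nat (card (E_lines g))"
proof -
  have count: "card {h \<in> G0. (\<exists>x. h = mat x) \<and> matrix_inv h ** g \<in> Uset v} = of_bool (v \<in> E_lines g)"
    if v: "v \<in> Lam" for v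
  proof -
    have eq: "{h \<in> G0. (\<exists>x. h = mat x) \<and> matrix_inv h ** g \<in> Uset v}
        = mat ` {y \<in> E. g *v v = y *s v \<and> det g = y\<^sup>2}"
    proof -
      have "matrix_inv (mat y) ** g \<in> Uset v \<longleftrightarrow> g *v v = y *s v \<and> det g = y\<^sup>2" if y: "y \<in> E" for y
      proof -
        have m: "mat y \<in> G0" using y by (simp add: mat_in_G0_iff)
        have "(matrix_inv (mat y) ** g) *v v = v \<longleftrightarrow> g *v v = mat y *v v"
        proof
          assume "(matrix_inv (mat y) ** g) *v v = v"
          then have "mat y *v v = mat y *v ((matrix_inv (mat y) ** g) *v v)" by simp
          then show "g *v v = mat y *v v" using m by (simp add: matrix_vector_mul_assoc)
        next
          assume "g *v v = mat y *v v"
          then have "(matrix_inv (mat y) ** g) *v v = matrix_inv (mat y) *v (mat y *v v)"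
            by (simp flip: matrix_vector_mul_assoc)
          then show "(matrix_inv (mat y) ** g) *v v = v" using m by (simp add: matrix_vector_mul_assoc inv_left)
        qed
        moreover have "det (mat y :: 'a^2^2) = y\<^sup>2" by (simp add: det_2 power2_eq_square)
        ultimately show ?thesis
          using m g det_nonzero[OF m]
          by (auto simp: Uset_def mult_in_G0 matrix_inv_in_G0 det_inv_mult mat_mult_vec)
      qed
      then show ?thesis using mat_in_G0_iff by auto
    qed
    have "inj_on (mat :: 'a \<Rightarrow> 'a^2^2) {y \<in> E. g *v v = y *s v \<and> det g = y\<^sup>2}"
      by (auto simp: inj_on_def mat2_eq_iff)
    then have c: "card {h \<in> G0. (\<exists>x. h = mat x) \<and> matrix_inv h ** g \<in> Uset v}
        = card {y \<in> E. g *v v = y *s v \<and> det g = y\<^sup>2}"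
      unfolding eq by (rule card_image)
    show ?thesis
    proof (cases "v \<in> E_lines g")
      case True
      then obtain y where y: "y \<in> E" "g *v v = y *s v" "det g = y\<^sup>2" by (auto simp: E_lines_def)
      have "y' = y" if "g *v v = y' *s v" for y'
        using that y(2) Lam_nonzero[OF v] by (metis vector_mul_rcancel)
      then have "{y \<in> E. g *v v = y *s v \<and> det g = y\<^sup>2} = {y}" using y by auto
      then show ?thesis using c True by simp
    next
      case False
      then have "{y \<in> E. g *v v = y *s v \<and> det g = y\<^sup>2} = {}" using v by (auto simp: E_lines_def)
      then show ?thesis using c False by simp
    qed
  qed
  have "kconv Zk Uk g = (\<Sum>h\<in>G0. \<Sum>v\<in>Lam. of_bool ((\<exists>x. h = mat x) \<and> matrix_inv h ** g \<in> Uset v))"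
    unfolding kconv_def Zk_def Uk_def
    by (simp only: of_nat_card_filter[OF finite] sum_distrib_left of_bool_conj)
  also have "\<dots> = (\<Sum>v\<in>Lam. \<Sum>h\<in>G0. of_bool ((\<exists>x. h = mat x) \<and> matrix_inv h ** g \<in> Uset v))"
    by (rule sum.swap)
  also have "\<dots> = (\<Sum>v\<in>Lam. of_bool (v \<in> E_lines g))"
    using count by (intro sum.cong refl) (simp only: of_nat_card_filter[OF finite, symmetric] of_nat_of_bool)
  also have "\<dots> = of_nat (card {v \<in> Lam. v \<in> E_lines g})" by (simp only: of_nat_card_filter[OF finite])
  also have "{v \<in> Lam. v \<in> E_lines g} = E_lines g" by (auto simp: E_lines_def)
  finally show ?thesis .
qed

lemma E_lines_subset: "E_lines g \<subseteq> fixed_lines g"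
  using act_eqI E_nonzero by (auto simp: E_lines_def fixed_lines_def)

lemma inverse_power_E: "c \<in> E \<Longrightarrow> inverse (c ^ q) = c"
  using E_iff[of c] inverse_unique[of "c ^ q" c] by simp

text \<open>The only eigenvalue is c, and eigenvectors on two different lines would make g
  scalar.\<close>

lemma fixed_lines_jordan:
  assumes g: "g \<in> G0" and ns: "\<nexists>x. g = mat x" and c: "c \<in> E" "g$1$1 + g$2$2 = 2 * c" "det g = c\<^sup>2"
  shows "card (fixed_lines g) = 1" "E_lines g = fixed_lines g"
proof -
  have "c ^ q * det g = c" using c(1) by (simp add: c(3) power2_eq_square E_iff flip: mult.assoc)
  moreover have "c\<^sup>2 - (g$1$1 + g$2$2) * c + det g = 0" by (simp add: c power2_eq_square)
  ultimately obtain v where v: "v \<in> Lam" "g *v v = c *s v" using ex_fixed_line[OF g] by blast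
  have sub: "u \<in> E_lines g \<and> u = v" if u: "u \<in> fixed_lines g" for u
  proof -
    obtain k where k: "g *v u = k *s u" using fixed_lineE[OF g u] by metis
    have uL: "u \<in> Lam" using u by (simp add: fixed_lines_def)
    have "k\<^sup>2 - (2 * c) * k + c\<^sup>2 = 0" using eigenvalue_char_poly[OF k Lam_nonzero[OF uL]] c by simp
    then have "(k - c)\<^sup>2 = 0" by (simp add: power2_eq_square algebra_simps)
    then have "k = c" by simp
    then have kc: "g *v u = c *s u" using k by simp
    then have "u = v" using same_eigenvalue_scalar[OF uL v(1) _ kc v(2)] ns by blast
    then show ?thesis using kc uL c by (auto simp: E_lines_def)
  qed
  then show "E_lines g = fixed_lines g" using E_lines_subset by blast
  have "v \<in> fixed_lines g" using act_eqI[OF v(2) E_nonzero[OF c(1)] v(1)] v(1) by (simp add: fixed_lines_def)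
  then have "fixed_lines g = {v}" using sub by blast
  then show "card (fixed_lines g) = 1" by simp
qed

text \<open>For c outside \<open>E\<close> the eigenvalues c and c^(-q) are distinct, and both
  satisfy the semilinear condition of \<open>ex_fixed_line\<close>.\<close>

lemma fixed_lines_split:
  assumes g: "g \<in> G0" and c: "c \<noteq> 0" "c \<notin> E" "g$1$1 + g$2$2 = c + inverse (c ^ q)" "det g = c * inverse (c ^ q)"
  shows "card (fixed_lines g) = 2" "E_lines g = {}" "det g = 1 \<Longrightarrow> (g$1$1 + g$2$2)\<^sup>2 \<noteq> 4"
proof -
  define w where "w = inverse (c ^ q)"
  have T: "g$1$1 + g$2$2 = c + w" "det g = c * w" using c by (simp_all add: w_def)
  have w0: "w \<noteq> 0" using c(1) by (simp add: w_def)
  have cw: "c \<noteq> w"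
  proof
    assume "c = w"
    then have "c ^ q * c = c ^ q * inverse (c ^ q)" by (simp add: w_def)
    then show False using c by (simp add: E_iff)
  qed
  have s: "c ^ q * det g = c" "w ^ q * det g = w"
    using c(1) by (simp_all add: T w_def power_inverse frobenius_twice)
  have p: "c\<^sup>2 - (g$1$1 + g$2$2) * c + det g = 0" "w\<^sup>2 - (g$1$1 + g$2$2) * w + det g = 0"
    unfolding T by (simp_all add: power2_eq_square algebra_simps)
  obtain v where v: "v \<in> Lam" "g *v v = c *s v" using ex_fixed_line[OF g s(1) p(1)] by blast
  obtain v' where v': "v' \<in> Lam" "g *v v' = w *s v'" using ex_fixed_line[OF g s(2) p(2)] by blast
  have uniq: "k = l" if "u \<in> Lam" "g *v u = k *s u" "g *v u = l *s u" for u k l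
    using that Lam_nonzero[OF that(1)] by (metis vector_mul_rcancel)
  have ne: "v \<noteq> v'" using uniq[OF v] v'(2) cw by blast
  have ns: "\<nexists>x. g = mat x"
  proof
    assume "\<exists>x. g = mat x"
    then obtain x where "g = mat x" ..
    then show False using uniq[OF v(1,2), of x] uniq[OF v'(1,2), of x] cw by (simp add: mat_mult_vec)
  qed
  have ev: "k = c \<or> k = w" if "u \<in> Lam" "g *v u = k *s u" for u k
  proof -
    have "(k - c) * (k - w) = 0"
      using eigenvalue_char_poly[OF that(2) Lam_nonzero[OF that(1)]] unfolding T
      by (simp add: power2_eq_square algebra_simps)
    then show ?thesis by auto
  qed
  have "u = v \<or> u = v'" if u: "u \<in> fixed_lines g" for u
  proof -
    obtain k where k: "g *v u = k *s u" using fixed_lineE[OF g u] by metis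
    have uL: "u \<in> Lam" using u by (simp add: fixed_lines_def)
    from ev[OF uL k] show ?thesis
    proof
      assume "k = c"
      then show ?thesis using same_eigenvalue_scalar[OF uL v(1) _ _ v(2)] k ns by blast
    next
      assume "k = w"
      then show ?thesis using same_eigenvalue_scalar[OF uL v'(1) _ _ v'(2)] k ns by blast
    qed
  qed
  moreover have "v \<in> fixed_lines g" "v' \<in> fixed_lines g"
    using act_eqI[OF v(2) c(1) v(1)] act_eqI[OF v'(2) w0 v'(1)] v v' by (simp_all add: fixed_lines_def)
  ultimately have "fixed_lines g = {v, v'}" by blast
  then show "card (fixed_lines g) = 2" using ne by simp
  show "E_lines g = {}"
  proof -
    have False if "u \<in> Lam" "y \<in> E" "g *v u = y *s u" "det g = y\<^sup>2" for u y
    proof -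
      have "y \<noteq> 0" using that(2) by (rule E_nonzero)
      have "c * w = y * y" using that(4) T by (simp add: power2_eq_square)
      then have "c = w" using ev[OF that(1,3)] \<open>y \<noteq> 0\<close> by auto
      then show False using cw by simp
    qed
    then show ?thesis by (auto simp: E_lines_def)
  qed
  show "(g$1$1 + g$2$2)\<^sup>2 \<noteq> 4" if "det g = 1"
  proof
    assume 4: "(g$1$1 + g$2$2)\<^sup>2 = 4"
    have "(c - w)\<^sup>2 = (c + w)\<^sup>2 - 4 * (c * w)" by (simp add: power2_eq_square algebra_simps)
    then have "(c - w)\<^sup>2 = 0" using 4 that unfolding T by simp
    then show False using cw by simp
  qed
qed

section \<open>The adjacency operator as a combination of class sums\<close>

definition conn_kernel :: "'a^2^2 \<Rightarrow> complex" where
  "conn_kernel g = of_bool (g \<in> conn_set)"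

lemma Uk_sum:
  assumes "g \<in> G0"
  shows "Uk g + Uk (- g) = of_bool (det g = 1) * of_nat (if (g$1$1 + g$2$2)\<^sup>2 = 4 then card (fixed_lines g) else 0)"
proof (cases "det g = 1")
  case False
  then show ?thesis by (simp add: Uk_def Uset_def)
qed (use Uk_plus_minus[OF assms] in simp)

text \<open>The coefficients come from comparing values by number of isotropic eigenlines. With two,
  the M-terms give 1 if the determinant is 1 or a non-square and 0 otherwise, as
  \<open>good_det\<close> demands. With one, the M- and U-terms cancel and
  \<open>kconv Zk Uk\<close> gives 1. For scalars the two Z-terms cancel as well. With none, only
  \<open>Dk\<close> is left. The U-term is symmetrised because a fixed line of a Jordan element of
  determinant 1 may have multiplier 1 or -1.\<close>

lemma conn_kernel_eq:
  assumes g: "g \<in> G0"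
  shows "conn_kernel g = Dk g + kconv Zk Uk g - of_nat (q + 1) * Zk g - (Uk g + Uk (- g)) / 2
    + (Mk delta1 g + (Mk (\<lambda>_. 1) g - Mk sgnE g) / 2) / 2"
proof (cases "\<exists>x. g = mat x")
  case True
  then obtain x where x: "g = mat x" by blast
  have xE: "x \<in> E" using g x mat_in_G0_iff by blast
  have x0: "x \<noteq> 0" using xE by (rule E_nonzero)
  have T: "g$1$1 + g$2$2 = 2 * x" "det g = x\<^sup>2" by (simp_all add: x det_2 power2_eq_square)
  have not_in: "g \<notin> conn_set"
  proof
    assume "g \<in> conn_set"
    then show False
    proof (cases rule: conn_setE)
      case involution
      then show False using T(1) x0 two_neq_zero by simp
    next
      case (jordan y)
      then have "2 * x = 2 * y" using T(1) by simp
      then show False using jordan(4) x two_neq_zero by simp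
    next
      case (split z)
      then have z: "z \<notin> E" "2 * x = z + inverse (z ^ q)" "x\<^sup>2 = z * inverse (z ^ q)" using T by simp_all
      define w where "w = inverse (z ^ q)"
      have w: "w = 2 * x - z" using z(2) by (simp add: w_def)
      have "x\<^sup>2 = z * w" using z(3) by (simp add: w_def)
      then have "(z - x)\<^sup>2 = 0" unfolding w by (simp add: power2_eq_square algebra_simps)
      then show False using z(1) xE by simp
    qed
  qed
  have D: "Dk g = 0" using x0 two_neq_zero T by (simp add: Dk_def)
  have "E_lines g = Lam" using xE T by (auto simp: E_lines_def x mat_mult_vec)
  moreover from this have F: "fixed_lines g = Lam" using E_lines_subset[of g] by (auto simp: fixed_lines_def)
  moreover have "(2 * x)\<^sup>2 = 4" if "x\<^sup>2 = 1" using that by (simp add: power_mult_distrib)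
  ultimately show ?thesis
    using not_in D True xE unfolding conn_kernel_def kconv_ZU[OF g] Uk_sum[OF g] Mk_def Zk_def T
    by (simp add: card_Lam sgnE_square)
next
  case ns: False
  have Z: "Zk g = 0" using ns by (simp add: Zk_def)
  consider "fixed_lines g = {}"
    | c where "c \<in> E" "g$1$1 + g$2$2 = 2 * c" "det g = c\<^sup>2"
    | c where "c \<noteq> 0" "c \<notin> E" "g$1$1 + g$2$2 = c + inverse (c ^ q)" "det g = c * inverse (c ^ q)"
  proof (cases "fixed_lines g = {}")
    case False
    then obtain v where "v \<in> fixed_lines g" by blast
    from fixed_lineE[OF g this] obtain c where c: "c \<noteq> 0" "g$1$1 + g$2$2 = c + inverse (c ^ q)"
      "det g = c * inverse (c ^ q)" by metis
    show ?thesis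
    proof (cases "c \<in> E")
      case True
      then have "g$1$1 + g$2$2 = 2 * c" "det g = c\<^sup>2"
        using c by (simp_all add: inverse_power_E power2_eq_square)
      then show ?thesis using that(2) True by blast
    qed (use that(3) c in blast)
  qed (use that(1) in blast)
  then show ?thesis
  proof cases
    case 1
    have E: "E_lines g = {}" using E_lines_subset[of g] 1 by simp
    have "g \<in> conn_set \<longleftrightarrow> g$1$1 + g$2$2 = 0 \<and> det g = - 1"
    proof
      assume "g \<in> conn_set"
      then show "g$1$1 + g$2$2 = 0 \<and> det g = - 1"
      proof (cases rule: conn_setE)
        case (jordan x)
        then show ?thesis using fixed_lines_jordan(1)[OF g ns jordan(1-3)] 1 by simp
      next
        case (split z)
        then show ?thesis using fixed_lines_split(1)[OF g split(1,2,4,5)] 1 by simp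
      qed simp
    qed (use g in \<open>simp add: conn_set_iff\<close>)
    then show ?thesis
      unfolding conn_kernel_def kconv_ZU[OF g] Uk_sum[OF g] Mk_def Z E 1 Dk_def by simp
  next
    case c: 2
    have F: "card (fixed_lines g) = 1" "E_lines g = fixed_lines g" using fixed_lines_jordan[OF g ns c] .
    have "g \<noteq> mat c" using ns by blast
    with g c have "g \<in> conn_set" by (rule conn_set_jordanI)
    moreover have "2 * c \<noteq> 0" using E_nonzero[OF c(1)] two_neq_zero by simp
    moreover have "(2 * c)\<^sup>2 = 4" if "c\<^sup>2 = 1" using that by (simp add: power_mult_distrib)
    ultimately show ?thesis
      unfolding conn_kernel_def kconv_ZU[OF g] Uk_sum[OF g] Mk_def Z F Dk_def c(2,3)
      by (simp add: sgnE_square[OF c(1)])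
  next
    case c: 3
    note F = fixed_lines_split[OF g c]
    have no_inv: "\<not> (g$1$1 + g$2$2 = 0 \<and> det g = - 1)"
    proof
      assume a: "g$1$1 + g$2$2 = 0 \<and> det g = - 1"
      define w where "w = inverse (c ^ q)"
      have "c + w = 0" "c * w = - 1" using a c by (simp_all add: w_def)
      then have "w = - c" "c * w = - 1" by (simp_all add: add_eq_0_iff)
      then have "c\<^sup>2 = 1" by (simp add: power2_eq_square)
      then have "c = 1 \<or> c = - 1" by (simp add: power2_eq_1_iff)
      then show False using c(2) one_in_E minus_one_in_E by auto
    qed
    have in_iff: "g \<in> conn_set \<longleftrightarrow> good_det (det g)"
    proof
      assume "g \<in> conn_set"
      then show "good_det (det g)"
      proof (cases rule: conn_setE)
        case involution
        then show ?thesis using no_inv by blast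
      next
        case (jordan x)
        then show ?thesis using fixed_lines_jordan(1)[OF g ns jordan(1-3)] F(1) by simp
      qed
    next
      assume "good_det (det g)"
      then show "g \<in> conn_set" using conn_set_splitI[OF g c(1,2) _ c(3,4)] by blast
    qed
    have D: "Dk g = 0" using no_inv by (simp add: Dk_def)
    have U: "Uk g + Uk (- g) = 0" using Uk_sum[OF g] F(3) by auto
    have "sgnE 1 = 1" by (rule sgnE_1)
    then show ?thesis
      unfolding conn_kernel_def kconv_ZU[OF g] U Mk_def Z F D in_iff good_det_def
      by (auto simp: sgnE_def split: if_splits)
  qed
qed

lemma kop_conn:
  assumes w: "w \<in> Wplus"
  shows "kop conn_kernel w x = kop Dk w x + kop Zk (kop Uk w) x - of_nat (q + 1) * kop Zk w x
    - kop Uk w x + (kop (Mk delta1) w x + (kop (Mk (\<lambda>_. 1)) w x - kop (Mk sgnE) w x) / 2) / 2"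
proof -
  have "kop conn_kernel = kop (\<lambda>g. 1 * (1 * (1 * Dk g + 1 * kconv Zk Uk g) + (- of_nat (q + 1)) * Zk g)
      + 1 * ((- 1 / 2) * (1 * Uk g + 1 * Uk (- g))
        + (1 / 2) * (1 * Mk delta1 g + (1 / 2) * (1 * Mk (\<lambda>_. 1) g + (- 1) * Mk sgnE g))))"
    by (rule kop_cong) (simp add: conn_kernel_eq add_divide_distrib diff_divide_distrib algebra_simps)
  then show ?thesis
    unfolding kop_kop[OF central_Z]
    by (simp only: kop_kernel_linear kop_uminus_kernel[OF w]) (simp add: field_simps)
qed

section \<open>Evolution of a unit mass up to time pi / 2\<close>

lemma transition_sums:
  "(\<lambda>n. (- \<i> * complex_of_real (pi / 2)) ^ n * (kop conn_kernel ^^ n) (\<lambda>y. of_bool (y = a)) x / fact n)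
    sums (- of_bool (x = - a))"
proof -
  let ?c = "- \<i> * complex_of_real (pi / 2)"
  let ?A = "kop conn_kernel"
  define e where "e y = (of_bool (y = a) :: complex)" for y
  \<comment> \<open>p and m are the even and odd parts of the unit mass e, and -p + m is the negated
    reflection of e.\<close>
  define p where "p y = 1 / 2 * e y + 1 / 2 * e (- y)" for y
  define m where "m y = 1 / 2 * e y + (- 1 / 2) * e (- y)" for y
  have "p \<in> Kspace ?A"
    using Wplus_subset_Kspace[OF kop_conn] by (auto simp: Wplus_def p_def add.commute)
  then have P: "(\<lambda>n. ?c ^ n * (?A ^^ n) p x / fact n) sums (- p x)" by (simp add: Kspace_def)
  have refl_w: "?A (\<lambda>y. w (- y)) y = ?A w y" for w y
  proof -
    have ck: "conn_kernel (- g) = conn_kernel g" for g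
      using uminus_in_conn_set[of g] uminus_in_conn_set[of "- g"] by (auto simp: conn_kernel_def)
    have "- (g ** y) = (- g) ** y" for g :: "'a^2^2" by (simp add: mat2_eq_iff matrix_mult_2)
    then have "?A (\<lambda>y. w (- y)) y = (\<Sum>g\<in>G0. conn_kernel (- g) * w ((- g) ** y))"
      by (simp add: kop_def ck)
    also have "\<dots> = ?A w y"
      unfolding kop_def by (rule sum.reindex_bij_witness[where i = uminus and j = uminus]) (auto simp: uminus_in_G0)
    finally show ?thesis .
  qed
  \<comment> \<open>The kernel is even, so the operator gives the same result on e and on its
    reflection. On m only the term n = 0 of the exponential series survives.\<close>
  have Am: "?A m = (\<lambda>x. 0)"
    unfolding m_def kop_linear refl_w by simp
  have "?A (\<lambda>x. 0) = (\<lambda>x. 0)" by (simp add: kop_def fun_eq_iff)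
  then have "(?A ^^ n) (\<lambda>x. 0) = (\<lambda>x. 0)" for n by (induction n) simp_all
  then have "(?A ^^ Suc n) m = (\<lambda>x. 0)" for n unfolding funpow_Suc_right o_apply Am .
  then have "(?A ^^ n) m = (\<lambda>x. 0)" if "n \<noteq> 0" for n using that by (cases n) simp_all
  then have "(\<lambda>n. ?c ^ n * (?A ^^ n) m x / fact n) = (\<lambda>n. if n = 0 then m x else 0)"
    by (auto simp: fun_eq_iff)
  then have M: "(\<lambda>n. ?c ^ n * (?A ^^ n) m x / fact n) sums m x"
    using sums_single[of 0 "\<lambda>_. m x"] by simp
  have e: "e = (\<lambda>y. 1 * p y + 1 * m y)" by (simp add: p_def m_def fun_eq_iff)
  have "(?A ^^ n) e = (\<lambda>y. 1 * (?A ^^ n) p y + 1 * (?A ^^ n) m y)" for n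
    unfolding e kop_funpow_linear ..
  then have "(\<lambda>n. ?c ^ n * (?A ^^ n) e x / fact n)
      = (\<lambda>n. ?c ^ n * (?A ^^ n) p x / fact n + ?c ^ n * (?A ^^ n) m x / fact n)"
    by (simp add: fun_eq_iff distrib_left add_divide_distrib)
  then have "(\<lambda>n. ?c ^ n * (?A ^^ n) e x / fact n) sums (- p x + m x)"
    using sums_add[OF P M] by simp
  moreover have "- p x + m x = - of_bool (x = - a)"
  proof -
    have "- x = a \<longleftrightarrow> x = - a" by auto
    then show ?thesis by (simp add: p_def m_def e_def)
  qed
  moreover have "e = (\<lambda>y. of_bool (y = a))" by (simp add: fun_eq_iff e_def)
  ultimately show ?thesis by simp
qed

section \<open>The connection set generates the group\<close>

lemma Uset_subset_conn_set:
  assumes "v \<in> Lam" "u \<in> Uset v" "u \<noteq> mat 1"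
  shows "u \<in> conn_set"
proof -
  have u: "u \<in> G0" "det u = 1" "u *v v = 1 *s v" using assms(2) by (simp_all add: Uset_def)
  have "2 - (u$1$1 + u$2$2) = 1\<^sup>2 - (u$1$1 + u$2$2) * 1 + det u" unfolding u(2) by simp
  also have "\<dots> = 0" by (rule eigenvalue_char_poly[OF u(3) Lam_nonzero[OF assms(1)]])
  finally have "u$1$1 + u$2$2 = 2 * 1" unfolding right_minus_eq by simp
  then show ?thesis
    by (rule conn_set_jordanI[OF u(1) one_in_E]) (use u(2) assms(3) in simp_all)
qed

text \<open>If the multiplier c on the fixed line lay in \<open>E\<close>, the determinant would be
  c^2; a non-square determinant leaves only the split type.\<close>

lemma two_fixed_lines_conn_set:
  assumes "g \<in> G0" "v \<in> fixed_lines g" "sgnE (det g) = - 1"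
  shows "g \<in> conn_set"
proof -
  obtain c where c: "c \<noteq> 0" "g$1$1 + g$2$2 = c + inverse (c ^ q)" "det g = c * inverse (c ^ q)"
    using fixed_lineE[OF assms(1,2)] by metis
  have "c \<notin> E"
  proof
    assume "c \<in> E"
    then have "det g = c\<^sup>2" using c(3) by (simp add: inverse_power_E power2_eq_square)
    then show False using sgnE_square[OF \<open>c \<in> E\<close>] assms(3) by simp
  qed
  moreover have "good_det (det g)" using assms(3) by (simp add: good_det_def)
  ultimately show ?thesis by (intro conn_set_splitI[OF assms(1) c(1) _ _ c(2,3)])
qed

lemma Uset_inv: "u \<in> Uset v \<Longrightarrow> matrix_inv u \<in> Uset v"
  using matrix_vector_mul_assoc[of "matrix_inv u" u v]
  by (auto simp: Uset_def matrix_inv_in_G0 det_inv inv_left)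

text \<open>Left factors from root subgroups reduce an element to one fixing \<open>?e\<close>, and
  such an element to one fixing \<open>?f\<close> too. H is only assumed to be closed under
  products, so these factors are cancelled by inverses taken inside their root subgroups.\<close>

lemma conn_set_generates:
  assumes one: "mat 1 \<in> H" and gen: "conn_set \<subseteq> H"
    and mult: "\<And>g h. g \<in> H \<Longrightarrow> h \<in> H \<Longrightarrow> g ** h \<in> H"
  shows "G0 \<subseteq> H"
proof -
  let ?e = "vector [1, 0] :: 'a^2" and ?f = "vector [0, 1] :: 'a^2"
  have ef: "?e \<in> Lam" "?f \<in> Lam" "?e \<noteq> ?f" using Fq_closed by (auto simp: Lam_def vec2_eq_iff)
  have U: "u \<in> H" if "v \<in> Lam" "u \<in> Uset v" for u v
    using Uset_subset_conn_set[OF that] one gen by blast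
  have cancel: "g \<in> H" if "v \<in> Lam" "u \<in> Uset v" "u ** g \<in> H" for u v g
  proof -
    have "u \<in> G0" using that(2) by (simp add: Uset_def)
    then have "matrix_inv u ** (u ** g) = g" by simp
    then show ?thesis using mult[OF U[OF that(1) Uset_inv[OF that(2)]] that(3)] by simp
  qed
  have torus: "g \<in> H" if g: "g \<in> G0" "act g ?e = ?e" "act g ?f = ?f" for g
  proof (cases "sgnE (det g) = - 1")
    case True
    have "?e \<in> fixed_lines g" using g ef by (simp add: fixed_lines_def)
    from two_fixed_lines_conn_set[OF g(1) this True] show ?thesis using gen by blast
  next
    \<comment> \<open>An element of square determinant fixing both lines is the product of two such
      elements of non-square determinant; d is one of them.\<close>
    case False
    then have sg: "sgnE (det g) = 1" by (simp add: sgnE_def split: if_splits)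
    obtain r where r: "r \<in> E" "sgnE r = - 1" using ex_nonsquare by blast
    obtain a where a: "a \<noteq> 0" "a ^ q * r = a" using ex_semilinear[OF r(1)] by blast
    obtain d where d: "d \<in> G0" "det d = r" "d *v ?e = a *s ?e" "act d ?f = ?f"
      using ex_frame_map[OF ef ef r(1) a] by blast
    have de: "act d ?e = ?e" by (rule act_eqI[OF d(3) a(1) ef(1)])
    have "?e \<in> fixed_lines d" using de ef by (simp add: fixed_lines_def)
    then have dH: "d \<in> H" using two_fixed_lines_conn_set[OF d(1)] d(2) r(2) gen by blast
    have id: "matrix_inv d \<in> G0" by (rule matrix_inv_in_G0[OF d(1)])
    have "act (matrix_inv d) ?e = ?e" using act_inv[OF d(1) ef(1) ef(1)] de by simp
    then have "act (matrix_inv d ** g) ?e = ?e" using act_mult[OF g(1) ef(1)] g(2) by simp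
    then have fl: "?e \<in> fixed_lines (matrix_inv d ** g)" using ef by (simp add: fixed_lines_def)
    have "r * (det g / r) = det g" using E_nonzero[OF r(1)] by simp
    then have "sgnE r * sgnE (det g / r) = 1"
      using sgnE_mult[OF r(1) E_divide[OF det_in_E[OF g(1)] r(1)]] sg by simp
    then have "sgnE (det g / r) = - 1" using r(2) by (simp add: minus_equation_iff[of "sgnE _"])
    then have "sgnE (det (matrix_inv d ** g)) = - 1" using d by (simp add: det_inv_mult)
    from two_fixed_lines_conn_set[OF mult_in_G0[OF id g(1)] fl this]
    have "matrix_inv d ** g \<in> H" using gen by blast
    from mult[OF dH this] show ?thesis using d(1) by simp
  qed
  have borel: "g \<in> H" if g: "g \<in> G0" "act g ?e = ?e" for g
  proof -
    have w: "act g ?f \<in> Lam" by (rule act_in_Lam[OF g(1) ef(2)])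
    have "act g ?f \<noteq> ?e" using act_inj[OF g(1) ef(2,1)] g(2) ef(3) by auto
    then obtain u where u: "u \<in> Uset ?e" "act u (act g ?f) = ?f"
      using ex_Uset[OF ef(1) w ef(2)] ef(3) by auto
    have uG: "u \<in> G0" using u(1) by (simp add: Uset_def)
    have "u ** g \<in> H"
      by (rule torus[OF mult_in_G0[OF uG g(1)]])
        (simp_all add: act_mult[OF g(1)] ef g(2) u(2) Uset_act[OF ef(1) u(1)])
    then show ?thesis by (rule cancel[OF ef(1) u(1)])
  qed
  show ?thesis
  proof
    fix g assume g: "g \<in> G0"
    have w: "act g ?e \<in> Lam" by (rule act_in_Lam[OF g ef(1)])
    \<comment> \<open>An axis off both \<open>?e\<close> and its image, so that its root subgroup
      can move the image back.\<close>
    obtain v where v: "v \<in> Lam" "v \<noteq> act g ?e" "v \<noteq> ?e" using ex_other_line by blast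
    obtain u where u: "u \<in> Uset v" "act u (act g ?e) = ?e"
      using ex_Uset[OF v(1) w ef(1)] v(2,3) by auto
    have uG: "u \<in> G0" using u(1) by (simp add: Uset_def)
    have "u ** g \<in> H"
      by (rule borel[OF mult_in_G0[OF uG g]]) (simp add: act_mult[OF g] ef u(2))
    then show "g \<in> H" by (rule cancel[OF v(1) u(1)])
  qed
qed

section \<open>Transport to an arbitrary hermitian form\<close>

text \<open>A skew-hermitian form; multiplied by some \<delta> with
  \<open>\<delta> ^ q = - \<delta>\<close> it becomes hermitian, with the same isometries.\<close>

definition skew :: "'a^2 \<Rightarrow> 'a^2 \<Rightarrow> 'a" where
  "skew x y = x$1 * y$2 ^ q - x$2 * y$1 ^ q"

lemma G0_iff_skew: "A \<in> G0 \<longleftrightarrow> det A \<noteq> 0 \<and> (\<forall>x y. skew (A *v x) (A *v y) = skew x y)"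
proof
  assume A: "A \<in> G0"
  have e: "A$i$j ^ q * det A = A$i$j" for i j using A by (simp add: G0_def)
  have d: "det A \<noteq> 0" using A by (rule det_nonzero)
  have "skew (A *v x) (A *v y) = skew x y" for x y
  proof -
    have v: "((A *v y)$i) ^ q * det A = A$i$1 * y$1 ^ q + A$i$2 * y$2 ^ q" for i
    proof -
      have "((A *v y)$i) ^ q * det A = (A$i$1 ^ q * det A) * y$1 ^ q + (A$i$2 ^ q * det A) * y$2 ^ q"
        by (simp add: matrix_vector_mult_2 frobenius_add power_mult_distrib algebra_simps)
      then show ?thesis unfolding e .
    qed
    have "skew (A *v x) (A *v y) * det A
        = (A *v x)$1 * (((A *v y)$2) ^ q * det A) - (A *v x)$2 * (((A *v y)$1) ^ q * det A)"
      by (simp add: skew_def algebra_simps)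
    also have "\<dots> = skew x y * det A"
      unfolding v skew_def by (simp add: matrix_vector_mult_2 det_2 algebra_simps)
    finally show ?thesis using d by simp
  qed
  with d show "det A \<noteq> 0 \<and> (\<forall>x y. skew (A *v x) (A *v y) = skew x y)" by blast
next
  assume A: "det A \<noteq> 0 \<and> (\<forall>x y. skew (A *v x) (A *v y) = skew x y)"
  define a b c d where "a = A$1$1" and "b = A$1$2" and "c = A$2$1" and "d = A$2$2"
  have det: "det A = a * d - b * c" by (simp add: det_2 a_def b_def c_def d_def)
  have z: "(0::'a) ^ q = 0" using q_ge_3 by (simp add: power_0_left)
  have "skew (A *v vector [1, 0]) (A *v vector [1, 0]) = 0" "skew (A *v vector [1, 0]) (A *v vector [0, 1]) = 1"
    "skew (A *v vector [0, 1]) (A *v vector [1, 0]) = - 1" "skew (A *v vector [0, 1]) (A *v vector [0, 1]) = 0"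
    using A by (simp_all add: skew_def z)
  then have e: "a * c ^ q - c * a ^ q = 0" "a * d ^ q - c * b ^ q = 1" "b * c ^ q - d * a ^ q = - 1"
    "b * d ^ q - d * b ^ q = 0"
    by (simp_all add: skew_def matrix_vector_mult_2 a_def b_def c_def d_def)
  \<comment> \<open>Here x' and w' stand for q-th powers of entries. The form values on unit vectors
    are linear equations in them with determinant x z - y w up to sign; Cramer's rule gives the
    condition in \<open>G0\<close>.\<close>
  have 1: "x' * (x * z - y * w) = x \<and> w' * (x * z - y * w) = w"
    if "x * w' - w * x' = 0" "y * w' - z * x' = - 1" for x x' y z w w' :: 'a
    using that by algebra
  have 2: "y' * (x * z - y * w) = y \<and> z' * (x * z - y * w) = z"
    if "x * z' - w * y' = 1" "y * z' - z * y' = 0" for x y y' z z' w :: 'a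
    using that by algebra
  have "a ^ q * det A = a \<and> c ^ q * det A = c" "b ^ q * det A = b \<and> d ^ q * det A = d"
    unfolding det by (rule 1[OF e(1,3)], rule 2[OF e(2,4)])
  then show "A \<in> G0" using A by (simp add: G0_def forall_2 a_def b_def c_def d_def)
qed

end

locale unitary_plane = quad_field q fld for q and fld :: "'a::{field,finite} itself" +
  fixes f :: "'a^2 \<Rightarrow> 'a^2 \<Rightarrow> 'a"
  assumes herm: "hermitian_form q f" and nondeg: "nondegenerate_form f"
begin

lemma f_add_left: "f (u + v) w = f u w + f v w"
  and f_scale_left: "f (c *s u) v = c * f u v"
  and f_swap: "f v u = f u v ^ q"
  using herm unfolding hermitian_form_def by blast+

lemma f_add_right: "f u (v + w) = f u v + f u w"
proof -
  have "f u (v + w) = f (v + w) u ^ q" by (rule f_swap)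
  also have "\<dots> = f v u ^ q + f w u ^ q" unfolding f_add_left frobenius_add ..
  also have "\<dots> = f u v + f u w" by (simp only: f_swap[of u v] f_swap[of u w])
  finally show ?thesis .
qed

lemma f_scale_right: "f u (c *s v) = c ^ q * f u v"
proof -
  have "f u (c *s v) = f (c *s v) u ^ q" by (rule f_swap)
  also have "\<dots> = c ^ q * f v u ^ q" unfolding f_scale_left power_mult_distrib ..
  also have "\<dots> = c ^ q * f u v" by (simp only: f_swap[of u v])
  finally show ?thesis .
qed

lemma f_self_in_Fq: "f u u \<in> Fq"
  unfolding Fq_def mem_Collect_eq by (rule f_swap[symmetric])

text \<open>If the first unit vector u is anisotropic, take w orthogonal to u. Isotropy of x u + w
  is then a norm equation for x, solvable because the norm maps onto \<open>Fq\<close>.\<close>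

lemma ex_isotropic: "\<exists>e. e \<noteq> 0 \<and> f e e = 0"
proof (cases "f (vector [1, 0]) (vector [1, 0]) = 0")
  case True
  then show ?thesis by (intro exI[of _ "vector [1, 0]"]) (simp add: vec2_eq_iff)
next
  case False
  let ?u = "vector [1, 0] :: 'a^2"
  define \<alpha> where "\<alpha> = f ?u ?u"
  define m where "m = - (f (vector [0, 1]) ?u / \<alpha>)"
  define w where "w = vector [0, 1] + m *s ?u"
  have \<alpha>: "\<alpha> \<noteq> 0" using False by (simp add: \<alpha>_def)
  have wu: "f w ?u = 0" 
    unfolding w_def f_add_left f_scale_left \<alpha>_def[symmetric] m_def using \<alpha> by simp
  have uw: "f ?u w = 0" unfolding f_swap[of ?u w] wu using q_ge_3 by (simp add: power_0_left)
  have w2: "w$2 = 1" by (simp add: w_def)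
  show ?thesis
  proof (cases "f w w = 0")
    case True
    have "w \<noteq> 0" using w2 by auto
    then show ?thesis using True by blast
  next
    case F: False
    have "- (f w w / \<alpha>) \<in> Fq" "- (f w w / \<alpha>) \<noteq> 0"
      using f_self_in_Fq F \<alpha> by (simp_all add: \<alpha>_def Fq_closed)
    from norm_surj[OF this] obtain x where x: "x ^ q * x = - (f w w / \<alpha>)" by blast
    have "f (x *s ?u + w) (x *s ?u + w) = x ^ q * x * \<alpha> + f w w"
      by (simp add: f_add_left f_add_right f_scale_left f_scale_right wu uw mult_ac flip: \<alpha>_def)
    also have "\<dots> = 0" unfolding x using \<alpha> by simp
    finally have "f (x *s ?u + w) (x *s ?u + w) = 0" .
    moreover have "(x *s ?u + w)$2 = 1" using w2 by simp
    then have "x *s ?u + w \<noteq> 0" by (metis zero_index zero_neq_one)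
    ultimately show ?thesis by blast
  qed
qed

lemma ex_skew_basis: "\<exists>P \<delta>. det P \<noteq> 0 \<and> \<delta> \<noteq> 0 \<and> (\<forall>x y. f (P *v x) (P *v y) = \<delta> * skew x y)"
proof -
  obtain e1 where e1: "e1 \<noteq> 0" "f e1 e1 = 0" using ex_isotropic by blast
  have "\<not> (\<forall>v. f e1 v = 0)"
  proof
    assume "\<forall>v. f e1 v = 0"
    from mp[OF nondeg[unfolded nondegenerate_form_def, THEN spec, of e1] this] show False using e1(1) by simp
  qed
  then obtain w where w: "f e1 w \<noteq> 0" unfolding not_all by (elim exE)
  \<comment> \<open>A multiple of \<open>skew\<close> is hermitian only if the Frobenius map negates
    the factor; a nonzero such factor exists because -1 lies in \<open>E\<close>.\<close>
  from ex_semilinear[OF minus_one_in_E] obtain \<delta> :: 'a where "\<delta> \<noteq> 0 \<and> \<delta> ^ q * (- 1) = \<delta>" ..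
  then have \<delta>: "\<delta> \<noteq> 0" "\<delta> ^ q * (- 1) = \<delta>" by (rule conjunct1, rule conjunct2)
  have "- (\<delta> ^ q) = \<delta>" using \<delta>(2) unfolding mult_minus1_right .
  then have \<delta>q: "\<delta> ^ q = - \<delta>" by (rule minus_equation_iff[THEN iffD1, symmetric])
  define v where "v = ((\<delta> / f e1 w) ^ q) *s w"
  have e1v: "f e1 v = \<delta>" using w by (simp add: v_def f_scale_right frobenius_twice)
  have ve1: "f v e1 = - \<delta>" unfolding f_swap[of v e1] e1v \<delta>q ..
  define \<gamma> where "\<gamma> = f v v"
  have \<gamma>: "\<gamma> ^ q = \<gamma>" using f_self_in_Fq by (simp add: \<gamma>_def Fq_def)
  \<comment> \<open>Makes v + k e1 isotropic: k \<delta> and its conjugate each cancel half of f v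
    v.\<close>
  define k where "k = - (\<gamma> / 2) / \<delta>"
  have k\<delta>: "k * \<delta> = - (\<gamma> / 2)" using \<delta>(1) by (simp add: k_def)
  have "(2::'a) ^ q = 2" using numeral_in_Fq[of "num.Bit0 num.One"] by (simp add: Fq_def)
  then have kq: "k ^ q * (- \<delta>) = - (\<gamma> / 2)"
    unfolding \<delta>q[symmetric] power_mult_distrib[symmetric] k\<delta> frobenius_minus power_divide \<gamma> by simp
  define e2 where "e2 = v + k *s e1"
  have z: "(0::'a) ^ q = 0" using q_ge_3 by (simp add: power_0_left)
  have e12: "f e1 e2 = \<delta>" by (simp add: e2_def f_add_right f_scale_right e1 e1v)
  have e21: "f e2 e1 = - \<delta>" by (simp add: e2_def f_add_left f_scale_left e1 ve1)
  have "f e2 e2 = \<gamma> + k * \<delta> + k ^ q * (- \<delta>)"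
    by (simp add: e2_def f_add_right f_add_left f_scale_right f_scale_left e1 e1v ve1 flip: \<gamma>_def)
  also have "\<dots> = \<gamma> - (\<gamma> / 2 + \<gamma> / 2)" unfolding k\<delta> kq by simp
  also have "\<gamma> / 2 + \<gamma> / 2 = \<gamma>"
  proof -
    have "\<gamma> / 2 + \<gamma> / 2 = 2 * (\<gamma> / 2)" by (simp only: mult_2)
    then show ?thesis using two_neq_zero by simp
  qed
  finally have e22: "f e2 e2 = 0" by simp
  define P where "P = mat2 (e1$1) (e2$1) (e1$2) (e2$2)"
  have Pv: "P *v x = x$1 *s e1 + x$2 *s e2" for x
    by (simp add: P_def vec2_eq_iff matrix_vector_mult_2 mult.commute)
  have form: "f (P *v x) (P *v y) = \<delta> * skew x y" for x y
    unfolding Pv by (simp add: f_add_left f_add_right f_scale_left f_scale_right e1 e12 e21 e22 skew_def algebra_simps)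
  have "det P = cross2 e1 e2" unfolding P_def by (rule columns_mult(1))
  moreover have "cross2 e1 e2 \<noteq> 0"
  proof
    assume "cross2 e1 e2 = 0"
    then obtain c where "e2 = c *s e1" using cross2_zero_scale e1(1) by blast
    then have "f e1 e2 = 0" by (simp add: f_scale_right e1)
    then show False using e12 \<delta>(1) by simp
  qed
  ultimately show ?thesis using \<delta>(1) form by (intro exI[of _ P] exI[of _ \<delta>]) simp
qed

text \<open>Its columns form an isotropic basis, chosen once so that conjugation by it is a constant
  of the locale.\<close>

definition P :: "'a^2^2" where
  "P = (SOME P. det P \<noteq> 0 \<and> (\<exists>\<delta>. \<delta> \<noteq> 0 \<and> (\<forall>x y. f (P *v x) (P *v y) = \<delta> * skew x y)))"

definition Q :: "'a^2^2" where "Q = matrix_inv P"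

lemma P_props: "det P \<noteq> 0 \<and> (\<exists>\<delta>. \<delta> \<noteq> 0 \<and> (\<forall>x y. f (P *v x) (P *v y) = \<delta> * skew x y))"
  unfolding P_def by (rule someI_ex) (use ex_skew_basis in blast)

lemma PQ: "P ** Q = mat 1" "Q ** P = mat 1"
proof -
  have "invertible P" using P_props by (simp add: invertible_det_nz)
  then have "P ** Q = mat 1 \<and> Q ** P = mat 1"
    unfolding Q_def invertible_def matrix_inv_def by (rule someI_ex)
  then show "P ** Q = mat 1" "Q ** P = mat 1" by auto
qed

definition \<phi> :: "'a^2^2 \<Rightarrow> 'a^2^2" where "\<phi> A = P ** A ** Q"

lemma PQ_cancel: "P ** (Q ** A) = A" "Q ** (P ** A) = A" "A ** P ** Q = A" "A ** Q ** P = A"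
  by (simp_all add: PQ matrix_mul_assoc) (simp_all add: PQ flip: matrix_mul_assoc)

lemma \<phi>_mult: "\<phi> (A ** B) = \<phi> A ** \<phi> B"
  unfolding \<phi>_def matrix_mul_assoc PQ_cancel ..

lemma \<phi>_one: "\<phi> (mat 1) = mat 1" by (simp add: \<phi>_def PQ)

lemma \<phi>_inverse: "\<phi> (Q ** A ** P) = A" "Q ** \<phi> A ** P = A"
  by (simp_all add: \<phi>_def matrix_mul_assoc PQ PQ_cancel)

lemma \<phi>_eq_iff: "\<phi> A = \<phi> B \<longleftrightarrow> A = B"
  using \<phi>_inverse(2) by metis

lemma \<phi>_uminus: "\<phi> (- A) = - \<phi> A"
  by (simp add: \<phi>_def mat2_eq_iff matrix_mult_2 algebra_simps)

lemma det_PQ: "det P * det Q = 1"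
  unfolding det_mul[symmetric] PQ by (rule det_I)

lemma det_\<phi>: "det (\<phi> A) = det A"
proof -
  have "det (\<phi> A) = det A * (det P * det Q)" unfolding \<phi>_def det_mul by (simp only: mult_ac)
  then show ?thesis unfolding det_PQ by simp
qed

lemma \<phi>_in_carrier_iff: "\<phi> A \<in> carrier (unitary_group f) \<longleftrightarrow> A \<in> G0"
proof -
  from conjunct2[OF P_props] obtain \<delta>
    where *: "\<delta> \<noteq> 0 \<and> (\<forall>x y. f (P *v x) (P *v y) = \<delta> * skew x y)" ..
  have \<delta>0: "\<delta> \<noteq> 0" using * by (rule conjunct1)
  have \<delta>: "f (P *v x) (P *v y) = \<delta> * skew x y" for x y
    by (rule conjunct2[OF *, THEN spec, THEN spec])
  have \<phi>P: "\<phi> A *v (P *v x) = P *v (A *v x)" for x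
    by (simp add: \<phi>_def matrix_vector_mul_assoc PQ_cancel)
  have "(\<forall>u v. f (\<phi> A *v u) (\<phi> A *v v) = f u v) \<longleftrightarrow> (\<forall>x y. skew (A *v x) (A *v y) = skew x y)"
  proof
    assume *: "\<forall>u v. f (\<phi> A *v u) (\<phi> A *v v) = f u v"
    show "\<forall>x y. skew (A *v x) (A *v y) = skew x y"
    proof (intro allI)
      fix x y
      have "\<delta> * skew (A *v x) (A *v y) = \<delta> * skew x y"
        using *[rule_format, of "P *v x" "P *v y"] unfolding \<phi>P \<delta> .
      then show "skew (A *v x) (A *v y) = skew x y" using \<delta>0 by simp
    qed
  next
    assume *: "\<forall>x y. skew (A *v x) (A *v y) = skew x y"
    show "\<forall>u v. f (\<phi> A *v u) (\<phi> A *v v) = f u v"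
    proof (intro allI)
      fix u v
      have PQv: "P *v (Q *v x) = x" for x by (simp add: matrix_vector_mul_assoc PQ)
      have "f (\<phi> A *v (P *v (Q *v u))) (\<phi> A *v (P *v (Q *v v))) = f (P *v (Q *v u)) (P *v (Q *v v))"
        unfolding \<phi>P \<delta> using * by simp
      then show "f (\<phi> A *v u) (\<phi> A *v v) = f u v" unfolding PQv .
    qed
  qed
  then show ?thesis
    unfolding unitary_group_def general_linear_group_def G0_iff_skew
    by (simp add: invertible_det_nz det_\<phi>)
qed

lemma carrier_eq: "carrier (unitary_group f) = \<phi> ` G0"
proof (intro equalityI subsetI)
  fix B assume B: "B \<in> carrier (unitary_group f)"
  have "\<phi> (Q ** B ** P) = B" by (rule \<phi>_inverse)
  moreover from this B have "Q ** B ** P \<in> G0" using \<phi>_in_carrier_iff[of "Q ** B ** P"] by simp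
  ultimately show "B \<in> \<phi> ` G0" by (metis imageI)
qed (use \<phi>_in_carrier_iff in auto)

lemma mult_eq: "A \<otimes>\<^bsub>unitary_group f\<^esub> B = A ** B" and one_eq: "\<one>\<^bsub>unitary_group f\<^esub> = mat 1"
  by (simp_all add: unitary_group_def general_linear_group_def)

lemma inv_\<phi>:
  assumes "A \<in> G0"
  shows "inv\<^bsub>unitary_group f\<^esub> (\<phi> A) = \<phi> (matrix_inv A)"
  unfolding m_inv_def mult_eq one_eq
proof (rule the_equality)
  show "\<phi> (matrix_inv A) \<in> carrier (unitary_group f) \<and> \<phi> A ** \<phi> (matrix_inv A) = mat 1
      \<and> \<phi> (matrix_inv A) ** \<phi> A = mat 1"
    using assms by (simp add: \<phi>_in_carrier_iff matrix_inv_in_G0 inv_left inv_right \<phi>_one flip: \<phi>_mult)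
  fix y assume y: "y \<in> carrier (unitary_group f) \<and> \<phi> A ** y = mat 1 \<and> y ** \<phi> A = mat 1"
  have "y = y ** (\<phi> A ** \<phi> (matrix_inv A))"
    using assms by (simp add: inv_right \<phi>_one flip: \<phi>_mult)
  also have "\<dots> = \<phi> (matrix_inv A)" using y by (simp add: matrix_mul_assoc)
  finally show "y = \<phi> (matrix_inv A)" .
qed

lemma similar_\<phi>: "similar_matrix (\<phi> A) B \<longleftrightarrow> similar_matrix A B"
proof
  assume *: "similar_matrix (\<phi> A) B"
  obtain R where R: "det R \<noteq> 0" "\<phi> A ** R = R ** B" using similar_matrixE[OF *] .
  have "A ** (Q ** R) = Q ** (\<phi> A ** R)" by (simp add: \<phi>_def matrix_mul_assoc PQ)
  also have "\<dots> = (Q ** R) ** B" by (simp add: R(2) matrix_mul_assoc)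
  finally show "similar_matrix A B"
    using R(1) det_PQ by (intro similar_matrixI[of "Q ** R"]) (auto simp: det_mul)
next
  assume *: "similar_matrix A B"
  obtain R where R: "det R \<noteq> 0" "A ** R = R ** B" using similar_matrixE[OF *] .
  have "\<phi> A ** (P ** R) = P ** (A ** R)" by (simp add: \<phi>_def matrix_mul_assoc PQ_cancel)
  also have "\<dots> = (P ** R) ** B" by (simp add: R(2) matrix_mul_assoc)
  finally show "similar_matrix (\<phi> A) B"
    using R(1) det_PQ by (intro similar_matrixI[of "P ** R"]) (auto simp: det_mul)
qed

lemma \<phi>_in_connection_set_iff: "\<phi> A \<in> connection_set q f \<longleftrightarrow> A \<in> conn_set"
  by (simp add: connection_set_def conn_set_def \<phi>_in_carrier_iff similar_\<phi>)

section \<open>Perfect state transfer and connectedness of the Cayley graph\<close>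

abbreviation \<Gamma> :: "('a^2^2) pair_pre_digraph" where
  "\<Gamma> \<equiv> Cay (unitary_group f) (connection_set q f)"

lemma pverts_\<Gamma>: "pverts \<Gamma> = \<phi> ` G0"
  by (simp add: Cay_def carrier_eq)

lemma arc_iff:
  assumes "u \<in> G0" "v \<in> G0"
  shows "(\<phi> u, \<phi> v) \<in> parcs \<Gamma> \<longleftrightarrow> v ** matrix_inv u \<in> conn_set"
  using assms by (simp add: Cay_def \<phi>_in_carrier_iff mult_eq inv_\<phi> \<phi>_in_connection_set_iff flip: \<phi>_mult)

text \<open>A column of a matrix power is an iterate of the adjacency operator on a unit mass, which
  turns the entries of the matrix exponential into the series of
  \<open>transition_sums\<close>.\<close>

lemma mat_power_eq:
  assumes "u \<in> G0"
  shows "mat_power (pverts \<Gamma>) (\<lambda>u v. c * adjacency_matrix \<Gamma> u v) k (\<phi> u) (\<phi> a)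
    = c ^ k * (kop conn_kernel ^^ k) (\<lambda>y. of_bool (y = a)) u"
  using assms
proof (induction k arbitrary: u)
  case 0
  then show ?case by (simp add: \<phi>_eq_iff)
next
  case (Suc k)
  let ?w = "(kop conn_kernel ^^ k) (\<lambda>y. of_bool (y = a))"
  have inj: "inj_on \<phi> G0" by (auto simp: inj_on_def \<phi>_eq_iff)
  have "mat_power (pverts \<Gamma>) (\<lambda>u v. c * adjacency_matrix \<Gamma> u v) (Suc k) (\<phi> u) (\<phi> a)
      = (\<Sum>v\<in>G0. c * adjacency_matrix \<Gamma> (\<phi> u) (\<phi> v) * (c ^ k * ?w v))"
    unfolding pverts_\<Gamma> mat_power.simps sum.reindex[OF inj] o_def
    by (intro sum.cong refl) (simp add: Suc.IH[unfolded pverts_\<Gamma>])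
  also have "\<dots> = (\<Sum>v\<in>G0. c ^ Suc k * (conn_kernel (v ** matrix_inv u) * ?w v))"
    by (intro sum.cong refl) (simp add: adjacency_matrix_def arc_iff[OF Suc.prems] conn_kernel_def)
  \<comment> \<open>Writing the neighbour v as g u turns \<open>v ** matrix_inv u\<close> into
    g.\<close>
  also have "\<dots> = (\<Sum>g\<in>G0. c ^ Suc k * (conn_kernel (g ** u ** matrix_inv u) * ?w (g ** u)))"
    by (rule sum_right_mult[OF Suc.prems, symmetric])
  also have "\<dots> = c ^ Suc k * kop conn_kernel ?w u"
    using Suc.prems by (simp add: kop_def sum_distrib_left)
  finally show ?case by simp
qed

lemma pst:
  assumes x: "x \<in> carrier (unitary_group f)"
  shows "perfect_state_transfer \<Gamma> x (x \<otimes>\<^bsub>unitary_group f\<^esub> (- mat 1))"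
proof -
  obtain a where a: "a \<in> G0" "x = \<phi> a" using x unfolding carrier_eq by blast
  have b: "x \<otimes>\<^bsub>unitary_group f\<^esub> (- mat 1) = \<phi> (- a)"
    unfolding mult_eq a(2) \<phi>_uminus by (simp flip: uminus_eq_mult)
  have ne: "a \<noteq> - a"
  proof
    assume "a = - a"
    from arg_cong[OF this, of "\<lambda>A. A$i$j" for i j]
    have e: "a$i$j = - (a$i$j)" for i j unfolding vector_uminus_component .
    have "2 * a$i$j = 0" for i j
    proof -
      have "2 * a$i$j = a$i$j - - (a$i$j)" by simp
      then show ?thesis unfolding e[of i j, symmetric] by simp
    qed
    then have "a$i$j = 0" for i j using two_neq_zero by simp
    then have "det a = 0" by (simp add: det_2)
    then show False using det_nonzero[OF a(1)] by simp
  qed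
  have tm: "transition_matrix \<Gamma> (pi / 2) v x = - 1 * of_bool (v = \<phi> (- a))" if v: "v \<in> pverts \<Gamma>" for v
  proof -
    obtain u where u: "u \<in> G0" "v = \<phi> u" using v unfolding pverts_\<Gamma> by blast
    have "transition_matrix \<Gamma> (pi / 2) v x = (\<Sum>n. (- \<i> * complex_of_real (pi / 2)) ^ n
        * (kop conn_kernel ^^ n) (\<lambda>y. of_bool (y = a)) u / fact n)"
      unfolding transition_matrix_def mat_exp_def u(2) a(2) mat_power_eq[OF u(1)] ..
    also have "\<dots> = - of_bool (u = - a)" by (rule sums_unique[OF transition_sums, symmetric])
    finally show ?thesis by (simp add: u(2) \<phi>_eq_iff)
  qed
  have "x \<in> pverts \<Gamma>" "\<phi> (- a) \<in> pverts \<Gamma>" unfolding pverts_\<Gamma> using a uminus_in_G0 by auto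
  moreover have "x \<noteq> \<phi> (- a)" using ne by (simp add: a(2) \<phi>_eq_iff)
  moreover have "cmod (- 1) = 1" by simp
  ultimately show ?thesis unfolding perfect_state_transfer_def b using tm by blast
qed

text \<open>Reachability in a digraph is \<open>rtrancl_on\<close>, which also demands that the
  visited points are vertices.\<close>

lemma rtrancl_on_of_rtrancl:
  assumes "(u, v) \<in> r\<^sup>*" "u \<in> V" "r \<subseteq> V \<times> V"
  shows "(u, v) \<in> rtrancl_on V r"
  using assms(1)
proof induction
  case base
  then show ?case using assms(2) by (rule rtrancl_on_refl)
next
  case (step y z)
  then show ?case using assms(3) by (auto intro: rtrancl_on_into_rtrancl_on)
qed

lemma connected_\<Gamma>: "Digraph_Component.connected (with_proj \<Gamma>)"
proof -
  \<comment> \<open>The elements h such that a walk leads from every u to h u; they contain the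
    connection set and are closed under products.\<close>
  let ?H = "{h \<in> G0. \<forall>u\<in>G0. (\<phi> u, \<phi> (h ** u)) \<in> (parcs \<Gamma>)\<^sup>*}"
  have "G0 \<subseteq> ?H"
  proof (rule conn_set_generates)
    show "mat 1 \<in> ?H" using one_in_G0 by simp
    show "conn_set \<subseteq> ?H"
    proof
      fix s assume s: "s \<in> conn_set"
      then have sG: "s \<in> G0" by (simp add: conn_set_def)
      have "(\<phi> u, \<phi> (s ** u)) \<in> parcs \<Gamma>" if u: "u \<in> G0" for u
        using arc_iff[OF u mult_in_G0[OF sG u]] s u by simp
      then show "s \<in> ?H" using sG by blast
    qed
    fix g h assume g: "g \<in> ?H" and h: "h \<in> ?H"
    have "(\<phi> u, \<phi> (g ** h ** u)) \<in> (parcs \<Gamma>)\<^sup>*" if u: "u \<in> G0" for u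
    proof -
      have "(\<phi> u, \<phi> (h ** u)) \<in> (parcs \<Gamma>)\<^sup>*" using h u by blast
      also have "(\<phi> (h ** u), \<phi> (g ** (h ** u))) \<in> (parcs \<Gamma>)\<^sup>*" using g h mult_in_G0[of h u] u by blast
      finally show ?thesis by (simp add: matrix_mul_assoc)
    qed
    then show "g ** h \<in> ?H" using g h mult_in_G0 by blast
  qed
  have reach: "(x, y) \<in> (parcs \<Gamma>)\<^sup>*" if x: "x \<in> pverts \<Gamma>" and y: "y \<in> pverts \<Gamma>" for x y
  proof -
    obtain u where u: "x = \<phi> u" "u \<in> G0" using x unfolding pverts_\<Gamma> by (rule imageE)
    obtain v where v: "y = \<phi> v" "v \<in> G0" using y unfolding pverts_\<Gamma> by (rule imageE)
    have "v ** matrix_inv u \<in> ?H" using \<open>G0 \<subseteq> ?H\<close> mult_in_G0[OF v(2) matrix_inv_in_G0[OF u(2)]] by (rule subsetD)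
    then have "(\<phi> u, \<phi> (v ** matrix_inv u ** u)) \<in> (parcs \<Gamma>)\<^sup>*" using u(2) by blast
    then show ?thesis using u v by simp
  qed
  \<comment> \<open>Connectedness is strong connectedness of the symmetrised digraph, whose arcs
    include those of \<Gamma>.\<close>
  let ?M = "parcs (mk_symmetric (with_proj \<Gamma>))"
  have sub: "parcs \<Gamma> \<subseteq> ?M" by (auto simp: parcs_mk_symmetric)
  have wf: "?M \<subseteq> pverts \<Gamma> \<times> pverts \<Gamma>" by (auto simp: parcs_mk_symmetric Cay_def)
  have "(x, y) \<in> rtrancl_on (pverts \<Gamma>) ?M" if "x \<in> pverts \<Gamma>" "y \<in> pverts \<Gamma>" for x y
    using rtrancl_on_of_rtrancl[OF _ that(1) wf] rtrancl_mono[OF sub] reach[OF that] by blast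
  moreover have "pverts \<Gamma> \<noteq> {}" unfolding pverts_\<Gamma> using one_in_G0 by blast
  ultimately show ?thesis
    unfolding Digraph_Component.connected_def strongly_connected_def reachable_def by simp
qed

end

theorem theorem4p15:
  fixes q :: nat
    and f :: "'a::{field,finite}^2 \<Rightarrow> 'a^2 \<Rightarrow> 'a"
  assumes "primepow q" and "odd q"
    and "CARD('a) = q ^ 2"
    and "hermitian_form q f" and "nondegenerate_form f"
  shows "Digraph_Component.connected (with_proj (Cay (unitary_group f) (connection_set q f))) \<and>
    (\<forall>x\<in>carrier (unitary_group f).
       perfect_state_transfer (Cay (unitary_group f) (connection_set q f))
         x (x \<otimes>\<^bsub>unitary_group f\<^esub> (- mat 1)))"
proof -
  interpret unitary_plane q "TYPE('a)" f by unfold_locales (rule assms)+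
  show ?thesis using connected_\<Gamma> pst by blast
qed

end
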